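(* Let $q$ be a $Q$-function such that $\sup_{t\in[T_0,s[}q(x,t)<\infty$ for each $s\in\,]T_0,T_1[$ and $x\in\mathbf{X}$. Then the transition function $\bar P$ is the minimal function in $\hat{\mathcal{P}}$ among functions $P\in\hat{\mathcal{P}}$ satisfying the following two properties: (i) for all $u\in[T_0,T_1[$, $s\in\,]u,T_1[$, $x\in\mathbf{X}$, and $(q,s)$-bounded sets $B$, $\lim_{t\to u+}P(u,x;t,B)=\mathbf{I}\{x\in B\}$, and the function $t\mapsto P(u,x;t,B)$ is absolutely continuous in $t\in\,]u,s[$; (ii) for all $u\in[T_0,T_1[$, $s\in\,]u,T_1[$, $x\in\mathbf{X}$, and $(q,s)$-bounded sets $B$, Kolmogorov's forward equation $$\frac{\partial}{\partial t}P(u,x;t,B)=-\int_B q(y,t)P(u,x;t,dy)+\int_{\mathbf{X}}q(y,t,B\setminus\{y\})P(u,x;t,dy)$$ holds for almost every $t\in\,]u,s[$. In addition, if the transition function $\bar P$ is regular (that is, $\bar P(u,x;t,\mathbf{X})=1$ for all $u\in[T_0,T_1[$, $t\in\,]u,T_1[$, $x\in\mathbf{X}$), then $\bar P$ is the unique function in $\hat{\mathcal{P}}$ satisfying properties (i) and (ii) and taking values in $[0,1]$.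
   Context: Intervals: $]a,b[$ and $[a,b[$ denote open and half-open intervals. $(\mathbf{X},\mathfrak{B}(\mathbf{X}))$ is a standard Borel space; $0\le T_0<T_1\le\infty$; measurability means Borel measurability. $Q$-function: a function $q(x,t,B)$, $x\in\mathbf{X}$, $t\in[T_0,T_1[$, $B\in\mathfrak{B}(\mathbf{X})$, such that (a) for all $x,t$, $q(x,t,\cdot)$ is a (finite) signed measure with $q(x,t,\mathbf{X})\le 0$ and $0\le q(x,t,B\setminus\{x\})<\infty$ for all $B$; (b) for each $B$, $q(x,t,B)$ is measurable in $(x,t)$. Standing assumption: $q$ is conservative, i.e. $q(x,t,\mathbf{X})=0$ for all $x,t$. Put $q(x,t):=-q(x,t,\{x\})$ and $q^+(x,t,B):=q(x,t,B\setminus\{x\})$. The function $\bar P$ (which under the hypothesis of the claim is known to be a transition function, i.e. $[0,1]$-valued, a measure in $B$, measurable in $(u,x,t)$, and satisfying the Chapman–Kolmogorov equation): for $x\in\mathbf{X}$, $u\in[T_0,T_1[$, $t\in\,]u,T_1[$, $B\in\mathfrak{B}(\mathbf{X})$, $\bar P^{(0)}(u,x;t,B):=\mathbf{I}\{x\in B\}e^{-\int_u^t q(x,s)ds}$, $\bar P^{(n)}(u,x;t,B):=\int_u^t\int_{\mathbf{X}}e^{-\int_u^w q(x,\theta)d\theta}\,\bar P^{(n-1)}(w,y;t,B)\,q^+(x,w,dy)\,dw$ for $n\ge1$, and $\bar P:=\sum_{n=0}^\infty\bar P^{(n)}$. $\hat{\mathcal{P}}$ is the family of real-valued functions $P(u,x;t,B)$,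 defined for all $u\in[T_0,T_1[$, $t\in\,]u,T_1[$, $x\in\mathbf{X}$, $B\in\mathfrak{B}(\mathbf{X})$, which are (non-negative, finite) measures on $(\mathbf{X},\mathfrak{B}(\mathbf{X}))$ for fixed $u,x,t$ and measurable in $t$ for fixed $u,x,B$. For $s\in\,]T_0,T_1]$, a set $B\in\mathfrak{B}(\mathbf{X})$ is called $(q,s)$-bounded if the function $q(x,t)$ is bounded on $B\times[T_0,s[$. A function $f$ is minimal in a family $\mathcal{A}$ of functions on a common set $E$ if $f\in\mathcal{A}$ and $f\le g$ pointwise on $E$ for every $g\in\mathcal{A}$; "the minimal function satisfying given properties" means the minimal element of the subfamily of functions with those properties (in particular it has them). A differential equation "holds" at a point if the derivative exists there and the equality holds between finite numbers (in particular the integrals are finite). *)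

theory Defs
  imports "HOL-Analysis.Analysis"
begin

text \<open>Measurable spaces are encoded by the library type of measures; only \<^const>\<open>space\<close> and
  \<^const>\<open>sets\<close> of \<open>X\<close> are used, its measure function is irrelevant.\<close>

definition standard_borel :: "'a measure \<Rightarrow> bool" where
  "standard_borel X \<longleftrightarrow>
    (\<exists>T. completely_metrizable_space T \<and> second_countable T \<and> topspace T = space X \<and>
         sets X = sigma_sets (topspace T) {U. openin T U})"

definition signed_measure :: "'a measure \<Rightarrow> ('a set \<Rightarrow> real) \<Rightarrow> bool" where
  "signed_measure X \<mu> \<longleftrightarrow> \<mu> {} = 0 \<and>
    (\<forall>A::nat \<Rightarrow> 'a set. range A \<subseteq> sets X \<and> disjoint_family A \<longrightarrow>
       (\<lambda>n. \<mu> (A n)) sums \<mu> (\<Union>n. A n))"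

text \<open>A non-negative real-valued set function as a measure to integrate against. As always with
  \<^const>\<open>measure_of\<close>, this is meaningful only if the set function is countably additive
  on \<open>sets X\<close>, which holds wherever it is used below.\<close>

definition to_measure :: "'a measure \<Rightarrow> ('a set \<Rightarrow> real) \<Rightarrow> 'a measure" where
  "to_measure X \<mu> = measure_of (space X) (sets X) (\<lambda>B. ennreal (\<mu> B))"

definition time_dom :: "real \<Rightarrow> ereal \<Rightarrow> real set" where
  "time_dom T0 T1 = {t. T0 \<le> t \<and> ereal t < T1}"

type_synonym 'a rate_fun = "'a \<Rightarrow> real \<Rightarrow> 'a set \<Rightarrow> real"

definition Q_function :: "'a measure \<Rightarrow> real \<Rightarrow> ereal \<Rightarrow> 'a rate_fun \<Rightarrow> bool" where
  "Q_function X T0 T1 q \<longleftrightarrow>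
    (\<forall>x\<in>space X. \<forall>t\<in>time_dom T0 T1.
       signed_measure X (q x t) \<and> q x t (space X) \<le> 0 \<and>
       (\<forall>B\<in>sets X. 0 \<le> q x t (B - {x}))) \<and>
    (\<forall>B\<in>sets X. (\<lambda>(x, t). q x t B)
       \<in> borel_measurable (X \<Otimes>\<^sub>M restrict_space borel (time_dom T0 T1)))"

definition conservative :: "'a measure \<Rightarrow> real \<Rightarrow> ereal \<Rightarrow> 'a rate_fun \<Rightarrow> bool" where
  "conservative X T0 T1 q \<longleftrightarrow> (\<forall>x\<in>space X. \<forall>t\<in>time_dom T0 T1. q x t (space X) = 0)"

definition exit_rate :: "'a rate_fun \<Rightarrow> 'a \<Rightarrow> real \<Rightarrow> real" where
  "exit_rate q x t = - q x t {x}"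

definition q_plus :: "'a rate_fun \<Rightarrow> 'a \<Rightarrow> real \<Rightarrow> 'a set \<Rightarrow> real" where
  "q_plus q x t B = q x t (B - {x})"

text \<open>The value of the exponent is meant only when \<open>exit_rate q x\<close> is integrable over
  \<open>[u, t]\<close>; this is the case whenever it is bounded on \<open>[T0, s[\<close> for all \<open>s\<close> in \<open>]T0, T1[\<close>
  and \<open>T0 \<le> u\<close>, \<open>t < T1\<close>.\<close>

definition survival :: "'a rate_fun \<Rightarrow> 'a \<Rightarrow> real \<Rightarrow> real \<Rightarrow> real" where
  "survival q x u t = exp (- (LINT s:{u..t}|lborel. exit_rate q x s))"

text \<open>All integrands and summands are non-negative, so the iterates and their sum are formed in
  \<^typ>\<open>ennreal\<close>, where they always make sense.\<close>

primrec Pbar_iter ::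
  "'a measure \<Rightarrow> 'a rate_fun \<Rightarrow> nat \<Rightarrow> real \<Rightarrow> 'a \<Rightarrow> real \<Rightarrow> 'a set \<Rightarrow> ennreal" where
  "Pbar_iter X q 0 u x t B = indicator B x * ennreal (survival q x u t)"
| "Pbar_iter X q (Suc n) u x t B =
    (\<integral>\<^sup>+ w \<in> {u<..<t}.
       (\<integral>\<^sup>+ y. ennreal (survival q x u w) * Pbar_iter X q n w y t B
          \<partial>to_measure X (q_plus q x w)) \<partial>lborel)"

definition Pbar_series ::
  "'a measure \<Rightarrow> 'a rate_fun \<Rightarrow> real \<Rightarrow> 'a \<Rightarrow> real \<Rightarrow> 'a set \<Rightarrow> ennreal" where
  "Pbar_series X q u x t B = (\<Sum>n. Pbar_iter X q n u x t B)"

type_synonym 'a trans_fun = "real \<Rightarrow> 'a \<Rightarrow> real \<Rightarrow> 'a set \<Rightarrow> real"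

text \<open>\<^const>\<open>enn2real\<close> maps \<open>\<infinity>\<close> to \<open>0\<close>; that the series is finite has to be asserted separately.\<close>

definition Pbar :: "'a measure \<Rightarrow> 'a rate_fun \<Rightarrow> 'a trans_fun" where
  "Pbar X q u x t B = enn2real (Pbar_series X q u x t B)"

definition trans_dom :: "'a measure \<Rightarrow> real \<Rightarrow> ereal \<Rightarrow> (real \<times> 'a \<times> real \<times> 'a set) set" where
  "trans_dom X T0 T1 =
    {(u, x, t, B). u \<in> time_dom T0 T1 \<and> x \<in> space X \<and> u < t \<and> ereal t < T1 \<and> B \<in> sets X}"

definition P_hat :: "'a measure \<Rightarrow> real \<Rightarrow> ereal \<Rightarrow> 'a trans_fun set" where
  "P_hat X T0 T1 = {P.
    (\<forall>(u, x, t, B)\<in>trans_dom X T0 T1. 0 \<le> P u x t B) \<and>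
    (\<forall>u\<in>time_dom T0 T1. \<forall>x\<in>space X. \<forall>t. u < t \<and> ereal t < T1 \<longrightarrow>
       measure_space (space X) (sets X) (\<lambda>B. ennreal (P u x t B))) \<and>
    (\<forall>u\<in>time_dom T0 T1. \<forall>x\<in>space X. \<forall>B\<in>sets X.
       (\<lambda>t. P u x t B) \<in> borel_measurable (restrict_space borel {t. u < t \<and> ereal t < T1}))}"

definition qs_bounded :: "'a measure \<Rightarrow> real \<Rightarrow> 'a rate_fun \<Rightarrow> ereal \<Rightarrow> 'a set \<Rightarrow> bool" where
  "qs_bounded X T0 q s B \<longleftrightarrow>
    B \<in> sets X \<and> bounded ((\<lambda>(x, t). exit_rate q x t) ` (B \<times> {t. T0 \<le> t \<and> ereal t < s}))"

text \<open>Absolute continuity of a real function on an interval, which is unrelated to the library's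
  \<^const>\<open>absolutely_continuous\<close> for measures.\<close>

definition abs_continuous_on :: "real set \<Rightarrow> (real \<Rightarrow> real) \<Rightarrow> bool" where
  "abs_continuous_on I f \<longleftrightarrow>
    (\<forall>\<epsilon>>0. \<exists>\<delta>>0. \<forall>(n::nat) a b.
       (\<forall>i<n. a i < b i \<and> {a i..b i} \<subseteq> I) \<and>
       disjoint_family_on (\<lambda>i. {a i<..<b i}) {..<n} \<and>
       (\<Sum>i<n. b i - a i) < \<delta> \<longrightarrow>
       (\<Sum>i<n. \<bar>f (b i) - f (a i)\<bar>) < \<epsilon>)"

definition initial_and_ac ::
  "'a measure \<Rightarrow> real \<Rightarrow> ereal \<Rightarrow> 'a rate_fun \<Rightarrow> 'a trans_fun \<Rightarrow> bool" where
  "initial_and_ac X T0 T1 q P \<longleftrightarrow>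
    (\<forall>u\<in>time_dom T0 T1. \<forall>s. u < s \<and> ereal s < T1 \<longrightarrow>
      (\<forall>x\<in>space X. \<forall>B. qs_bounded X T0 q (ereal s) B \<longrightarrow>
        ((\<lambda>t. P u x t B) \<longlongrightarrow> indicator B x) (at_right u) \<and>
        abs_continuous_on {u<..<s} (\<lambda>t. P u x t B)))"

definition forward_equation_at ::
  "'a measure \<Rightarrow> 'a rate_fun \<Rightarrow> 'a trans_fun \<Rightarrow> real \<Rightarrow> 'a \<Rightarrow> real \<Rightarrow> 'a set \<Rightarrow> bool" where
  "forward_equation_at X q P u x t B \<longleftrightarrow>
    set_integrable (to_measure X (P u x t)) B (\<lambda>y. exit_rate q y t) \<and>
    integrable (to_measure X (P u x t)) (\<lambda>y. q y t (B - {y})) \<and>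
    ((\<lambda>t'. P u x t' B) has_real_derivative
       - (LINT y:B|to_measure X (P u x t). exit_rate q y t)
       + (LINT y|to_measure X (P u x t). q y t (B - {y}))) (at t)"

definition forward_equation ::
  "'a measure \<Rightarrow> real \<Rightarrow> ereal \<Rightarrow> 'a rate_fun \<Rightarrow> 'a trans_fun \<Rightarrow> bool" where
  "forward_equation X T0 T1 q P \<longleftrightarrow>
    (\<forall>u\<in>time_dom T0 T1. \<forall>s. u < s \<and> ereal s < T1 \<longrightarrow>
      (\<forall>x\<in>space X. \<forall>B. qs_bounded X T0 q (ereal s) B \<longrightarrow>
        (AE t in lborel. t \<in> {u<..<s} \<longrightarrow> forward_equation_at X q P u x t B)))"

text \<open>Functions on \<open>trans_dom X T0 T1\<close> are total in HOL; their values elsewhere are ignored.\<close>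

definition minimal_in ::
  "'a measure \<Rightarrow> real \<Rightarrow> ereal \<Rightarrow> 'a trans_fun set \<Rightarrow> 'a trans_fun \<Rightarrow> bool" where
  "minimal_in X T0 T1 \<A> P \<longleftrightarrow>
    P \<in> \<A> \<and> (\<forall>P'\<in>\<A>. \<forall>(u, x, t, B)\<in>trans_dom X T0 T1. P u x t B \<le> P' u x t B)"

definition unique_in ::
  "'a measure \<Rightarrow> real \<Rightarrow> ereal \<Rightarrow> 'a trans_fun set \<Rightarrow> 'a trans_fun \<Rightarrow> bool" where
  "unique_in X T0 T1 \<A> P \<longleftrightarrow>
    P \<in> \<A> \<and> (\<forall>P'\<in>\<A>. \<forall>(u, x, t, B)\<in>trans_dom X T0 T1. P' u x t B = P u x t B)"

definition regular :: "'a measure \<Rightarrow> real \<Rightarrow> ereal \<Rightarrow> 'a trans_fun \<Rightarrow> bool" where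
  "regular X T0 T1 P \<longleftrightarrow>
    (\<forall>u\<in>time_dom T0 T1. \<forall>x\<in>space X. \<forall>t. u < t \<and> ereal t < T1 \<longrightarrow> P u x t (space X) = 1)"

end

theory Submission
  imports Defs "HOL-Library.Nat_Bijection"
begin

text \<open>Write \<open>S(y, w, t)\<close> for the survival probability, \<open>Q\<^sub>w\<close> for the jump kernel and \<open>\<mu>\<^sub>t\<close> for
  \<open>P(u, x; t, \<cdot>)\<close>. Integrated in time, the forward equation reads
  \<open>\<mu>\<^sub>t(B) + \<integral> \<mu>\<^sub>w(1\<^sub>B q\<^sub>w) dw = 1\<^sub>B(x) + \<integral> \<mu>\<^sub>w(Q\<^sub>w B) dw\<close>, and on \<open>(q, s)\<close>-bounded sets it is equivalent
  to the last-jump equation \<open>\<mu>\<^sub>t(B) = 1\<^sub>B(x) S(x, u, t) + \<integral> \<mu>\<^sub>w(Q\<^sub>w(1\<^sub>B S(\<cdot>, w, t))) dw\<close>, because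
  \<open>\<integral> q(y, v) S(y, w, v) dv = 1 - S(y, w, t) = \<integral> q(y, v) S(y, v, t) dv\<close> over \<open>]w, t[\<close>.
  The series defining \<open>P\<close>-bar is the iteration of the last-jump equation starting from zero, so it
  solves the equation and every non-negative solution dominates its partial sums. To pass from
  bounded sets to all sets the state space must be exhausted by countably many Borel bounded sets,
  which is Novikov's separation theorem. The differential and the integrated equation are linked by
  Lebesgue's differentiation theorem and the fundamental theorem of calculus for absolutely
  continuous functions. Uniqueness in the regular case follows by comparing on \<open>B\<close> and its
  complement.\<close>

section \<open>Differentiation and absolute continuity\<close>

text \<open>All equations are kept between elements of \<open>[0, \<infinity>]\<close>, with the
  loss on the side of the mass. From the last-jump equation to the integrated one only additions
  occur, so P-bar satisfies the latter for all non-negative measurable functions. The converse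
  cancels a loss integral, which must be finite; it is available only for functions vanishing off a
  bounded set. A competitor P therefore satisfies the last-jump equation on bounded sets only, yet
  iterating it evaluates P on \<open>G t w (indicator A)\<close>, which need not vanish off a
  bounded set. Hence each step of the iteration extends the comparison to all functions, and this is
  where the exhaustion enters. Times are restricted to a horizon \<open>s\<close> below
  \<open>T1\<close>, beyond which the rates are set to zero. For each state the rates are then
  bounded on the whole line, and the iterates up to a time \<open>t < s\<close> do not notice the
  change. In names, \<open>mild\<close> marks the last-jump equation and \<open>integrated\<close>
  the forward equation integrated in time.\<close>

text \<open>Suitable open sets around the zero set of \<open>g\<close> carry arbitrarily little of
  the measure with density \<open>g\<close>, whereas around each point of the exceptional set short
  intervals carry more than \<open>c\<close> times their radius. Vitali's covering lemma picks
  disjoint intervals of this kind inside such an open set, so their total length is small as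
  well.\<close>

lemma density_zero_negligible:
  fixes g :: "real \<Rightarrow> real"
  assumes g: "integrable lborel g" and nn: "\<And>x. 0 \<le> g x" and c: "0 < c"
  shows "negligible {t. g t = 0 \<and>
           (\<forall>\<delta>>0. \<exists>r. 0 < r \<and> r < \<delta> \<and> c * r < (LINT s:{t-r..t+r}|lborel. g s))}"
    (is "negligible ?N")
proof (subst negligible_outer_le, intro allI impI)
  fix e :: real assume e: "0 < e"
  have gm[measurable]: "g \<in> borel_measurable borel" using g by simp
  define \<nu> where "\<nu> = density lborel (\<lambda>x. ennreal (g x))"
  have fin: "emeasure \<nu> UNIV \<noteq> \<infinity>"
    unfolding \<nu>_def using g nn by (simp add: emeasure_density integrable_iff_bounded less_top[symmetric])
  have sets_\<nu>[simp]: "sets \<nu> = sets borel" and space_\<nu>[simp]: "space \<nu> = UNIV"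
    unfolding \<nu>_def by auto
  interpret \<nu>: finite_measure \<nu> by (intro finite_measureI) (use fin in simp)
  have meas: "measure \<nu> A = (LINT s:A|lborel. g s)" if "A \<in> sets borel" for A
  proof -
    have "emeasure \<nu> A = (\<integral>\<^sup>+x. ennreal (indicator A x * g x) \<partial>lborel)"
      unfolding \<nu>_def using that
      by (subst emeasure_density) (auto intro!: nn_integral_cong split: split_indicator)
    also have "\<dots> = ennreal (\<integral>x. indicator A x * g x \<partial>lborel)"
      using that nn g
      by (intro nn_integral_eq_integral) (auto intro!: integrable_real_mult_indicator[of _ _ g, simplified mult.commute] simp: mult.commute)
    finally show ?thesis
      unfolding measure_def set_lebesgue_integral_def using nn
      by (simp add: integral_nonneg_AE)
  qed
  define A where "A = {t. g t = 0}"
  have A[measurable]: "A \<in> sets borel" unfolding A_def by measurable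
  have "emeasure \<nu> A = 0"
    unfolding \<nu>_def A_def by (subst emeasure_density) (auto intro!: nn_integral_0_iff_AE[THEN iffD2] split: split_indicator)
  \<comment> \<open>An interval enlarged five times has length \<open>10 * r\<close>, while the
    original one carries more than \<open>c * r\<close>. As the chosen intervals are disjoint, mass
    below \<open>e * c / 10\<close> leaves total enlarged length at most \<open>e\<close>.\<close>
  then have "(INF U \<in> {U. A \<subseteq> U \<and> open U}. emeasure \<nu> U) < ennreal (e * c / 10)"
    using outer_regular[of \<nu> A] fin A e c by simp
  then obtain U where U: "A \<subseteq> U" "open U" "emeasure \<nu> U < ennreal (e * c / 10)"
    unfolding INF_less_iff by auto
  have [measurable]: "U \<in> sets borel" using U by auto
  have mU: "measure \<nu> U \<le> e * c / 10"
    using U(3) e c by (simp add: \<nu>.emeasure_eq_measure ennreal_less_iff)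
  define K where "K = {(t, r). t \<in> ?N \<and> 0 < r \<and> r \<le> 1 \<and> cball t r \<subseteq> U \<and>
      c * r < (LINT s:{t-r..t+r}|lborel. g s)}"
  have K: "\<And>i. i \<in> K \<Longrightarrow> 0 < snd i \<and> snd i \<le> 1" unfolding K_def by auto
  obtain C where C: "countable C" "C \<subseteq> K"
     "pairwise (\<lambda>i j. disjnt (cball (fst i) (snd i)) (cball (fst j) (snd j))) C"
     "\<And>i. i \<in> K \<Longrightarrow> \<exists>j. j \<in> C \<and>
                        \<not> disjnt (cball (fst i) (snd i)) (cball (fst j) (snd j)) \<and>
                        cball (fst i) (snd i) \<subseteq> ball (fst j) (5 * snd j)"
    by (rule Vitali_covering_lemma_cballs_balls[of K snd 1 fst]; (rule K | rule that); assumption)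
  define T where "T = (\<Union>i\<in>C. ball (fst i) (5 * snd i))"
  have bnd: "measure lebesgue (\<Union>i\<in>F. ball (fst i) (5 * snd i)) \<le> e" if F: "F \<subseteq> C" "finite F" for F
  proof -
    have rp: "0 < snd i" if "i \<in> F" for i using K C(2) F(1) that by blast
    have dj: "disjoint_family_on (\<lambda>i. cball (fst i) (snd i)) F"
      using C(3) F(1) unfolding disjoint_family_on_def pairwise_def disjnt_def by blast
    have subU: "cball (fst i) (snd i) \<subseteq> U" if "i \<in> F" for i
      using C(2) F(1) that unfolding K_def by force
    have "measure lebesgue (\<Union>i\<in>F. ball (fst i) (5 * snd i)) \<le> (\<Sum>i\<in>F. measure lebesgue (ball (fst i) (5 * snd i)))"
      using F by (intro measure_UNION_le) auto
    also have "\<dots> = (\<Sum>i\<in>F. 10 * snd i)"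
      using rp by (intro sum.cong) (auto simp: ball_eq_greaterThanLessThan less_imp_le)
    also have "\<dots> \<le> (\<Sum>i\<in>F. (10 / c) * measure \<nu> (cball (fst i) (snd i)))"
    proof (intro sum_mono)
      fix i assume "i \<in> F"
      then have "c * snd i < measure \<nu> (cball (fst i) (snd i))"
        using C(2) F(1) unfolding K_def by (subst meas) (auto simp: cball_eq_atLeastAtMost)
      then show "10 * snd i \<le> (10 / c) * measure \<nu> (cball (fst i) (snd i))"
        using c by (simp add: field_simps)
    qed
    also have "\<dots> = (10 / c) * measure \<nu> (\<Union>i\<in>F. cball (fst i) (snd i))"
      using F dj by (subst \<nu>.finite_measure_finite_Union) (auto simp: sum_distrib_left)
    also have "\<dots> \<le> (10 / c) * measure \<nu> U"
      using c by (intro mult_left_mono \<nu>.finite_measure_mono UN_least subU) auto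
    also have "\<dots> \<le> (10 / c) * (e * c / 10)" using mU c by (intro mult_left_mono) auto
    finally show ?thesis using c by simp
  qed
  have "T \<in> lmeasurable" unfolding T_def
    by (rule fmeasurable_UN_bound[OF C(1) _ bnd]) auto
  moreover have "measure lebesgue T \<le> e" unfolding T_def
    by (rule measure_UN_bound[OF C(1) _ bnd]) auto
  moreover have "?N \<subseteq> T"
  proof
    fix t assume t: "t \<in> ?N"
    then have "t \<in> U" using U(1) unfolding A_def by auto
    then obtain \<delta> where \<delta>: "0 < \<delta>" "cball t \<delta> \<subseteq> U" using U(2) open_contains_cball by blast
    obtain r where r: "0 < r" "r < min \<delta> 1" "c * r < (LINT s:{t-r..t+r}|lborel. g s)"
      using t \<delta>(1) by (auto dest!: spec[of _ "min \<delta> 1"])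
    then have "cball t r \<subseteq> U" using \<delta>(2) by (force simp: subset_eq)
    then have "(t, r) \<in> K" using r t unfolding K_def by auto
    from C(4)[OF this] r show "t \<in> T" unfolding T_def by force
  qed
  ultimately show "\<exists>T. ?N \<subseteq> T \<and> T \<in> lmeasurable \<and> measure lebesgue T \<le> e" by blast
qed

text \<open>For rational \<open>p\<close> slightly above \<open>h t\<close> the function \<open>max 0 (h - p)\<close> vanishes at \<open>t\<close>, so by the
  previous lemma \<open>h\<close> exceeds \<open>p\<close> only negligibly near almost every such \<open>t\<close>.\<close>

lemma lebesgue_upper_derivative:
  fixes h :: "real \<Rightarrow> real"
  assumes h: "set_integrable lborel {a..b} h"
  shows "AE t in lborel. t \<in> {a<..<b} \<longrightarrow> (\<forall>e>0. \<exists>\<delta>>0. \<forall>u v. t - \<delta> < u \<and> u \<le> t \<and> t \<le> v \<and> v < t + \<delta> \<longrightarrow>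
           (LINT s:{u..v}|lborel. h s) \<le> (h t + e) * (v - u))"
proof -
  define k where "k s = indicator {a..b} s * h s" for s
  have k: "integrable lborel k" using h unfolding set_integrable_def k_def by simp
  \<comment> \<open>Outside \<open>{a..b}\<close> the function \<open>k\<close> vanishes, so for
    negative \<open>p\<close> the positive part of \<open>k - p\<close> is integrable only after the
    cut-off.\<close>
  define g where "g p s = indicator {a..b} s * max 0 (k s - p)" for p s
  have g: "integrable lborel (g p)" for p
  proof (rule Bochner_Integration.integrable_bound[of lborel "\<lambda>s. \<bar>k s\<bar> + \<bar>p\<bar> * indicator {a..b} s"])
    show "integrable lborel (\<lambda>s. \<bar>k s\<bar> + \<bar>p\<bar> * indicator {a..b} s)"
      using k by (intro Bochner_Integration.integrable_add integrable_abs integrable_mult_right integrable_real_indicator)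
         (auto simp: emeasure_lborel_Icc_eq)
    show "g p \<in> borel_measurable lborel" unfolding g_def using k by measurable
    show "AE x in lborel. norm (g p x) \<le> norm (\<bar>k x\<bar> + \<bar>p\<bar> * indicator {a..b} x)"
      by (auto simp: g_def split: split_indicator)
  qed
  have gnn: "0 \<le> g p s" for p s unfolding g_def by auto
  define bad where "bad p c = {t. g p t = 0 \<and>
           (\<forall>\<delta>>0. \<exists>r. 0 < r \<and> r < \<delta> \<and> c * r < (LINT s:{t-r..t+r}|lborel. g p s))}" for p c
  have bad: "negligible (bad p (1 / Suc n))" for p n
    unfolding bad_def by (intro density_zero_negligible g gnn) simp
  have "negligible (\<Union>(p, n)\<in>\<rat> \<times> (UNIV::nat set). bad p (1 / Suc n))"
    by (intro negligible_countable_Union)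
       (auto simp del: of_nat_Suc intro!: bad countable_SIGMA countable_rat)
  then have "AE t in lebesgue. t \<notin> (\<Union>(p, n)\<in>\<rat> \<times> (UNIV::nat set). bad p (1 / Suc n))"
    unfolding negligible_iff_null_sets by (rule AE_not_in)
  then have "AE t in lborel. t \<notin> (\<Union>(p, n)\<in>\<rat> \<times> (UNIV::nat set). bad p (1 / Suc n))"
    by (simp add: AE_completion_iff)
  then show ?thesis
  proof (eventually_elim, intro impI allI)
    fix t e assume nb: "t \<notin> (\<Union>(p, n)\<in>\<rat> \<times> (UNIV::nat set). bad p (1 / Suc n))"
      and t: "t \<in> {a<..<b}" and e: "(0::real) < e"
    obtain p where p: "p \<in> \<rat>" "h t < p" "p < h t + e / 2" using Rats_dense_in_real[of "h t" "h t + e/2"] e by auto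
    obtain n where n: "1 / real (Suc n) < e / 2" using nat_approx_posE[of "e/2"] e by auto
    have "t \<notin> bad p (1 / Suc n)" using nb p(1) by blast
    moreover have "g p t = 0" using t p unfolding g_def k_def by auto
    ultimately obtain \<delta> where \<delta>: "0 < \<delta>" "\<And>r. 0 < r \<Longrightarrow> r < \<delta> \<Longrightarrow> (LINT s:{t-r..t+r}|lborel. g p s) \<le> (1 / Suc n) * r"
      unfolding bad_def by (force simp: not_less)
    define \<delta>' where "\<delta>' = min \<delta> (min (t - a) (b - t))"
    have \<delta>': "0 < \<delta>'" using \<delta>(1) t unfolding \<delta>'_def by auto
    moreover have "(LINT s:{u..v}|lborel. h s) \<le> (h t + e) * (v - u)"
      if uv: "t - \<delta>' < u \<and> u \<le> t \<and> t \<le> v \<and> v < t + \<delta>'" for u v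
    proof (cases "u = v")
      case True
      have "(LINT s:{u..v}|lborel. h s) = 0"
        unfolding set_lebesgue_integral_def True
        by (rule integral_eq_zero_AE, rule eventually_mono[OF AE_lborel_singleton[of v]]) auto
      then show ?thesis using True by simp
    next
      case False
      \<comment> \<open>Every interval \<open>{u..v}\<close> around \<open>t\<close> lies in a
        symmetric one whose radius is at most \<open>v - u\<close>; a bound linear in the radius is
        therefore linear in the length.\<close>
      define r where "r = max (t - u) (v - t)"
      have r: "0 < r" "r < \<delta>" "r \<le> v - u" "t - r \<le> u" "v \<le> t + r" using uv False unfolding r_def \<delta>'_def by auto
      have sub: "{u..v} \<subseteq> {a..b}" using uv unfolding \<delta>'_def by auto
      have hi: "set_integrable lborel {u..v} h" by (rule set_integrable_subset[OF h]) (use sub in auto)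
      have gi: "set_integrable lborel A (g p)" if "A \<in> sets borel" for A
        unfolding set_integrable_def using g that by (intro integrable_mult_indicator) auto
      have pi: "set_integrable lborel {u..v} (\<lambda>s. p)" unfolding set_integrable_def
        by (auto intro!: integrable_real_indicator simp: emeasure_lborel_Icc_eq)
      have "(LINT s:{u..v}|lborel. h s) \<le> (LINT s:{u..v}|lborel. p + g p s)"
        using sub by (intro set_integral_mono hi set_integral_add pi gi) (auto simp: g_def k_def)
      also have "\<dots> = p * (v - u) + (LINT s:{u..v}|lborel. g p s)"
        using uv by (subst set_integral_add(2)[OF pi gi]) (auto simp: set_lebesgue_integral_def)
      also have "(LINT s:{u..v}|lborel. g p s) \<le> (LINT s:{t-r..t+r}|lborel. g p s)"
        unfolding set_lebesgue_integral_def using r gnn gi[unfolded set_integrable_def]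
        by (intro integral_mono) (auto split: split_indicator)
      also have "\<dots> \<le> (1 / Suc n) * r" using \<delta>(2) r by auto
      also have "\<dots> \<le> e / 2 * (v - u)" using n r e by (intro mult_mono) auto
      also have "p * (v - u) \<le> (h t + e / 2) * (v - u)" using p uv by (intro mult_right_mono) auto
      finally show ?thesis by (simp add: algebra_simps)
    qed
    ultimately show "\<exists>\<delta>>0. \<forall>u v. t - \<delta> < u \<and> u \<le> t \<and> t \<le> v \<and> v < t + \<delta> \<longrightarrow>
           (LINT s:{u..v}|lborel. h s) \<le> (h t + e) * (v - u)" by blast
  qed
qed

lemma set_integral_Icc_diff:
  fixes h :: "real \<Rightarrow> real"
  assumes h: "set_integrable lborel {a..v} h" and "a \<le> u" "u \<le> v"
  shows "(LINT s:{a..v}|lborel. h s) - (LINT s:{a..u}|lborel. h s) = (LINT s:{u..v}|lborel. h s)"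
    and "(LINT s:{a..v}|lborel. h s) - (LINT s:{a..u}|lborel. h s) = (LINT s:{u<..v}|lborel. h s)"
proof -
  have *: "{a..v} = {a..u} \<union> {u<..v}" using assms by auto
  have "(LINT s:{a..v}|lborel. h s) = (LINT s:{a..u}|lborel. h s) + (LINT s:{u<..v}|lborel. h s)"
    unfolding * by (intro set_integral_Un set_integrable_subset[OF h]) (use assms in auto)
  then show 1: "(LINT s:{a..v}|lborel. h s) - (LINT s:{a..u}|lborel. h s) = (LINT s:{u<..v}|lborel. h s)" by simp
  have "set_integrable lborel {u<..v} h" "set_integrable lborel {u..v} h"
    using assms by (auto intro: set_integrable_subset[OF h])
  note i = this[unfolded set_integrable_def, THEN borel_measurable_integrable, simplified]
  have "(LINT s:{u<..v}|lborel. h s) = (LINT s:{u..v}|lborel. h s)"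
    unfolding set_lebesgue_integral_def
    by (rule integral_cong_AE)
       (use AE_lborel_singleton[of u] i in \<open>auto split: split_indicator\<close>)
  then show "(LINT s:{a..v}|lborel. h s) - (LINT s:{a..u}|lborel. h s) = (LINT s:{u..v}|lborel. h s)" using 1 by simp
qed

text \<open>The upper bound for \<open>h\<close> and for \<open>- h\<close> encloses the averages
  over all short intervals containing the point. Intervals with the point as an endpoint are
  included, which covers the difference quotients from both sides.\<close>

theorem lebesgue_differentiation:
  fixes h :: "real \<Rightarrow> real"
  assumes h: "set_integrable lborel {a..b} h"
  shows "AE t in lborel. t \<in> {a<..<b} \<longrightarrow> ((\<lambda>t. LINT s:{a..t}|lborel. h s) has_real_derivative h t) (at t)"
proof -
  have "set_integrable lborel {a..b} (\<lambda>s. - h s)" using h by (simp add: set_integrable_def)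
  from lebesgue_upper_derivative[OF h] lebesgue_upper_derivative[OF this]
  show ?thesis
  proof (eventually_elim, intro impI)
    fix t assume up: "t \<in> {a<..<b} \<longrightarrow> (\<forall>e>0. \<exists>\<delta>>0. \<forall>u v. t - \<delta> < u \<and> u \<le> t \<and> t \<le> v \<and> v < t + \<delta> \<longrightarrow>
           (LINT s:{u..v}|lborel. h s) \<le> (h t + e) * (v - u))"
      and lo: "t \<in> {a<..<b} \<longrightarrow> (\<forall>e>0. \<exists>\<delta>>0. \<forall>u v. t - \<delta> < u \<and> u \<le> t \<and> t \<le> v \<and> v < t + \<delta> \<longrightarrow>
           (LINT s:{u..v}|lborel. - h s) \<le> (- h t + e) * (v - u))"
      and t: "t \<in> {a<..<b}"
    let ?F = "\<lambda>t. LINT s:{a..t}|lborel. h s"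
    have "\<exists>\<delta>>0. \<forall>y. y \<noteq> t \<and> dist y t < \<delta> \<longrightarrow> dist ((?F y - ?F t) / (y - t)) (h t) < e" if e: "0 < e" for e
    proof -
      note e2 = half_gt_zero[OF e]
      obtain d1 where d1: "d1 > 0" "\<And>u v. t - d1 < u \<and> u \<le> t \<and> t \<le> v \<and> v < t + d1 \<Longrightarrow>
           (LINT s:{u..v}|lborel. h s) \<le> (h t + e/2) * (v - u)"
        using up[THEN mp, OF t, rule_format, OF e2] by blast
      obtain d2 where d2: "d2 > 0" "\<And>u v. t - d2 < u \<and> u \<le> t \<and> t \<le> v \<and> v < t + d2 \<Longrightarrow>
           (LINT s:{u..v}|lborel. - h s) \<le> (- h t + e/2) * (v - u)"
        using lo[THEN mp, OF t, rule_format, OF e2] by blast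
      define d where "d = min (min d1 d2) (min (t - a) (b - t))"
      have d: "0 < d" using d1 d2 t unfolding d_def by auto
      have "dist ((?F y - ?F t) / (y - t)) (h t) < e" if y: "y \<noteq> t" "dist y t < d" for y
      proof -
        define u v where "u = min y t" and "v = max y t"
        have uv: "t - d1 < u \<and> u \<le> t \<and> t \<le> v \<and> v < t + d1" "t - d2 < u \<and> u \<le> t \<and> t \<le> v \<and> v < t + d2"
          "a \<le> u" "v \<le> b" "u < v" "u \<le> v"
        proof -
          have "t - d < y" "y < t + d" using y(2) by (auto simp: dist_real_def abs_less_iff)
          moreover have "d \<le> d1" "d \<le> d2" "d \<le> t - a" "d \<le> b - t" unfolding d_def by auto
          ultimately show "t - d1 < u \<and> u \<le> t \<and> t \<le> v \<and> v < t + d1" "t - d2 < u \<and> u \<le> t \<and> t \<le> v \<and> v < t + d2"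
            "a \<le> u" "v \<le> b" "u < v" "u \<le> v"
            using y(1) d d1(1) d2(1) by (cases "y \<le> t"; simp add: u_def v_def)+
        qed
        have F: "?F v - ?F u = (LINT s:{u..v}|lborel. h s)"
          using uv(3,4,6) by (intro set_integral_Icc_diff set_integrable_subset[OF h]) auto
        have q: "(?F y - ?F t) / (y - t) = (?F v - ?F u) / (v - u)"
          unfolding u_def v_def using minus_divide_divide[of "?F y - ?F t" "y - t"]
          by (auto simp: min_def max_def)
        have "?F v - ?F u \<le> (h t + e/2) * (v - u)" "-(?F v - ?F u) \<le> (- h t + e/2) * (v - u)"
          using d1(2)[OF uv(1)] d2(2)[OF uv(2)] unfolding F by (simp_all add: set_lebesgue_integral_def)
        then have "(?F v - ?F u) / (v - u) \<le> h t + e/2" "(?F v - ?F u) / (v - u) \<ge> h t - e/2"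
          using uv(5) by (auto simp: field_simps)
        then show ?thesis unfolding q dist_real_def using e by (auto simp: abs_less_iff)
      qed
      then show ?thesis using d by blast
    qed
    then have "((\<lambda>y. (?F y - ?F t) / (y - t)) \<longlongrightarrow> h t) (at t)"
      unfolding tendsto_iff eventually_at by (auto simp: dist_commute)
    then show "(?F has_real_derivative h t) (at t)"
      by (simp add: has_field_derivative_iff)
  qed
qed

section \<open>Absolutely continuous functions and the fundamental theorem of calculus\<close>

text \<open>In the gauge proof the intervals are indexed by the members of a tagged division, which
  calls for arbitrary finite index sets in place of initial segments of the natural numbers.\<close>

lemma abs_continuous_onD:
  assumes f: "abs_continuous_on I f" and e: "0 < e"
  shows "\<exists>\<delta>>0. \<forall>S (a::'i \<Rightarrow> real) b. finite S \<longrightarrow> (\<forall>i\<in>S. a i < b i \<and> {a i..b i} \<subseteq> I) \<longrightarrow>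
       disjoint_family_on (\<lambda>i. {a i<..<b i}) S \<longrightarrow> (\<Sum>i\<in>S. b i - a i) < \<delta> \<longrightarrow>
       (\<Sum>i\<in>S. \<bar>f (b i) - f (a i)\<bar>) < e"
proof -
  obtain \<delta> where \<delta>: "0 < \<delta>" "\<And>(n::nat) a b. (\<forall>i<n. a i < b i \<and> {a i..b i} \<subseteq> I) \<Longrightarrow>
       disjoint_family_on (\<lambda>i. {a i<..<b i}) {..<n} \<Longrightarrow>
       (\<Sum>i<n. b i - a i) < \<delta> \<Longrightarrow> (\<Sum>i<n. \<bar>f (b i) - f (a i)\<bar>) < e"
    using f e unfolding abs_continuous_on_def by meson
  show ?thesis
  proof (intro exI[of _ \<delta>] conjI allI impI \<delta>(1))
    fix S :: "'i set" and a b :: "'i \<Rightarrow> real"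
    assume S: "finite S" and I: "\<forall>i\<in>S. a i < b i \<and> {a i..b i} \<subseteq> I"
      and dj: "disjoint_family_on (\<lambda>i. {a i<..<b i}) S" and sm: "(\<Sum>i\<in>S. b i - a i) < \<delta>"
    obtain \<phi> where \<phi>: "bij_betw \<phi> {..<card S} S"
      using ex_bij_betw_nat_finite[OF S] by (auto simp: atLeast0LessThan)
    have re: "(\<Sum>i<card S. F (\<phi> i)) = (\<Sum>i\<in>S. F i)" for F :: "'i \<Rightarrow> real"
      using sum.reindex_bij_betw[OF \<phi>] by simp
    have "disjoint_family_on (\<lambda>i. {a (\<phi> i)<..<b (\<phi> i)}) {..<card S}"
      using dj \<phi> unfolding disjoint_family_on_def bij_betw_def inj_on_def by blast
    moreover have "\<forall>i<card S. a (\<phi> i) < b (\<phi> i) \<and> {a (\<phi> i)..b (\<phi> i)} \<subseteq> I"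
      using I \<phi> unfolding bij_betw_def by blast
    ultimately have "(\<Sum>i<card S. \<bar>f (b (\<phi> i)) - f (a (\<phi> i))\<bar>) < e"
      using \<delta>(2)[of "card S" "\<lambda>i. a (\<phi> i)" "\<lambda>i. b (\<phi> i)"] sm re[of "\<lambda>i. b i - a i"] by simp
    then show "(\<Sum>i\<in>S. \<bar>f (b i) - f (a i)\<bar>) < e" using re[of "\<lambda>i. \<bar>f (b i) - f (a i)\<bar>"] by simp
  qed
qed

text \<open>The part of the absolute value of \<open>h\<close> above a high level \<open>n\<close>
  has integral below \<open>e / 2\<close>, by dominated convergence, and the part below that level
  contributes at most \<open>n\<close> times the total length of the intervals.\<close>

lemma abs_continuous_on_integral:
  assumes h: "set_integrable lborel {a..b} h"
    and f: "\<And>t. a < t \<Longrightarrow> t < b \<Longrightarrow> f t = C + (LINT s:{a..t}|lborel. h s)"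
  shows "abs_continuous_on {a<..<b} f"
  unfolding abs_continuous_on_def
proof (intro allI impI)
  fix e :: real assume e: "0 < e"
  define k where "k s = indicator {a..b} s * \<bar>h s\<bar>" for s
  have k: "integrable lborel k"
    using integrable_abs[OF h[unfolded set_integrable_def]] unfolding k_def by (simp add: abs_mult)
  then have km[measurable]: "k \<in> borel_measurable borel" by simp
  have knn: "0 \<le> k s" for s unfolding k_def by simp
  have mi: "integrable lborel (\<lambda>s. max 0 (k s - real n))" for n
    by (rule Bochner_Integration.integrable_bound[OF k]) (use knn in \<open>auto simp: abs_le_iff\<close>)
  have "(\<lambda>n. \<integral>s. max 0 (k s - real n) \<partial>lborel) \<longlonglongrightarrow> (\<integral>s. 0 \<partial>(lborel::real measure))"
  proof (rule integral_dominated_convergence[where w=k])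
    show "AE s in lborel. (\<lambda>n. max 0 (k s - real n)) \<longlonglongrightarrow> 0"
    proof (rule AE_I2)
      fix s
      obtain N where N: "k s < real N" using reals_Archimedean2 by blast
      have "eventually (\<lambda>n. max 0 (k s - real n) = 0) sequentially"
        using eventually_ge_at_top[of N] by eventually_elim (use N in \<open>auto simp: max_def\<close>)
      then show "(\<lambda>n. max 0 (k s - real n)) \<longlonglongrightarrow> 0" by (rule tendsto_eventually)
    qed
  qed (use k knn in auto)
  then have "eventually (\<lambda>n. (\<integral>s. max 0 (k s - real n) \<partial>lborel) < e / 2) sequentially"
    using e by (intro order_tendstoD(2)[where y=0]) auto
  then obtain n where n: "(\<integral>s. max 0 (k s - real n) \<partial>lborel) < e / 2" by (auto simp: eventually_sequentially)
  define m where "m s = max 0 (k s - real n)" for s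
  have m: "integrable lborel m" unfolding m_def by (rule mi)
  \<comment> \<open>The summand 1 admits the level \<open>n = 0\<close>;
    \<open>real n * \<delta>\<close> is at most \<open>e / 2\<close>.\<close>
  define \<delta> where "\<delta> = e / (2 * (real n + 1))"
  have \<delta>: "0 < \<delta>" unfolding \<delta>_def using e by auto
  moreover have "(\<Sum>i<N. \<bar>f (v i) - f (u i)\<bar>) < e"
    if uv: "\<forall>i<N. u i < v i \<and> {u i..v i} \<subseteq> {a<..<b}"
      and dj: "disjoint_family_on (\<lambda>i. {u i<..<v i}) {..<N}"
      and sm: "(\<Sum>i<N. v i - u i) < \<delta>" for N :: nat and u v
  proof -
    have in1: "a < u i" "v i < b" "u i < v i" if "i < N" for i
    proof -
      have "u i \<in> {u i..v i}" "v i \<in> {u i..v i}" using uv that by (auto simp: less_imp_le)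
      then show "a < u i" "v i < b" "u i < v i" using uv that by (auto simp: subset_eq)
    qed
    \<comment> \<open>Only the open intervals are assumed disjoint, but the increments are integrals
      over half-open ones. Two of these with a common point also share points of their interiors, so
      at most one of the indicators is nonzero.\<close>
    have dj2: "(\<Sum>i<N. indicator {u i<..v i} s) \<le> (1::real)" for s
    proof (cases "\<exists>i<N. s \<in> {u i<..v i}")
      case True
      then obtain i where i: "i < N" "s \<in> {u i<..v i}" by auto
      have "s \<notin> {u j<..v j}" if j: "j < N" "j \<noteq> i" for j
      proof
        assume s: "s \<in> {u j<..v j}"
        have "(max (u i) (u j) + s) / 2 \<in> {u i<..<v i} \<inter> {u j<..<v j}" using s i by (auto simp: max_def)
        then show False using dj i j unfolding disjoint_family_on_def by blast
      qed
      then have "(\<Sum>j<N. indicator {u j<..v j} s :: real) = (\<Sum>j<N. if j = i then 1 else 0)"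
        using i by (intro sum.cong) auto
      then show ?thesis using i by simp
    next
      case False
      then show ?thesis by (simp add: sum.neutral)
    qed
    have "\<bar>f (v i) - f (u i)\<bar> \<le> real n * (v i - u i) + (\<integral>s. indicator {u i<..v i} s * m s \<partial>lborel)" if i: "i < N" for i
    proof -
      have hi: "set_integrable lborel {u i<..v i} h"
        by (rule set_integrable_subset[OF h]) (use in1[OF i] in auto)
      have "f (v i) - f (u i) = (LINT s:{u i<..v i}|lborel. h s)"
        using in1[OF i] f[of "v i"] f[of "u i"] set_integral_Icc_diff(2)[of a "v i" h "u i"] set_integrable_subset[OF h, of "{a..v i}"]
        by auto
      also have "\<bar>\<dots>\<bar> \<le> (LINT s:{u i<..v i}|lborel. \<bar>h s\<bar>)"
        using set_integral_norm_bound[OF hi] by simp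
      also have "\<dots> \<le> (\<integral>s. real n * indicator {u i<..v i} s + indicator {u i<..v i} s * m s \<partial>lborel)"
        unfolding set_lebesgue_integral_def
      proof (intro integral_mono Bochner_Integration.integrable_add integrable_mult_right)
        show "integrable lborel (\<lambda>s. indicator {u i<..v i} s *\<^sub>R \<bar>h s\<bar>)"
          using integrable_abs[OF hi[unfolded set_integrable_def]] by (simp add: abs_mult)
        show "integrable lborel (\<lambda>s. indicator {u i<..v i} s * m s)"
          using integrable_mult_indicator[OF _ m, of "{u i<..v i}"] by simp
        show "indicator {u i<..v i} s *\<^sub>R \<bar>h s\<bar> \<le> real n * indicator {u i<..v i} s + indicator {u i<..v i} s * m s" for s
          using in1[OF i] by (auto simp: m_def k_def split: split_indicator)
      qed (use in1[OF i] in auto)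
      also have "\<dots> = real n * (v i - u i) + (\<integral>s. indicator {u i<..v i} s * m s \<partial>lborel)"
        using in1[OF i] integrable_mult_indicator[OF _ m, of "{u i<..v i}"]
        by (subst Bochner_Integration.integral_add) auto
      finally show ?thesis .
    qed
    then have "(\<Sum>i<N. \<bar>f (v i) - f (u i)\<bar>) \<le> (\<Sum>i<N. real n * (v i - u i) + (\<integral>s. indicator {u i<..v i} s * m s \<partial>lborel))"
      by (intro sum_mono) auto
    also have "\<dots> = real n * (\<Sum>i<N. v i - u i) + (\<integral>s. (\<Sum>i<N. indicator {u i<..v i} s * m s) \<partial>lborel)"
      using integrable_mult_indicator[OF _ m]
      by (subst Bochner_Integration.integral_sum) (auto simp: sum.distrib sum_distrib_left)
    also have "(\<integral>s. (\<Sum>i<N. indicator {u i<..v i} s * m s) \<partial>lborel) \<le> (\<integral>s. m s \<partial>lborel)"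
    proof (intro integral_mono Bochner_Integration.integrable_sum m)
      show "integrable lborel (\<lambda>s. indicator {u i<..v i} s * m s)" for i
        using integrable_mult_indicator[OF _ m, of "{u i<..v i}"] by simp
      show "(\<Sum>i<N. indicator {u i<..v i} s * m s) \<le> m s" for s
        using mult_right_mono[OF dj2[of s], of "m s"] by (simp add: sum_distrib_right m_def)
    qed
    also have "\<dots> < e / 2" using n unfolding m_def .
    also have "real n * (\<Sum>i<N. v i - u i) \<le> real n * \<delta>" using sm by (intro mult_left_mono) auto
    also have "\<dots> \<le> e / 2" unfolding \<delta>_def using e by (simp add: field_simps)
    finally show ?thesis by simp
  qed
  ultimately show "\<exists>\<delta>>0. \<forall>(n::nat) a' b'.
       (\<forall>i<n. a' i < b' i \<and> {a' i..b' i} \<subseteq> {a<..<b}) \<and>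
       disjoint_family_on (\<lambda>i. {a' i<..<b' i}) {..<n} \<and>
       (\<Sum>i<n. b' i - a' i) < \<delta> \<longrightarrow>
       (\<Sum>i<n. \<bar>f (b' i) - f (a' i)\<bar>) < e" by blast
qed

text \<open>Intervals tagged in \<open>N\<close> have small total length, so absolute continuity bounds their
  increments; all others are handled by the derivative as in the classical gauge proof.\<close>

lemma FTC_abs_continuous:
  fixes f g :: "real \<Rightarrow> real"
  assumes ac: "abs_continuous_on I f" and I: "{a..b} \<subseteq> I" and ab: "a \<le> b"
    and N: "negligible N"
    and deriv: "\<And>t. t \<in> {a..b} \<Longrightarrow> t \<notin> N \<Longrightarrow> (f has_real_derivative g t) (at t)"
  shows "(g has_integral (f b - f a)) {a..b}"
proof -
  \<comment> \<open>On \<open>N\<close> the values of \<open>g\<close> are arbitrary. With 0 in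
    their place, an interval tagged in \<open>N\<close> contributes only its increment of
    \<open>f\<close>.\<close>
  define g' where "g' t = (if t \<in> N then 0 else g t)" for t
  have "(g' has_integral (f b - f a)) {a..b}"
    unfolding has_integral_real
  proof (intro allI impI)
    fix e :: real assume e: "0 < e"
    obtain \<delta> where \<delta>: "0 < \<delta>"
      "\<forall>S (u::real \<times> real set \<Rightarrow> real) v. finite S \<longrightarrow> (\<forall>i\<in>S. u i < v i \<and> {u i..v i} \<subseteq> I) \<longrightarrow>
       disjoint_family_on (\<lambda>i. {u i<..<v i}) S \<longrightarrow> (\<Sum>i\<in>S. v i - u i) < \<delta> \<longrightarrow>
       (\<Sum>i\<in>S. \<bar>f (v i) - f (u i)\<bar>) < e / 2"
      using abs_continuous_onD[OF ac half_gt_zero[OF e], where 'i="real \<times> real set"] by blast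
    have "N \<in> null_sets lebesgue" using N by (simp add: negligible_iff_null_sets)
    then have N0: "N \<in> sets lebesgue" "emeasure lebesgue N = 0" by auto
    obtain U where U: "open U" "N \<subseteq> U" "U - N \<in> lmeasurable" "emeasure lebesgue (U - N) < ennreal \<delta>"
      using sets_lebesgue_outer_open[OF N0(1) \<delta>(1)] by metis
    have "emeasure lebesgue U = emeasure lebesgue (U - N)"
      using U N0 emeasure_Diff_null_set[of N lebesgue U] by (auto simp: null_sets_def)
    then have mU: "emeasure lebesgue U < ennreal \<delta>" using U(4) by simp
    \<comment> \<open>Intervals tagged outside \<open>N\<close> contribute at most
      \<open>c * (b - a)\<close>, which is to stay below \<open>e / 2\<close>; the summand 1 admits
      \<open>a = b\<close>.\<close>
    define c where "c = e / (2 * (b - a + 1))"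
    have c: "0 < c" using e ab unfolding c_def by simp
    \<comment> \<open>The gauge pushes intervals tagged in \<open>N\<close> into \<open>U\<close>,
      so that their total length is below \<open>\<delta>\<close>; at the other tags in
      \<open>{a..b}\<close> it is a radius on which the linear approximation has relative error at
      most \<open>c\<close>.\<close>
    have "\<exists>d>0. ball t d \<subseteq> (if t \<in> N then U else UNIV) \<and> (t \<in> {a..b} - N \<longrightarrow>
        (\<forall>y. \<bar>y - t\<bar> < d \<longrightarrow> \<bar>f y - f t - (y - t) * g t\<bar> \<le> c * \<bar>y - t\<bar>))" for t
    proof (cases "t \<in> N")
      case True
      then show ?thesis using U(1,2) by (auto simp: open_contains_ball subset_eq)
    next
      case False
      show ?thesis
      proof (cases "t \<in> {a..b}")
        case True
        from deriv[OF True False] c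
        have "\<exists>d>0. \<forall>y. norm (y - t) < d \<longrightarrow> norm (f y - f t - g t * (y - t)) \<le> c * norm (y - t)"
          unfolding has_field_derivative_def has_derivative_at_alt by blast
        then show ?thesis using False True by (simp add: mult.commute)
      qed (use False in \<open>auto intro: exI[of _ 1]\<close>)
    qed
    then obtain d where "\<And>t. d t > 0 \<and> ball t (d t) \<subseteq> (if t \<in> N then U else UNIV) \<and> (t \<in> {a..b} - N \<longrightarrow>
        (\<forall>y. \<bar>y - t\<bar> < d t \<longrightarrow> \<bar>f y - f t - (y - t) * g t\<bar> \<le> c * \<bar>y - t\<bar>))"
      using choice[of "\<lambda>t d. d > 0 \<and> ball t d \<subseteq> (if t \<in> N then U else UNIV) \<and> (t \<in> {a..b} - N \<longrightarrow>
        (\<forall>y. \<bar>y - t\<bar> < d \<longrightarrow> \<bar>f y - f t - (y - t) * g t\<bar> \<le> c * \<bar>y - t\<bar>))"] by blast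
    then have d: "\<And>t. d t > 0" "\<And>t. t \<in> N \<Longrightarrow> ball t (d t) \<subseteq> U"
      "\<And>t y. t \<in> {a..b} - N \<Longrightarrow> \<bar>y - t\<bar> < d t \<Longrightarrow> \<bar>f y - f t - (y - t) * g t\<bar> \<le> c * \<bar>y - t\<bar>"
      by presburger+
    have "norm ((\<Sum>(x,k)\<in>p. measure lborel k *\<^sub>R g' x) - (f b - f a)) < e"
      if p: "p tagged_division_of {a..b}" and fine: "(\<lambda>t. ball t (d t)) fine p" for p
    proof -
      note tagged_division_ofD[OF p]
      have fin: "finite p" by fact
      define u v where "u i = Inf (snd i)" and "v i = Sup (snd i)" for i :: "real \<times> real set"
      have pk: "snd i = {u i..v i}" "u i \<le> fst i" "fst i \<le> v i" "a \<le> u i" "v i \<le> b"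
        "measure lborel (snd i) = v i - u i" "snd i \<subseteq> ball (fst i) (d (fst i))" if i: "i \<in> p" for i
      proof -
        obtain x K where xK: "i = (x, K)" by (cases i)
        have x: "x \<in> K" "K \<subseteq> {a..b}" using i xK tagged_division_ofD(2,3)[OF p] by auto
        obtain y z where K: "K = cbox y z" using i xK tagged_division_ofD(4)[OF p] by blast
        then have yz: "K = {y..z}" "y \<le> z" using x(1) by auto
        then have "u i = y" "v i = z" unfolding u_def v_def xK by auto
        then show "snd i = {u i..v i}" "u i \<le> fst i" "fst i \<le> v i" "a \<le> u i" "v i \<le> b"
            "measure lborel (snd i) = v i - u i" "snd i \<subseteq> ball (fst i) (d (fst i))"
          using yz x xK i fine by (auto simp: fine_def)
      qed
      have split: "(\<Sum>(x,k)\<in>p. measure lborel k *\<^sub>R g' x) - (f b - f a) = (\<Sum>i\<in>p. (v i - u i) * g' (fst i) - (f (v i) - f (u i)))"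
      proof -
        have "f b - f a = (\<Sum>i\<in>p. f (v i) - f (u i))"
          using additive_tagged_division_1[OF ab p, of f] by (simp add: u_def v_def case_prod_beta)
        moreover have "(\<Sum>(x,k)\<in>p. measure lborel k *\<^sub>R g' x) = (\<Sum>i\<in>p. (v i - u i) * g' (fst i))"
          by (intro sum.cong) (auto simp: pk(6)[symmetric])
        ultimately show ?thesis by (simp add: sum_subtractf)
      qed
      have ba: "b - a = (\<Sum>i\<in>p. v i - u i)"
        using additive_tagged_division_1[OF ab p, of "\<lambda>x. x"] by (simp add: u_def v_def case_prod_beta)
      define P where "P = {i\<in>p. fst i \<in> N}"
      \<comment> \<open>Degenerate intervals have no increment, and absolute continuity speaks of
        proper intervals only.\<close>
      define P' where "P' = {i\<in>P. u i < v i}"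
      have "\<bar>\<Sum>i\<in>p. (v i - u i) * g' (fst i) - (f (v i) - f (u i))\<bar>
          \<le> (\<Sum>i\<in>p. \<bar>(v i - u i) * g' (fst i) - (f (v i) - f (u i))\<bar>)" by (rule sum_abs)
      also have "\<dots> \<le> (\<Sum>i\<in>p. c * (v i - u i) + (if i \<in> P' then \<bar>f (v i) - f (u i)\<bar> else 0))"
      proof (intro sum_mono)
        fix i assume i: "i \<in> p"
        note k = pk[OF i]
        show "\<bar>(v i - u i) * g' (fst i) - (f (v i) - f (u i))\<bar> \<le> c * (v i - u i) + (if i \<in> P' then \<bar>f (v i) - f (u i)\<bar> else 0)"
        proof (cases "fst i \<in> N")
          case True
          then have "g' (fst i) = 0" unfolding g'_def by simp
          moreover have "f (v i) = f (u i) \<and> v i = u i" if "i \<notin> P'"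
          proof -
            have "\<not> u i < v i" using that i True unfolding P'_def P_def by blast
            then have "v i = u i" using k(2,3) by linarith
            then show ?thesis by simp
          qed
          moreover have "0 \<le> c * (v i - u i)" using c k(2,3) by simp
          ultimately show ?thesis by (cases "i \<in> P'") (auto simp: abs_minus_commute)
        next
          case False
          then have t: "fst i \<in> {a..b} - N" using k by auto
          have "u i \<in> snd i" "v i \<in> snd i" unfolding k(1) using k by auto
          then have "\<bar>u i - fst i\<bar> < d (fst i)" "\<bar>v i - fst i\<bar> < d (fst i)"
            using k(7) by (auto simp: dist_real_def subset_eq abs_minus_commute)
          from d(3)[OF t this(1)] d(3)[OF t this(2)]
          have "\<bar>f (u i) - f (fst i) - (u i - fst i) * g (fst i)\<bar> \<le> c * (fst i - u i)"
            "\<bar>f (v i) - f (fst i) - (v i - fst i) * g (fst i)\<bar> \<le> c * (v i - fst i)"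
            using k by auto
          then have "\<bar>(v i - u i) * g (fst i) - (f (v i) - f (u i))\<bar> \<le> c * (v i - u i)"
            by (simp add: algebra_simps abs_le_iff)
          then show ?thesis using False by (auto simp: g'_def)
        qed
      qed
      also have "\<dots> = c * (b - a) + (\<Sum>i\<in>P'. \<bar>f (v i) - f (u i)\<bar>)"
        using fin unfolding ba by (simp add: sum.distrib sum_distrib_left sum.If_cases P'_def P_def Int_def)
      also have "(\<Sum>i\<in>P'. \<bar>f (v i) - f (u i)\<bar>) < e / 2"
      proof (rule \<delta>(2)[rule_format])
        show "finite P'" unfolding P'_def P_def using fin by simp
        show "u i < v i \<and> {u i..v i} \<subseteq> I" if "i \<in> P'" for i
          using that pk[of i] I unfolding P'_def P_def by auto
        show dj: "disjoint_family_on (\<lambda>i. {u i<..<v i}) P'"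
          unfolding disjoint_family_on_def
        proof (intro ballI impI)
          fix i j assume ij: "i \<in> P'" "j \<in> P'" "i \<noteq> j"
          then have "interior (snd i) \<inter> interior (snd j) = {}"
            using tagged_division_ofD(5)[OF p, of "fst i" "snd i" "fst j" "snd j"] unfolding P'_def P_def
            by (auto simp: prod_eq_iff)
          then show "{u i<..<v i} \<inter> {u j<..<v j} = {}"
            using pk(1)[of i] pk(1)[of j] ij unfolding P'_def P_def by auto
        qed
        have "ennreal (\<Sum>i\<in>P'. v i - u i) = (\<Sum>i\<in>P'. emeasure lebesgue {u i<..<v i})"
          unfolding P'_def by (subst sum_ennreal[symmetric]) (auto intro!: sum.cong)
        also have "\<dots> = emeasure lebesgue (\<Union>i\<in>P'. {u i<..<v i})"
          using dj \<open>finite P'\<close> by (intro sum_emeasure) auto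
        also have "\<dots> \<le> emeasure lebesgue U"
        proof (intro emeasure_mono UN_least)
          fix i assume "i \<in> P'"
          then have i: "i \<in> p" "fst i \<in> N" unfolding P'_def P_def by auto
          then show "{u i<..<v i} \<subseteq> U" using pk[OF i(1)] d(2)[OF i(2)] by (auto simp: subset_eq)
        qed (use U in auto)
        also have "\<dots> < ennreal \<delta>" by (rule mU)
        finally show "(\<Sum>i\<in>P'. v i - u i) < \<delta>"
          by (rule ennreal_less_iff[THEN iffD1, rotated]) (auto intro!: sum_nonneg simp: P'_def)
      qed
      also have "c * (b - a) \<le> e / 2" unfolding c_def using e ab by (simp add: field_simps)
      finally show ?thesis unfolding split by simp
    qed
    moreover have "gauge (\<lambda>t. ball t (d t))" using d(1) by (rule gauge_ball_dependent[OF allI])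
    ultimately show "\<exists>\<gamma>. gauge \<gamma> \<and> (\<forall>\<D>. \<D> tagged_division_of {a..b} \<and> \<gamma> fine \<D> \<longrightarrow>
        norm ((\<Sum>(x,k)\<in>\<D>. measure lborel k *\<^sub>R g' x) - (f b - f a)) < e)" by blast
  qed
  then show ?thesis
    by (rule has_integral_spike[OF N, rotated]) (auto simp: g'_def)
qed

text \<open>The fundamental theorem yields gauge integrals, whereas the equations in time use
  extended integrals over open intervals. For non-negative measurable functions the two
  agree.\<close>

lemma nn_integral_open_interval:
  fixes f :: "real \<Rightarrow> real"
  assumes m: "f \<in> borel_measurable borel" and nn: "\<And>w. w \<in> {a..b} \<Longrightarrow> 0 \<le> f w"
    and I: "(f has_integral I) {a..b}"
  shows "(\<integral>\<^sup>+w\<in>{a<..<b}. ennreal (f w) \<partial>lborel) = ennreal I"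
proof -
  have "(\<integral>\<^sup>+w\<in>{a<..<b}. ennreal (f w) \<partial>lborel) = (\<integral>\<^sup>+w. ennreal (if w \<in> {a..b} then f w else 0) \<partial>lborel)"
    by (rule nn_integral_cong_AE)
       (use AE_lborel_singleton[of a] AE_lborel_singleton[of b] in \<open>eventually_elim, auto split: split_indicator\<close>)
  also have "\<dots> = ennreal I"
    using m nn I[folded has_integral_restrict_UNIV[of _ f]]
    by (intro nn_integral_has_integral_lborel) auto
  finally show ?thesis .
qed

lemma abs_continuous_on_Lipschitz:
  fixes f :: "real \<Rightarrow> real"
  assumes "\<And>a b. a \<in> I \<Longrightarrow> b \<in> I \<Longrightarrow> a \<le> b \<Longrightarrow> \<bar>f b - f a\<bar> \<le> K * (b - a)" and K: "0 \<le> K"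
  shows "abs_continuous_on I f"
  unfolding abs_continuous_on_def
proof (intro allI impI)
  fix e :: real assume e: "0 < e"
  show "\<exists>\<delta>>0. \<forall>(n::nat) a b. (\<forall>i<n. a i < b i \<and> {a i..b i} \<subseteq> I) \<and>
       disjoint_family_on (\<lambda>i. {a i<..<b i}) {..<n} \<and> (\<Sum>i<n. b i - a i) < \<delta> \<longrightarrow>
       (\<Sum>i<n. \<bar>f (b i) - f (a i)\<bar>) < e"
  proof (intro exI[of _ "e / (K + 1)"] conjI allI impI)
    show "0 < e / (K + 1)" using e K by simp
    fix n :: nat and a b :: "nat \<Rightarrow> real"
    assume *: "(\<forall>i<n. a i < b i \<and> {a i..b i} \<subseteq> I) \<and>
       disjoint_family_on (\<lambda>i. {a i<..<b i}) {..<n} \<and> (\<Sum>i<n. b i - a i) < e / (K + 1)"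
    have "(\<Sum>i<n. \<bar>f (b i) - f (a i)\<bar>) \<le> (\<Sum>i<n. K * (b i - a i))"
    proof (intro sum_mono)
      fix i assume "i \<in> {..<n}"
      then have "a i < b i" "{a i..b i} \<subseteq> I" using * by auto
      then show "\<bar>f (b i) - f (a i)\<bar> \<le> K * (b i - a i)"
        by (intro assms(1)) (auto simp: subset_eq)
    qed
    also have "\<dots> = K * (\<Sum>i<n. b i - a i)" by (simp add: sum_distrib_left)
    also have "\<dots> \<le> K * (e / (K + 1))" using * K by (intro mult_left_mono) auto
    also have "\<dots> < e" using e K by (simp add: field_simps)
    finally show "(\<Sum>i<n. \<bar>f (b i) - f (a i)\<bar>) < e" .
  qed
qed

section \<open>Integral identities for survival probabilities\<close>

lemma abs_exp_diff_le:
  fixes x y :: real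
  assumes "x \<le> 0" "y \<le> 0"
  shows "\<bar>exp x - exp y\<bar> \<le> \<bar>x - y\<bar>"
proof -
  have *: "exp x - exp y \<le> x - y \<and> exp y \<le> exp x" if "y \<le> x" "x \<le> 0" for x y :: real
  proof -
    have "1 - exp (y - x) \<le> x - y" using exp_ge_add_one_self[of "y - x"] by linarith
    then have "exp x * (1 - exp (y - x)) \<le> 1 * (x - y)"
      using that by (intro mult_mono) auto
    moreover have "exp x * (1 - exp (y - x)) = exp x - exp y" by (simp add: algebra_simps exp_diff)
    ultimately show ?thesis using that by simp
  qed
  show ?thesis using *[of y x] *[of x y] assms by (cases "y \<le> x") auto
qed

text \<open>For a rate that is merely measurable, survival is differentiable in time only almost
  everywhere. As the rate is bounded, the exponentials are Lipschitz, hence absolutely continuous,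
  and the fundamental theorem integrates their derivatives. The first identity varies the end of the
  survival interval, the second its beginning.\<close>

lemma exp_integral_identities:
  fixes r :: "real \<Rightarrow> real"
  assumes rm: "r \<in> borel_measurable borel" and r0: "\<And>s. 0 \<le> r s" and rK: "\<And>s. r s \<le> K" and ut: "u \<le> t"
  defines "S \<equiv> \<lambda>u t. exp (- (LINT s:{u..t}|lborel. r s))"
  shows "(\<integral>\<^sup>+w\<in>{u<..<t}. ennreal (r w * S u w) \<partial>lborel) = ennreal (1 - S u t)"
    and "(\<integral>\<^sup>+w\<in>{u<..<t}. ennreal (r w * S w t) \<partial>lborel) = ennreal (1 - S u t)"
proof -
  have K: "0 \<le> K" using r0 rK order_trans by blast
  have ri: "set_integrable lborel {a..b} r" for a b :: real
    unfolding set_integrable_def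
    by (rule Bochner_Integration.integrable_bound[of _ "\<lambda>x. K * indicator {a..b} x"])
       (use rm r0 in \<open>auto intro!: integrable_real_indicator AE_I2 order_trans[OF rK abs_ge_self]
         simp: emeasure_lborel_Icc_eq split: split_indicator\<close>)
  \<comment> \<open>The base point lies to the left of \<open>u\<close>, and the integral is
    differentiated up to \<open>t + 1\<close>: differentiability almost everywhere is known on open
    intervals and is needed on all of \<open>{u..t}\<close>.\<close>
  define a where "a = u - 1"
  define R where "R w = (LINT s:{a..w}|lborel. r s)" for w
  have Rd: "R w - R v = (LINT s:{v..w}|lborel. r s)" if "a \<le> v" "v \<le> w" for v w
    unfolding R_def using that by (intro set_integral_Icc_diff ri)
  have Rd0: "0 \<le> R w - R v" "R w - R v \<le> K * (w - v)" if "a \<le> v" "v \<le> w" for v w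
  proof -
    show "0 \<le> R w - R v" unfolding Rd[OF that] set_lebesgue_integral_def using r0 by (intro integral_nonneg_AE) auto
    have "(LINT s:{v..w}|lborel. r s) \<le> (LINT s:{v..w}|lborel. K)"
      using ri rK by (intro set_integral_mono) (auto simp: set_integrable_def intro!: integrable_real_indicator simp: emeasure_lborel_Icc_eq)
    also have "\<dots> = K * (w - v)" using that by (simp add: set_lebesgue_integral_def)
    finally show "R w - R v \<le> K * (w - v)" unfolding Rd[OF that] .
  qed
  have S1: "S u w = exp (- (R w - R u))" if "u \<le> w" for w
    unfolding S_def using Rd[of u w] that by (simp add: a_def)
  have S2: "S w t = exp (R w - R t)" if "u \<le> w" "w \<le> t" for w
    unfolding S_def using Rd[of w t] that by (simp add: a_def)
  obtain N where N: "N \<in> null_sets lborel" "\<And>w. w \<in> {a<..<t+1} \<Longrightarrow> w \<notin> N \<Longrightarrow> (R has_real_derivative r w) (at w)"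
    using lebesgue_differentiation[OF ri[of a "t+1"]] unfolding R_def eventually_ae_filter by auto
  have negN: "negligible N" using N(1) by (auto simp: negligible_iff_null_sets null_sets_completionI)
  have Rcont: "continuous_on {a..t+1} R"
    unfolding continuous_on_iff
  proof (intro ballI allI impI)
    fix x e :: real assume x: "x \<in> {a..t+1}" and e: "0 < e"
    have L: "\<bar>R y - R x\<bar> \<le> K * \<bar>y - x\<bar>" if "y \<in> {a..t+1}" for y
      using Rd0[of x y] Rd0[of y x] x that by (cases "x \<le> y") auto
    show "\<exists>d>0. \<forall>x'\<in>{a..t+1}. dist x' x < d \<longrightarrow> dist (R x') (R x) < e"
    proof (intro exI[of _ "e / (K + 1)"] conjI ballI impI)
      fix y assume y: "y \<in> {a..t+1}" "dist y x < e / (K + 1)"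
      have "\<bar>R y - R x\<bar> \<le> K * (e / (K + 1))" using L[OF y(1)] y(2) K mult_left_mono[of "\<bar>y - x\<bar>" "e / (K + 1)" K] by (auto simp: dist_real_def)
      also have "\<dots> < e" using e K by (simp add: field_simps)
      finally show "dist (R y) (R x) < e" by (simp add: dist_real_def)
    qed (use e K in simp)
  qed
  have Rm: "(\<lambda>w. indicator {u..t} w * R w) \<in> borel_measurable borel"
    using borel_measurable_continuous_on_indicator[of "{u..t}" R] continuous_on_subset[OF Rcont, of "{u..t}"]
    by (auto simp: a_def)
  \<comment> \<open>Measurability of \<open>R\<close> comes from its continuity, which is known on a
    bounded interval only; the indicator keeps \<open>R\<close> inside it.\<close>
  have meas: "(\<lambda>w. indicator {u..t} w * (r w * exp (c * (indicator {u..t} w * R w) + d))) \<in> borel_measurable borel" for c d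
    using rm Rm by measurable
  \<comment> \<open>Both identities at once: \<open>c\<close> is the sign of \<open>R\<close> in the
    exponent. Since \<open>c * c = 1\<close>, the function \<open>c * exp (c * R w + d)\<close> has
    derivative \<open>r w * exp (c * R w + d)\<close>, and the non-positive exponent keeps its
    Lipschitz constant at \<open>K\<close>.\<close>
  have main: "((\<lambda>w. r w * exp (c * R w + d)) has_integral c * (exp (c * R t + d) - exp (c * R u + d))) {u..t}"
    if c: "c \<in> {1, -1}" and le0: "\<And>w. w \<in> {u..t} \<Longrightarrow> c * R w + d \<le> 0" for c d
  proof -
    have "abs_continuous_on {u..t} (\<lambda>w. c * exp (c * R w + d))"
    proof (rule abs_continuous_on_Lipschitz[OF _ K])
      fix v w assume vw: "v \<in> {u..t}" "w \<in> {u..t}" "v \<le> w"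
      have "\<bar>c * exp (c * R w + d) - c * exp (c * R v + d)\<bar> = \<bar>exp (c * R w + d) - exp (c * R v + d)\<bar>"
        using c by auto
      also have "\<dots> \<le> \<bar>(c * R w + d) - (c * R v + d)\<bar>" by (intro abs_exp_diff_le le0 vw)
      also have "\<dots> = \<bar>R w - R v\<bar>" using c by auto
      also have "\<dots> \<le> K * (w - v)" using Rd0[of v w] vw by (auto simp: a_def)
      finally show "\<bar>c * exp (c * R w + d) - c * exp (c * R v + d)\<bar> \<le> K * (w - v)" .
    qed
    then have "((\<lambda>w. r w * exp (c * R w + d)) has_integral c * exp (c * R t + d) - c * exp (c * R u + d)) {u..t}"
    proof (rule FTC_abs_continuous[OF _ order_refl ut negN])
      fix w assume "w \<in> {u..t}" "w \<notin> N"
      then have "(R has_real_derivative r w) (at w)" by (intro N(2)) (auto simp: a_def)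
      then have "((\<lambda>w. c * exp (c * R w + d)) has_real_derivative c * (exp (c * R w + d) * (c * r w))) (at w)"
        by (auto intro!: derivative_eq_intros)
      also have "c * (exp (c * R w + d) * (c * r w)) = r w * exp (c * R w + d)" using c by auto
      finally show "((\<lambda>w. c * exp (c * R w + d)) has_real_derivative r w * exp (c * R w + d)) (at w)" .
    qed
    then show ?thesis by (simp add: algebra_simps)
  qed
  have fin: "(\<integral>\<^sup>+w\<in>{u<..<t}. ennreal (r w * exp (c * R w + d)) \<partial>lborel) = ennreal (c * (exp (c * R t + d) - exp (c * R u + d)))"
    if c: "c \<in> {1, -1}" and le0: "\<And>w. w \<in> {u..t} \<Longrightarrow> c * R w + d \<le> 0" for c d
  proof -
    have "((\<lambda>w. indicator {u..t} w * (r w * exp (c * (indicator {u..t} w * R w) + d))) has_integral c * (exp (c * R t + d) - exp (c * R u + d))) {u..t}"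
      by (rule has_integral_eq[OF _ main[OF c le0]]) auto
    from nn_integral_open_interval[OF meas _ this]
    have "(\<integral>\<^sup>+w\<in>{u<..<t}. ennreal (indicator {u..t} w * (r w * exp (c * (indicator {u..t} w * R w) + d))) \<partial>lborel) = ennreal (c * (exp (c * R t + d) - exp (c * R u + d)))"
      using r0 by auto
    then show ?thesis by (subst (asm) nn_integral_cong) (auto split: split_indicator)
  qed
  have mono: "R u \<le> R w" "R w \<le> R t" if "w \<in> {u..t}" for w
    using Rd0(1)[of u w] Rd0(1)[of w t] that by (auto simp: a_def)
  have "(\<integral>\<^sup>+w\<in>{u<..<t}. ennreal (r w * S u w) \<partial>lborel) = (\<integral>\<^sup>+w\<in>{u<..<t}. ennreal (r w * exp ((-1) * R w + R u)) \<partial>lborel)"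
    by (intro nn_integral_cong) (auto simp: S1 algebra_simps split: split_indicator)
  also have "\<dots> = ennreal (1 - S u t)"
    by (subst fin) (use mono ut in \<open>auto simp: S1 algebra_simps\<close>)
  finally show "(\<integral>\<^sup>+w\<in>{u<..<t}. ennreal (r w * S u w) \<partial>lborel) = ennreal (1 - S u t)" .
  have "(\<integral>\<^sup>+w\<in>{u<..<t}. ennreal (r w * S w t) \<partial>lborel) = (\<integral>\<^sup>+w\<in>{u<..<t}. ennreal (r w * exp (1 * R w + - R t)) \<partial>lborel)"
    by (intro nn_integral_cong) (auto simp: S2 algebra_simps split: split_indicator)
  also have "\<dots> = ennreal (1 - S u t)"
    by (subst fin) (use mono ut in \<open>auto simp: S1 algebra_simps\<close>)
  finally show "(\<integral>\<^sup>+w\<in>{u<..<t}. ennreal (r w * S w t) \<partial>lborel) = ennreal (1 - S u t)" .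
qed

section \<open>Differential and integrated form of an evolution equation\<close>

lemma nn_integral_interval_bounded:
  fixes a :: "real \<Rightarrow> ennreal"
  assumes "\<And>w. w \<in> {u<..<t} \<Longrightarrow> a w \<le> ennreal M"
  shows "(\<integral>\<^sup>+w\<in>{u<..<t}. a w \<partial>lborel) < \<infinity>"
proof -
  have "(\<integral>\<^sup>+w\<in>{u<..<t}. a w \<partial>lborel) \<le> (\<integral>\<^sup>+w. ennreal M * indicator {u<..<t} w \<partial>lborel)"
    using assms by (intro nn_integral_mono) (auto split: split_indicator)
  also have "\<dots> = ennreal M * emeasure lborel {u<..<t}" by (rule nn_integral_cmult_indicator) simp
  also have "\<dots> < \<infinity>" by (cases "u \<le> t") (auto simp: ennreal_mult_less_top)
  finally show ?thesis .
qed

lemma nn_integral_set_add: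
  fixes f g :: "real \<Rightarrow> ennreal"
  assumes "f \<in> borel_measurable borel" "g \<in> borel_measurable borel"
  shows "(\<integral>\<^sup>+v\<in>{u<..<t}. f v + g v \<partial>lborel) = (\<integral>\<^sup>+v\<in>{u<..<t}. f v \<partial>lborel) + (\<integral>\<^sup>+v\<in>{u<..<t}. g v \<partial>lborel)"
  using assms by (simp add: distrib_right nn_integral_add)

lemma nn_integral_set_cong:
  fixes f g :: "real \<Rightarrow> ennreal"
  assumes "\<And>v. u < v \<Longrightarrow> v < t \<Longrightarrow> f v = g v"
  shows "(\<integral>\<^sup>+v\<in>{u<..<t}. f v \<partial>lborel) = (\<integral>\<^sup>+v\<in>{u<..<t}. g v \<partial>lborel)"
  using assms by (intro nn_integral_cong) (auto split: split_indicator)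

text \<open>Single intervals in the definition give uniform continuity, and a uniformly continuous
  function on a bounded interval is bounded. For a competitor \<open>P\<close> this bounds the mass
  of a \<open>(q, s)\<close>-bounded set uniformly in time, and with it the rate of loss.\<close>

lemma abs_continuous_on_bounded:
  assumes "abs_continuous_on {u<..<s} F"
  shows "\<exists>M. \<forall>t\<in>{u<..<s}. \<bar>F t\<bar> \<le> M"
proof -
  have "uniformly_continuous_on {u<..<s} F"
    unfolding uniformly_continuous_on_def
  proof (intro allI impI)
    fix e :: real assume "0 < e"
    then obtain \<delta> where \<delta>: "0 < \<delta>" "\<And>(n::nat) a b. (\<forall>i<n. a i < b i \<and> {a i..b i} \<subseteq> {u<..<s}) \<Longrightarrow>
       disjoint_family_on (\<lambda>i. {a i<..<b i}) {..<n} \<Longrightarrow>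
       (\<Sum>i<n. b i - a i) < \<delta> \<Longrightarrow> (\<Sum>i<n. \<bar>F (b i) - F (a i)\<bar>) < e"
      using assms unfolding abs_continuous_on_def by meson
    have *: "\<bar>F y - F x\<bar> < e" if "x \<in> {u<..<s}" "y \<in> {u<..<s}" "x < y" "y - x < \<delta>" for x y
    proof -
      have "{x..y} \<subseteq> {u<..<s}" using that by auto
      then show ?thesis using \<delta>(2)[of 1 "\<lambda>_. x" "\<lambda>_. y"] that by (simp add: disjoint_family_on_def)
    qed
    have "dist (F y) (F x) < e" if "x \<in> {u<..<s}" "y \<in> {u<..<s}" "dist y x < \<delta>" for x y
    proof (cases x y rule: linorder_cases)
      case less
      then show ?thesis using *[of x y] that by (simp add: dist_real_def)
    next
      case equal
      then show ?thesis using \<open>0 < e\<close> by simp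
    next
      case greater
      then show ?thesis using *[of y x] that by (simp add: dist_real_def abs_minus_commute)
    qed
    then show "\<exists>d>0. \<forall>x\<in>{u<..<s}. \<forall>x'\<in>{u<..<s}. dist x' x < d \<longrightarrow> dist (F x') (F x) < e"
      using \<delta>(1) by blast
  qed
  then have "bounded (F ` {u<..<s})"
    by (rule bounded_uniformly_continuous_image) (use bounded_box[of u s] in \<open>simp add: box_real\<close>)
  then show ?thesis unfolding bounded_iff by auto
qed

lemma nn_integral_shrinking_interval:
  fixes f :: "real \<Rightarrow> ennreal"
  assumes [measurable]: "f \<in> borel_measurable borel" and u: "decseq v" "v \<longlonglongrightarrow> u" "\<And>n. u < v n"
  shows "(\<lambda>n. \<integral>\<^sup>+w\<in>{v n<..<t}. f w \<partial>lborel) \<longlonglongrightarrow> (\<integral>\<^sup>+w\<in>{u<..<t}. f w \<partial>lborel)"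
proof (rule nn_integral_LIMSEQ)
  show "incseq (\<lambda>n w. f w * indicator {v n<..<t} w)"
    using u(1) unfolding incseq_def decseq_def le_fun_def
    by (force split: split_indicator intro: le_less_trans)
  show "(\<lambda>n. f w * indicator {v n<..<t} w) \<longlonglongrightarrow> f w * indicator {u<..<t} w" for w
  proof (cases "u < w")
    case True
    have "eventually (\<lambda>n. v n < w) sequentially" using order_tendstoD(2)[OF u(2) True] .
    then show ?thesis
      by (intro tendsto_eventually, elim eventually_mono) (use True in \<open>auto split: split_indicator\<close>)
  next
    case False
    then have "\<not> v n < w" for n using u(3)[of n] by simp
    then show ?thesis using False by (simp add: indicator_def)
  qed
qed measurable

text \<open>The fundamental theorem is applied on \<open>{v..t}\<close> with \<open>u < v\<close>,
  because absolute continuity is given on the open interval only; the value at \<open>u\<close>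
  enters as the limit for \<open>v\<close> tending to \<open>u\<close>. With the loss on the left no
  extended numbers are subtracted.\<close>

lemma derivative_imp_integrated:
  fixes F :: "real \<Rightarrow> real" and a b :: "real \<Rightarrow> ennreal"
  assumes ac: "abs_continuous_on {u<..<s} F" and lim: "(F \<longlongrightarrow> c) (at_right u)"
    and [measurable]: "a \<in> borel_measurable borel" "b \<in> borel_measurable borel"
    and aM: "\<And>w. a w \<le> ennreal M"
    and deriv: "AE t in lborel. t \<in> {u<..<s} \<longrightarrow> b t < \<infinity> \<and>
      (F has_real_derivative - enn2real (a t) + enn2real (b t)) (at t)"
    and F0: "\<And>t. t \<in> {u<..<s} \<Longrightarrow> 0 \<le> F t" and t: "t \<in> {u<..<s}"
  shows "ennreal (F t) + (\<integral>\<^sup>+w\<in>{u<..<t}. a w \<partial>lborel) = ennreal c + (\<integral>\<^sup>+w\<in>{u<..<t}. b w \<partial>lborel)"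
proof -
  obtain N where N: "N \<in> null_sets lborel" "\<And>t. t \<in> {u<..<s} \<Longrightarrow> t \<notin> N \<Longrightarrow>
      b t < \<infinity> \<and> (F has_real_derivative - enn2real (a t) + enn2real (b t)) (at t)"
    using deriv unfolding eventually_ae_filter by auto
  have negN: "negligible N" using N(1) by (auto simp: negligible_iff_null_sets null_sets_completionI)
  have step: "ennreal (F t) + (\<integral>\<^sup>+w\<in>{v<..<t}. a w \<partial>lborel) = ennreal (F v) + (\<integral>\<^sup>+w\<in>{v<..<t}. b w \<partial>lborel)"
    if v: "u < v" "v < t" for v
  proof -
    have sub: "{v..t} \<subseteq> {u<..<s}" using v t by auto
    have afin: "a w < top" for w using aM[of w] by (auto simp: le_less_trans)
    have aM': "enn2real (a w) \<le> max 0 M" for w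
      using aM[of w] by (cases "a w") (auto simp: ennreal_le_iff2 max_def)
    have ai: "set_integrable lborel {v..t} (\<lambda>w. enn2real (a w))"
      unfolding set_integrable_def
      by (rule Bochner_Integration.integrable_bound[of _ "\<lambda>w. max 0 M * indicator {v..t} w"])
         (use aM' in \<open>auto intro!: integrable_real_indicator simp: emeasure_lborel_Icc_eq split: split_indicator\<close>)
    define A where "A = integral {v..t} (\<lambda>w. enn2real (a w))"
    have hA: "((\<lambda>w. enn2real (a w)) has_integral A) {v..t}"
      unfolding A_def using set_borel_integral_eq_integral(1)[OF ai] by (rule integrable_integral)
    have hF: "((\<lambda>w. - enn2real (a w) + enn2real (b w)) has_integral F t - F v) {v..t}"
      by (rule FTC_abs_continuous[OF ac sub _ negN]) (use v N(2) sub in auto)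
    \<comment> \<open>Integrability of the gain \<open>b\<close> is a result here: \<open>b\<close>
      is the derivative plus the bounded loss, and both of these are integrable.\<close>
    have hB: "((\<lambda>w. enn2real (b w)) has_integral A + (F t - F v)) {v..t}"
      using has_integral_add[OF hA hF] by simp
    have A0: "0 \<le> A" by (rule has_integral_nonneg[OF hA]) simp
    have B0: "0 \<le> A + (F t - F v)" by (rule has_integral_nonneg[OF hB]) simp
    have "(\<integral>\<^sup>+w\<in>{v<..<t}. a w \<partial>lborel) = (\<integral>\<^sup>+w\<in>{v<..<t}. ennreal (enn2real (a w)) \<partial>lborel)"
      using afin by simp
    also have "\<dots> = ennreal A" by (rule nn_integral_open_interval[OF _ _ hA]) auto
    finally have IA: "(\<integral>\<^sup>+w\<in>{v<..<t}. a w \<partial>lborel) = ennreal A" .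
    have "AE w in lborel. w \<notin> N" using N(1) by (rule AE_not_in)
    then have "AE w in lborel. b w * indicator {v<..<t} w = ennreal (enn2real (b w)) * indicator {v<..<t} w"
    proof eventually_elim
      case (elim w)
      then show ?case using N(2)[of w] sub by (auto split: split_indicator simp: subset_eq)
    qed
    then have "(\<integral>\<^sup>+w\<in>{v<..<t}. b w \<partial>lborel) = (\<integral>\<^sup>+w\<in>{v<..<t}. ennreal (enn2real (b w)) \<partial>lborel)"
      by (rule nn_integral_cong_AE)
    also have "\<dots> = ennreal (A + (F t - F v))" by (rule nn_integral_open_interval[OF _ _ hB]) auto
    finally have IB: "(\<integral>\<^sup>+w\<in>{v<..<t}. b w \<partial>lborel) = ennreal (A + (F t - F v))" .
    have "0 \<le> F t" "0 \<le> F v" using F0 t v by auto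
    then show ?thesis unfolding IA IB using A0 B0 by (simp flip: ennreal_plus)
  qed
  \<comment> \<open>The denominators start at 2, so that \<open>v 0 < t\<close> as well.\<close>
  define v where "v n = u + (t - u) * inverse (real (Suc (Suc n)))" for n
  have ut: "u < t" using t by simp
  have v: "u < v n" "v n < t" for n
  proof -
    have i: "0 < inverse (real (Suc (Suc n)))" "inverse (real (Suc (Suc n))) < 1"
      by (auto simp: inverse_less_1_iff)
    show "u < v n" unfolding v_def using mult_pos_pos[of "t - u", OF _ i(1)] ut by simp
    have "(t - u) * inverse (real (Suc (Suc n))) < (t - u) * 1"
      by (rule mult_strict_left_mono[OF i(2)]) (use ut in simp)
    then show "v n < t" unfolding v_def by (simp only: mult_1_right less_diff_eq add.commute)
  qed
  have dec: "decseq v"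
    unfolding v_def decseq_def using ut by (auto intro!: mult_left_mono le_imp_inverse_le)
  have vlim: "v \<longlonglongrightarrow> u"
  proof -
    have "v \<longlonglongrightarrow> u + (t - u) * 0"
      unfolding v_def by (intro tendsto_add tendsto_mult tendsto_const LIMSEQ_Suc[OF LIMSEQ_inverse_real_of_nat])
    then show ?thesis by simp
  qed
  have "filterlim v (at_right u) sequentially"
    using vlim v(1) by (intro filterlim_at_withinI) (auto simp: eventually_sequentially greaterThan_def less_imp_neq[symmetric])
  then have Flim: "(\<lambda>n. ennreal (F (v n))) \<longlonglongrightarrow> ennreal c"
    by (intro tendsto_ennrealI filterlim_compose[OF lim])
  have "(\<lambda>n. ennreal (F t) + (\<integral>\<^sup>+w\<in>{v n<..<t}. a w \<partial>lborel)) \<longlonglongrightarrow> ennreal (F t) + (\<integral>\<^sup>+w\<in>{u<..<t}. a w \<partial>lborel)"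
    by (intro tendsto_add tendsto_const nn_integral_shrinking_interval dec vlim v) measurable
  moreover have "(\<lambda>n. ennreal (F (v n)) + (\<integral>\<^sup>+w\<in>{v n<..<t}. b w \<partial>lborel)) \<longlonglongrightarrow> ennreal c + (\<integral>\<^sup>+w\<in>{u<..<t}. b w \<partial>lborel)"
    by (intro tendsto_add Flim nn_integral_shrinking_interval dec vlim v) measurable
  ultimately show ?thesis unfolding step[OF v] by (rule LIMSEQ_unique)
qed

text \<open>Finite integrals make \<open>a\<close> and \<open>b\<close> finite almost everywhere, so
  real functions may replace them. Then \<open>F\<close> is \<open>c\<close> plus an indefinite
  integral, which is absolutely continuous and, by Lebesgue's theorem, differentiable almost
  everywhere.\<close>

lemma integrated_imp_derivative:
  fixes F :: "real \<Rightarrow> real" and a b :: "real \<Rightarrow> ennreal"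
  assumes us: "u < s" and [measurable]: "a \<in> borel_measurable borel" "b \<in> borel_measurable borel"
    and afin: "(\<integral>\<^sup>+w\<in>{u<..<s}. a w \<partial>lborel) < \<infinity>" and bfin: "(\<integral>\<^sup>+w\<in>{u<..<s}. b w \<partial>lborel) < \<infinity>"
    and F0: "\<And>t. t \<in> {u<..<s} \<Longrightarrow> 0 \<le> F t" and c0: "0 \<le> c"
    and eq: "\<And>t. t \<in> {u<..<s} \<Longrightarrow>
      ennreal (F t) + (\<integral>\<^sup>+w\<in>{u<..<t}. a w \<partial>lborel) = ennreal c + (\<integral>\<^sup>+w\<in>{u<..<t}. b w \<partial>lborel)"
  shows "abs_continuous_on {u<..<s} F" and "(F \<longlongrightarrow> c) (at_right u)"
    and "AE t in lborel. t \<in> {u<..<s} \<longrightarrow> a t < \<infinity> \<and> b t < \<infinity> \<and>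
      (F has_real_derivative - enn2real (a t) + enn2real (b t)) (at t)"
proof -
  have fin: "AE w in lborel. w \<in> {u<..<s} \<longrightarrow> f w < \<infinity>"
    and int: "set_integrable lborel {u..s} (\<lambda>w. enn2real (f w))"
    and val: "\<And>t. t \<in> {u<..<s} \<Longrightarrow> ennreal (LINT w:{u..t}|lborel. enn2real (f w)) = (\<integral>\<^sup>+w\<in>{u<..<t}. f w \<partial>lborel)"
    if [measurable]: "f \<in> borel_measurable borel" and f: "(\<integral>\<^sup>+w\<in>{u<..<s}. f w \<partial>lborel) < \<infinity>" for f :: "real \<Rightarrow> ennreal"
  proof -
    have "AE w in lborel. f w * indicator {u<..<s} w \<noteq> \<infinity>"
      by (rule nn_integral_noteq_infinite) (use f in auto)
    then show fin: "AE w in lborel. w \<in> {u<..<s} \<longrightarrow> f w < \<infinity>"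
      by eventually_elim (auto simp: less_top)
    have eqn: "(\<integral>\<^sup>+w. ennreal (indicator {u..t} w *\<^sub>R enn2real (f w)) \<partial>lborel) = (\<integral>\<^sup>+w\<in>{u<..<t}. f w \<partial>lborel)" if "t \<le> s" for t
    proof (rule nn_integral_cong_AE)
      show "AE w in lborel. ennreal (indicator {u..t} w *\<^sub>R enn2real (f w)) = f w * indicator {u<..<t} w"
        using fin AE_lborel_singleton[of u] AE_lborel_singleton[of t]
        by eventually_elim (use that in \<open>auto split: split_indicator\<close>)
    qed
    show int: "set_integrable lborel {u..s} (\<lambda>w. enn2real (f w))"
      unfolding set_integrable_def using eqn[OF order_refl] f by (intro integrableI_nonneg) auto
    fix t assume t: "t \<in> {u<..<s}"
    have "set_integrable lborel {u..t} (\<lambda>w. enn2real (f w))"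
      by (rule set_integrable_subset[OF int]) (use t in auto)
    from nn_integral_eq_integral[OF this[unfolded set_integrable_def]]
    show "ennreal (LINT w:{u..t}|lborel. enn2real (f w)) = (\<integral>\<^sup>+w\<in>{u<..<t}. f w \<partial>lborel)"
      unfolding set_lebesgue_integral_def using eqn[of t] t by simp
  qed
  note A = fin[OF assms(2) afin] int[OF assms(2) afin] val[OF assms(2) afin]
  note B = fin[OF assms(3) bfin] int[OF assms(3) bfin] val[OF assms(3) bfin]
  define h where "h w = - enn2real (a w) + enn2real (b w)" for w
  have h: "set_integrable lborel {u..s} h"
    using set_integral_diff(1)[OF B(2) A(2)] unfolding h_def by (simp add: algebra_simps)
  have F: "F t = c + (LINT w:{u..t}|lborel. h w)" if t: "t \<in> {u<..<s}" for t
  proof -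
    have i: "set_integrable lborel {u..t} (\<lambda>w. enn2real (a w))" "set_integrable lborel {u..t} (\<lambda>w. enn2real (b w))"
      using t by (auto intro: set_integrable_subset[OF A(2)] set_integrable_subset[OF B(2)])
    have "ennreal (F t) + ennreal (LINT w:{u..t}|lborel. enn2real (a w)) = ennreal c + ennreal (LINT w:{u..t}|lborel. enn2real (b w))"
      unfolding A(3)[OF t] B(3)[OF t] by (rule eq[OF t])
    moreover have "0 \<le> (LINT w:{u..t}|lborel. enn2real (a w))" "0 \<le> (LINT w:{u..t}|lborel. enn2real (b w))"
      unfolding set_lebesgue_integral_def by (auto intro!: integral_nonneg_AE)
    ultimately have "F t + (LINT w:{u..t}|lborel. enn2real (a w)) = c + (LINT w:{u..t}|lborel. enn2real (b w))"
      using F0[OF t] c0 by (simp flip: ennreal_plus)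
    moreover have "(LINT w:{u..t}|lborel. h w) = (LINT w:{u..t}|lborel. enn2real (b w)) - (LINT w:{u..t}|lborel. enn2real (a w))"
      unfolding h_def using set_integral_diff(2)[OF i(2,1)] by (simp add: algebra_simps)
    ultimately show ?thesis by simp
  qed
  show "abs_continuous_on {u<..<s} F"
    by (rule abs_continuous_on_integral[OF h]) (use F in auto)
  show "(F \<longlongrightarrow> c) (at_right u)"
  proof -
    have "continuous_on {u..s} (\<lambda>t. integral {u..t} h)"
      by (rule indefinite_integral_continuous_1[OF set_borel_integral_eq_integral(1)[OF h]])
    then have "((\<lambda>t. integral {u..t} h) \<longlongrightarrow> integral {u..u} h) (at u within {u..s})"
      using us by (auto dest!: continuous_on_def[THEN iffD1] bspec[of _ _ u])
    then have "((\<lambda>t. c + integral {u..t} h) \<longlongrightarrow> c + 0) (at u within {u..s})"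
      by (intro tendsto_add tendsto_const) simp
    then have "((\<lambda>t. c + integral {u..t} h) \<longlongrightarrow> c) (at_right u)"
      using us by (simp add: at_within_Icc_at_right)
    then show ?thesis
    proof (rule Lim_transform_eventually)
      have "eventually (\<lambda>t. t \<in> {u<..<s}) (at_right u)"
        using us by (auto simp: eventually_at_right)
      then show "eventually (\<lambda>t. c + integral {u..t} h = F t) (at_right u)"
      proof eventually_elim
        case (elim t)
        have "set_integrable lborel {u..t} h"
          by (rule set_integrable_subset[OF h]) (use elim in auto)
        from set_borel_integral_eq_integral(2)[OF this] show ?case using F[OF elim] by simp
      qed
    qed
  qed
  show "AE t in lborel. t \<in> {u<..<s} \<longrightarrow> a t < \<infinity> \<and> b t < \<infinity> \<and>
      (F has_real_derivative - enn2real (a t) + enn2real (b t)) (at t)"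
    using A(1) B(1) lebesgue_differentiation[OF h]
  proof eventually_elim
    case (elim t)
    show ?case
    proof (intro impI conjI)
      assume t: "t \<in> {u<..<s}"
      show "a t < \<infinity>" "b t < \<infinity>" using elim t by auto
      have "((\<lambda>t. LINT w:{u..t}|lborel. h w) has_real_derivative h t) (at t)" using elim t by blast
      then have "((\<lambda>t. c + (LINT w:{u..t}|lborel. h w)) has_real_derivative h t) (at t)"
        by (auto intro!: derivative_eq_intros)
      then show "(F has_real_derivative - enn2real (a t) + enn2real (b t)) (at t)"
        unfolding h_def[symmetric]
        by (rule has_field_derivative_transform_within_open[of _ _ _ "{u<..<s}"]) (use t F in auto)
    qed
  qed
qed

section \<open>Analytic sets and Novikov separation\<close>

text \<open>The basic neighbourhoods in Baire space. Closedness and continuity are expressed through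
  them directly, so that no topology on sequences has to be set up.\<close>

definition cylinder :: "(nat \<Rightarrow> nat) \<Rightarrow> nat \<Rightarrow> (nat \<Rightarrow> nat) set" where
  "cylinder \<alpha> n = {\<beta>. \<forall>i<n. \<beta> i = \<alpha> i}"

definition baire_closed :: "(nat \<Rightarrow> nat) set \<Rightarrow> bool" where
  "baire_closed D \<longleftrightarrow> (\<forall>\<alpha>. (\<forall>n. D \<inter> cylinder \<alpha> n \<noteq> {}) \<longrightarrow> \<alpha> \<in> D)"

definition baire_continuous :: "'b topology \<Rightarrow> (nat \<Rightarrow> nat) set \<Rightarrow> ((nat \<Rightarrow> nat) \<Rightarrow> 'b) \<Rightarrow> bool" where
  "baire_continuous T D f \<longleftrightarrow>
    (\<forall>\<alpha>\<in>D. \<forall>U. openin T U \<and> f \<alpha> \<in> U \<longrightarrow> (\<exists>n. f ` (D \<inter> cylinder \<alpha> n) \<subseteq> U))"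

text \<open>Continuous images of closed subsets of Baire space rather than of the whole space, so that
  the empty set needs no exception.\<close>

definition analytic_in :: "'b topology \<Rightarrow> 'b set \<Rightarrow> bool" where
  "analytic_in T E \<longleftrightarrow> E \<subseteq> topspace T \<and> (\<exists>D f. baire_closed D \<and> baire_continuous T D f \<and> f ` D = E)"

text \<open>One sequence codes a sequence of sequences, which identifies Baire space with its
  countable power.\<close>

definition baire_slice :: "nat \<Rightarrow> (nat \<Rightarrow> nat) \<Rightarrow> nat \<Rightarrow> nat" where
  "baire_slice i \<beta> = (\<lambda>n. \<beta> (prod_encode (i, n)))"

lemma analytic_inI:
  "E \<subseteq> topspace T \<Longrightarrow> baire_closed D \<Longrightarrow> baire_continuous T D f \<Longrightarrow> f ` D = E \<Longrightarrow> analytic_in T E"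
  unfolding analytic_in_def by blast

lemma baire_slice_cylinder: "\<exists>m. baire_slice i ` cylinder \<beta> m \<subseteq> cylinder (baire_slice i \<beta>) n"
proof -
  \<comment> \<open>The first \<open>n\<close> entries of the slice sit at the positions
    \<open>prod_encode (i, j)\<close> with \<open>j < n\<close>; their sum is a crude common
    bound.\<close>
  have "baire_slice i ` cylinder \<beta> (Suc (\<Sum>j<n. prod_encode (i, j))) \<subseteq> cylinder (baire_slice i \<beta>) n"
  proof -
    have "prod_encode (i, j) < Suc (\<Sum>j<n. prod_encode (i, j))" if "j < n" for j
      using member_le_sum[of j "{..<n}" "\<lambda>j. prod_encode (i, j)"] that by simp
    then show ?thesis by (auto simp: cylinder_def baire_slice_def)
  qed
  then show ?thesis by blast
qed

lemma ex_baire_slice: "\<exists>\<beta>. \<forall>i. baire_slice i \<beta> = \<alpha> i"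
proof (intro exI allI)
  show "baire_slice i (\<lambda>k. \<alpha> (fst (prod_decode k)) (snd (prod_decode k))) = \<alpha> i" for i
    by (simp add: baire_slice_def)
qed

lemma baire_closed_baire_slice:
  assumes "baire_closed D" and "\<And>n. \<exists>\<beta>\<in>cylinder \<alpha> n. baire_slice i \<beta> \<in> D"
  shows "baire_slice i \<alpha> \<in> D"
proof -
  have "D \<inter> cylinder (baire_slice i \<alpha>) n \<noteq> {}" for n
    using baire_slice_cylinder[of i \<alpha> n] assms(2) by blast
  then show ?thesis using assms(1) unfolding baire_closed_def by blast
qed

lemma baire_continuous_baire_slice:
  assumes f: "baire_continuous T D f" and \<alpha>: "baire_slice i \<alpha> \<in> D" and U: "openin T U" "f (baire_slice i \<alpha>) \<in> U"
  shows "\<exists>n. \<forall>\<beta>\<in>cylinder \<alpha> n. baire_slice i \<beta> \<in> D \<longrightarrow> f (baire_slice i \<beta>) \<in> U"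
proof -
  obtain n where "f ` (D \<inter> cylinder (baire_slice i \<alpha>) n) \<subseteq> U"
    using f \<alpha> U unfolding baire_continuous_def by blast
  moreover obtain m where "baire_slice i ` cylinder \<alpha> m \<subseteq> cylinder (baire_slice i \<alpha>) n"
    using baire_slice_cylinder by blast
  ultimately show ?thesis by blast
qed

section \<open>Closure properties of analytic sets\<close>

lemma analytic_in_continuous_image:
  assumes "analytic_in T E" and g: "continuous_map T T' g"
  shows "analytic_in T' (g ` E)"
proof -
  obtain D f where Df: "baire_closed D" "baire_continuous T D f" "f ` D = E" "E \<subseteq> topspace T"
    using assms(1) unfolding analytic_in_def by blast
  have "baire_continuous T' D (g \<circ> f)"
    unfolding baire_continuous_def
  proof (intro ballI allI impI)
    fix \<alpha> U assume \<alpha>: "\<alpha> \<in> D" and U: "openin T' U \<and> (g \<circ> f) \<alpha> \<in> U"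
    have "openin T {x \<in> topspace T. g x \<in> U}" using g U by (simp add: continuous_map_def)
    moreover have "f \<alpha> \<in> {x \<in> topspace T. g x \<in> U}" using \<alpha> U Df(3,4) by auto
    ultimately show "\<exists>n. (g \<circ> f) ` (D \<inter> cylinder \<alpha> n) \<subseteq> U"
      using Df(2) \<alpha> unfolding baire_continuous_def by fastforce
  qed
  moreover have "g ` E \<subseteq> topspace T'" using g Df(4) continuous_map_image_subset_topspace by fastforce
  moreover have "(g \<circ> f) ` D = g ` E" by (metis Df(3) image_comp)
  ultimately show ?thesis using Df(1) by (intro analytic_inI)
qed

text \<open>The leading entry of a sequence selects a set, and the tail is the parameter of a point
  in it. The leading entry is constant on cylinders of positive length, so closedness and continuity
  are inherited.\<close>

lemma analytic_in_UN:
  assumes "\<And>i::nat. analytic_in T (E i)"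
  shows "analytic_in T (\<Union>i. E i)"
proof -
  obtain D f where Df: "\<And>i. baire_closed (D i)" "\<And>i. baire_continuous T (D i) (f i)" "\<And>i. f i ` D i = E i"
    and sub: "\<And>i. E i \<subseteq> topspace T"
    using assms unfolding analytic_in_def by metis
  define tl where "tl \<beta> = (\<lambda>n. \<beta> (Suc n))" for \<beta> :: "nat \<Rightarrow> nat"
  have tl: "tl \<beta> \<in> cylinder (tl \<alpha>) n" "\<beta> 0 = \<alpha> 0" if "\<beta> \<in> cylinder \<alpha> (Suc n)" for \<alpha> \<beta> n
    using that unfolding cylinder_def tl_def by auto
  define D' where "D' = {\<beta>. tl \<beta> \<in> D (\<beta> 0)}"
  define f' where "f' \<beta> = f (\<beta> 0) (tl \<beta>)" for \<beta>
  have "baire_closed D'"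
    unfolding baire_closed_def
  proof (intro allI impI)
    fix \<alpha> assume a: "\<forall>n. D' \<inter> cylinder \<alpha> n \<noteq> {}"
    have "D (\<alpha> 0) \<inter> cylinder (tl \<alpha>) n \<noteq> {}" for n
    proof -
      obtain \<beta> where "\<beta> \<in> D'" "\<beta> \<in> cylinder \<alpha> (Suc n)" using a by blast
      then show ?thesis using tl[of \<beta> \<alpha> n] unfolding D'_def by auto
    qed
    then show "\<alpha> \<in> D'" using Df(1) unfolding baire_closed_def D'_def by blast
  qed
  moreover have "baire_continuous T D' f'"
    unfolding baire_continuous_def
  proof (intro ballI allI impI)
    fix \<alpha> U assume a: "\<alpha> \<in> D'" "openin T U \<and> f' \<alpha> \<in> U"
    then obtain n where n: "f (\<alpha> 0) ` (D (\<alpha> 0) \<inter> cylinder (tl \<alpha>) n) \<subseteq> U"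
      using Df(2)[of "\<alpha> 0"] unfolding baire_continuous_def D'_def f'_def by blast
    have "f' ` (D' \<inter> cylinder \<alpha> (Suc n)) \<subseteq> U"
    proof clarify
      fix \<beta> assume b: "\<beta> \<in> D'" "\<beta> \<in> cylinder \<alpha> (Suc n)"
      then show "f' \<beta> \<in> U" using tl[OF b(2)] n unfolding D'_def f'_def by auto
    qed
    then show "\<exists>n. f' ` (D' \<inter> cylinder \<alpha> n) \<subseteq> U" by blast
  qed
  moreover have "(\<Union>i. E i) \<subseteq> topspace T" using sub by blast
  moreover have "f' ` D' = (\<Union>i. E i)"
  proof
    show "f' ` D' \<subseteq> (\<Union>i. E i)" unfolding D'_def f'_def using Df(3) by blast
    show "(\<Union>i. E i) \<subseteq> f' ` D'"
    proof clarify
      fix x i assume "x \<in> E i"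
      then have "x \<in> f i ` D i" using Df(3) by simp
      then obtain \<alpha> where \<alpha>: "\<alpha> \<in> D i" "f i \<alpha> = x" by blast
      have "tl (case_nat i \<alpha>) = \<alpha>" unfolding tl_def by simp
      then have "case_nat i \<alpha> \<in> D'" "f' (case_nat i \<alpha>) = x" using \<alpha> unfolding D'_def f'_def by auto
      then show "x \<in> f' ` D'" by blast
    qed
  qed
  ultimately show ?thesis by (intro analytic_inI)
qed

text \<open>A point of the intersection is given by one parameter for each set, all with the same
  image. In a Hausdorff space such families of parameters form a closed set: two different images
  have disjoint neighbourhoods, and by continuity these persist on a cylinder.\<close>

lemma analytic_in_INT:
  assumes T: "Hausdorff_space T" and "\<And>i::nat. analytic_in T (E i)"
  shows "analytic_in T (\<Inter>i. E i)"
proof -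
  obtain D f where Df: "\<And>i. baire_closed (D i)" "\<And>i. baire_continuous T (D i) (f i)" "\<And>i. f i ` D i = E i"
    and sub: "\<And>i. E i \<subseteq> topspace T"
    using assms unfolding analytic_in_def by metis
  define D' where "D' = {\<beta>. \<forall>i. baire_slice i \<beta> \<in> D i \<and> f i (baire_slice i \<beta>) = f 0 (baire_slice 0 \<beta>)}"
  define f' where "f' \<beta> = f 0 (baire_slice 0 \<beta>)" for \<beta>
  have "baire_closed D'"
    unfolding baire_closed_def
  proof (intro allI impI)
    fix \<alpha> assume a: "\<forall>n. D' \<inter> cylinder \<alpha> n \<noteq> {}"
    have sD: "baire_slice i \<alpha> \<in> D i" for i
      by (rule baire_closed_baire_slice[OF Df(1)]) (insert a, unfold D'_def, blast)
    have "f i (baire_slice i \<alpha>) = f 0 (baire_slice 0 \<alpha>)" for i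
    proof (rule ccontr)
      assume "f i (baire_slice i \<alpha>) \<noteq> f 0 (baire_slice 0 \<alpha>)"
      moreover have "f i (baire_slice i \<alpha>) \<in> topspace T" "f 0 (baire_slice 0 \<alpha>) \<in> topspace T" using sD Df(3) sub by blast+
      ultimately obtain U V where UV: "openin T U" "openin T V" "f i (baire_slice i \<alpha>) \<in> U" "f 0 (baire_slice 0 \<alpha>) \<in> V" "disjnt U V"
        using T unfolding Hausdorff_space_def by metis
      obtain n where n: "\<forall>\<beta>\<in>cylinder \<alpha> n. baire_slice i \<beta> \<in> D i \<longrightarrow> f i (baire_slice i \<beta>) \<in> U"
        using baire_continuous_baire_slice[OF Df(2) sD UV(1,3)] by blast
      obtain m where m: "\<forall>\<beta>\<in>cylinder \<alpha> m. baire_slice 0 \<beta> \<in> D 0 \<longrightarrow> f 0 (baire_slice 0 \<beta>) \<in> V"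
        using baire_continuous_baire_slice[OF Df(2) sD UV(2,4)] by blast
      obtain \<beta> where \<beta>: "\<beta> \<in> D'" "\<beta> \<in> cylinder \<alpha> (max m n)" using a by blast
      then have "\<beta> \<in> cylinder \<alpha> m" "\<beta> \<in> cylinder \<alpha> n" unfolding cylinder_def by auto
      then have "f i (baire_slice i \<beta>) \<in> U" "f 0 (baire_slice 0 \<beta>) \<in> V" using n m \<beta>(1) unfolding D'_def by auto
      moreover have "f i (baire_slice i \<beta>) = f 0 (baire_slice 0 \<beta>)" using \<beta>(1) unfolding D'_def by auto
      ultimately show False using UV(5) unfolding disjnt_iff by metis
    qed
    then show "\<alpha> \<in> D'" using sD unfolding D'_def by blast
  qed
  moreover have "baire_continuous T D' f'"
    unfolding baire_continuous_def
  proof (intro ballI allI impI)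
    fix \<alpha> U assume a: "\<alpha> \<in> D'" "openin T U \<and> f' \<alpha> \<in> U"
    then have "baire_slice 0 \<alpha> \<in> D 0" unfolding D'_def by blast
    moreover have "openin T U" "f 0 (baire_slice 0 \<alpha>) \<in> U" using a(2) unfolding f'_def by auto
    ultimately obtain n where "\<forall>\<beta>\<in>cylinder \<alpha> n. baire_slice 0 \<beta> \<in> D 0 \<longrightarrow> f 0 (baire_slice 0 \<beta>) \<in> U"
      using baire_continuous_baire_slice[OF Df(2)[of 0]] by metis
    then show "\<exists>n. f' ` (D' \<inter> cylinder \<alpha> n) \<subseteq> U" unfolding D'_def f'_def by blast
  qed
  moreover have "(\<Inter>i. E i) \<subseteq> topspace T" using sub by blast
  moreover have "f' ` D' = (\<Inter>i. E i)"
  proof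
    show "f' ` D' \<subseteq> (\<Inter>i. E i)"
    proof clarify
      fix \<beta> i assume "\<beta> \<in> D'"
      then have "f i (baire_slice i \<beta>) = f' \<beta> \<and> baire_slice i \<beta> \<in> D i" unfolding D'_def f'_def by blast
      then show "f' \<beta> \<in> E i" using Df(3)[of i] by (metis image_eqI)
    qed
    show "(\<Inter>i. E i) \<subseteq> f' ` D'"
    proof
      fix x assume "x \<in> (\<Inter>i. E i)"
      then have "\<forall>i. x \<in> f i ` D i" using Df(3) by simp
      then have "\<forall>i. \<exists>\<alpha>\<in>D i. f i \<alpha> = x" by (metis imageE)
      then obtain \<alpha> where \<alpha>: "\<And>i. \<alpha> i \<in> D i" "\<And>i. f i (\<alpha> i) = x" by metis
      obtain \<beta> where \<beta>: "\<And>i. baire_slice i \<beta> = \<alpha> i" using ex_baire_slice[of \<alpha>] by blast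
      then have "\<beta> \<in> D'" "f' \<beta> = x" using \<alpha> unfolding D'_def f'_def by auto
      then show "x \<in> f' ` D'" by blast
    qed
  qed
  ultimately show ?thesis by (intro analytic_inI)
qed

lemma analytic_in_Times:
  assumes "analytic_in T1 A" and "analytic_in T2 B"
  shows "analytic_in (prod_topology T1 T2) (A \<times> B)"
proof -
  obtain D1 f1 where 1: "baire_closed D1" "baire_continuous T1 D1 f1" "f1 ` D1 = A" "A \<subseteq> topspace T1"
    using assms unfolding analytic_in_def by metis
  obtain D2 f2 where 2: "baire_closed D2" "baire_continuous T2 D2 f2" "f2 ` D2 = B" "B \<subseteq> topspace T2"
    using assms unfolding analytic_in_def by metis
  define D' where "D' = {\<beta>. baire_slice 0 \<beta> \<in> D1 \<and> baire_slice 1 \<beta> \<in> D2}"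
  define f' where "f' \<beta> = (f1 (baire_slice 0 \<beta>), f2 (baire_slice 1 \<beta>))" for \<beta>
  have "baire_closed D'"
    unfolding baire_closed_def
  proof (intro allI impI)
    fix \<alpha> assume a: "\<forall>n. D' \<inter> cylinder \<alpha> n \<noteq> {}"
    have "baire_slice 0 \<alpha> \<in> D1"
      by (rule baire_closed_baire_slice[OF 1(1)]) (insert a, unfold D'_def, blast)
    moreover have "baire_slice 1 \<alpha> \<in> D2"
      by (rule baire_closed_baire_slice[OF 2(1)]) (insert a, unfold D'_def, blast)
    ultimately show "\<alpha> \<in> D'" unfolding D'_def by blast
  qed
  moreover have "baire_continuous (prod_topology T1 T2) D' f'"
    unfolding baire_continuous_def
  proof (intro ballI allI impI)
    fix \<alpha> W assume a: "\<alpha> \<in> D'" "openin (prod_topology T1 T2) W \<and> f' \<alpha> \<in> W"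
    then obtain U V where UV: "openin T1 U" "openin T2 V" "f1 (baire_slice 0 \<alpha>) \<in> U" "f2 (baire_slice 1 \<alpha>) \<in> V" "U \<times> V \<subseteq> W"
      unfolding f'_def openin_prod_topology_alt by blast
    obtain n where n: "\<forall>\<beta>\<in>cylinder \<alpha> n. baire_slice 0 \<beta> \<in> D1 \<longrightarrow> f1 (baire_slice 0 \<beta>) \<in> U"
      using baire_continuous_baire_slice[OF 1(2) _ UV(1,3)] a(1) unfolding D'_def by blast
    obtain m where m: "\<forall>\<beta>\<in>cylinder \<alpha> m. baire_slice 1 \<beta> \<in> D2 \<longrightarrow> f2 (baire_slice 1 \<beta>) \<in> V"
      using baire_continuous_baire_slice[OF 2(2) _ UV(2,4)] a(1) unfolding D'_def by blast
    have "f' ` (D' \<inter> cylinder \<alpha> (max m n)) \<subseteq> W"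
    proof (rule image_subsetI)
      fix \<beta> assume \<beta>: "\<beta> \<in> D' \<inter> cylinder \<alpha> (max m n)"
      then have "\<beta> \<in> cylinder \<alpha> m" "\<beta> \<in> cylinder \<alpha> n" unfolding cylinder_def by auto
      then show "f' \<beta> \<in> W" using n m \<beta> UV(5) unfolding D'_def f'_def by blast
    qed
    then show "\<exists>n. f' ` (D' \<inter> cylinder \<alpha> n) \<subseteq> W" by blast
  qed
  moreover have "f' ` D' = A \<times> B"
  proof
    show "f' ` D' \<subseteq> A \<times> B" unfolding D'_def f'_def using 1(3) 2(3) by blast
    show "A \<times> B \<subseteq> f' ` D'"
    proof
      fix z assume "z \<in> A \<times> B"
      then obtain x y where z: "z = (x, y)" "x \<in> A" "y \<in> B" by blast
      then obtain \<alpha>1 \<alpha>2 where \<alpha>: "\<alpha>1 \<in> D1" "f1 \<alpha>1 = x" "\<alpha>2 \<in> D2" "f2 \<alpha>2 = y" using 1(3) 2(3) by blast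
      obtain \<beta> where \<beta>: "\<And>i. baire_slice i \<beta> = (if i = 0 then \<alpha>1 else \<alpha>2)"
        using ex_baire_slice[of "\<lambda>i. if i = 0 then \<alpha>1 else \<alpha>2"] by blast
      have "\<beta> \<in> D'" "f' \<beta> = (x, y)" using \<alpha> unfolding D'_def f'_def by (auto simp: \<beta>)
      then show "z \<in> f' ` D'" unfolding z(1) by (metis image_eqI)
    qed
  qed
  moreover have "A \<times> B \<subseteq> topspace (prod_topology T1 T2)" using 1(4) 2(4) by auto
  ultimately show ?thesis by (intro analytic_inI)
qed

section \<open>Borel sets of Polish spaces are analytic\<close>

text \<open>A Souslin scheme: the entry \<open>\<alpha> i\<close> names a member of a dense sequence
  within distance \<open>1 / (i + 1)\<close> of the point to be described. If all finite
  intersections of these balls with \<open>C\<close> are nonempty, completeness provides exactly one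
  point in all of them.\<close>

lemma analytic_in_closed:
  assumes T: "completely_metrizable_space T" "separable_space T" and C: "closedin T C"
  shows "analytic_in T C"
proof (cases "C = {}")
  case True
  have "baire_closed {} \<and> baire_continuous T {} f \<and> f ` {} = C" for f
    using True by (auto simp: baire_closed_def baire_continuous_def)
  then show ?thesis unfolding analytic_in_def using True by blast
next
  case False
  obtain M d where Md: "Metric_space M d" "Metric_space.mcomplete M d" "T = Metric_space.mtopology M d"
    using T(1) unfolding completely_metrizable_space_def by blast
  interpret Metric_space M d by (rule Md(1))
  obtain Q where Q: "countable Q" "Q \<subseteq> M" "mtopology closure_of Q = M"
    using T(2) unfolding separable_space_def Md(3) by auto
  have CM: "C \<subseteq> M" using closedin_subset[OF C] Md(3) by simp
  have "Q \<noteq> {}" using Q(3) CM False by auto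
  define e where "e = from_nat_into Q"
  have eM: "e k \<in> M" for k unfolding e_def using from_nat_into[OF \<open>Q \<noteq> {}\<close>] Q(2) by blast
  have dense: "\<exists>k. d (e k) x \<le> r" if "x \<in> M" "0 < r" for x r
  proof -
    have "x \<in> mtopology closure_of Q" using Q(3) that by simp
    then have "\<exists>y\<in>Q. y \<in> mball x r" using \<open>0 < r\<close> unfolding metric_closure_of mem_Collect_eq by auto
    then obtain y where y: "y \<in> Q" "y \<in> mball x r" by blast
    obtain k where "e k = y" unfolding e_def using from_nat_into_surj[OF Q(1) y(1)] by blast
    then show ?thesis using y(2) commute[of x y] by (intro exI[of _ k]) simp
  qed
  define F where "F \<alpha> n = C \<inter> (\<Inter>i\<le>n. mcball (e (\<alpha> i)) (inverse (real (Suc i))))" for \<alpha> :: "nat \<Rightarrow> nat" and n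
  \<comment> \<open>Nonemptiness is demanded of the finite intersections only. Each of them depends
    on finitely many entries, which makes \<open>D\<close> closed.\<close>
  define D where "D = {\<alpha>. \<forall>n. F \<alpha> n \<noteq> {}}"
  have Fsub: "F \<alpha> n \<subseteq> mcball (e (\<alpha> n)) (inverse (real (Suc n)))" for \<alpha> n unfolding F_def by auto
  have small: "d y z \<le> 2 * inverse (real (Suc n))" if "y \<in> F \<alpha> n" "z \<in> F \<alpha> n" for y z \<alpha> n
  proof -
    have "d (e (\<alpha> n)) y \<le> inverse (real (Suc n))" "d (e (\<alpha> n)) z \<le> inverse (real (Suc n))" "y \<in> M" "z \<in> M"
      using Fsub that by (auto simp: subset_eq)
    then show ?thesis using triangle[of y "e (\<alpha> n)" z] eM commute[of y "e (\<alpha> n)"] by auto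
  qed
  \<comment> \<open>\<open>F \<alpha> n\<close> involves the entries up to and including
    \<open>n\<close>, hence the cylinder of length \<open>Suc n\<close>.\<close>
  have Fc: "F \<beta> n = F \<alpha> n" if "\<beta> \<in> cylinder \<alpha> (Suc n)" for \<alpha> \<beta> n
    using that unfolding cylinder_def F_def by auto
  have Fclosed: "closedin mtopology (F \<alpha> n)" for \<alpha> n
    unfolding F_def using C Md(3) by (intro closedin_Int closedin_INT) auto
  have inc: "\<exists>n. inverse (real (Suc n)) < r" if "0 < r" for r using reals_Archimedean that by blast
  have "\<exists>l. l \<in> M \<and> \<Inter>(range (F \<alpha>)) = {l}" if "\<alpha> \<in> D" for \<alpha>
  proof (rule Md(2)[unfolded mcomplete_nest_sing, rule_format], intro conjI allI impI)
    show "closedin mtopology (F \<alpha> n)" for n by (rule Fclosed)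
    show "F \<alpha> n \<noteq> {}" for n using that unfolding D_def by blast
    show "decseq (F \<alpha>)" unfolding decseq_def F_def by (auto simp: atMost_def)
    fix r :: real assume "0 < r"
    then obtain n where "inverse (real (Suc n)) < r" using inc by blast
    then have "mcball (e (\<alpha> n)) (inverse (real (Suc n))) \<subseteq> mcball (e (\<alpha> n)) r" by auto
    then show "\<exists>n a. F \<alpha> n \<subseteq> mcball a r" using Fsub by blast
  qed
  then have "\<forall>\<alpha>\<in>D. \<exists>l. l \<in> M \<and> \<Inter>(range (F \<alpha>)) = {l}" by blast
  from bchoice[OF this] obtain f where f: "\<And>\<alpha>. \<alpha> \<in> D \<Longrightarrow> f \<alpha> \<in> M \<and> \<Inter>(range (F \<alpha>)) = {f \<alpha>}"
    by blast
  have fF: "f \<alpha> \<in> F \<alpha> n" if "\<alpha> \<in> D" for \<alpha> n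
  proof -
    have "f \<alpha> \<in> \<Inter>(range (F \<alpha>))" using f[OF that] by simp
    then show ?thesis by blast
  qed
  have "baire_closed D"
    unfolding baire_closed_def
  proof (intro allI impI)
    fix \<alpha> assume a: "\<forall>n. D \<inter> cylinder \<alpha> n \<noteq> {}"
    have "F \<alpha> n \<noteq> {}" for n
    proof -
      obtain \<beta> where "\<beta> \<in> D" "\<beta> \<in> cylinder \<alpha> (Suc n)" using a by blast
      then show ?thesis using Fc unfolding D_def by blast
    qed
    then show "\<alpha> \<in> D" unfolding D_def by blast
  qed
  moreover have "baire_continuous T D f"
    unfolding baire_continuous_def
  proof (intro ballI allI impI)
    fix \<alpha> U assume a: "\<alpha> \<in> D" "openin T U \<and> f \<alpha> \<in> U"
    then obtain r where r: "0 < r" "mball (f \<alpha>) r \<subseteq> U" unfolding Md(3) openin_mtopology by blast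
    obtain n where n: "inverse (real (Suc n)) < r / 2" using inc[of "r/2"] r by auto
    have "f ` (D \<inter> cylinder \<alpha> (Suc n)) \<subseteq> U"
    proof clarify
      fix \<beta> assume \<beta>: "\<beta> \<in> D" "\<beta> \<in> cylinder \<alpha> (Suc n)"
      have "f \<beta> \<in> F \<alpha> n" using fF[OF \<beta>(1), of n] Fc[OF \<beta>(2)] by simp
      from small[OF fF[OF a(1)] this] n have "d (f \<alpha>) (f \<beta>) < r" by linarith
      then have "f \<beta> \<in> mball (f \<alpha>) r" using f a(1) \<beta>(1) by simp
      then show "f \<beta> \<in> U" using r(2) by blast
    qed
    then show "\<exists>n. f ` (D \<inter> cylinder \<alpha> n) \<subseteq> U" by blast
  qed
  moreover have "f ` D = C"
  proof
    show "f ` D \<subseteq> C" using fF unfolding F_def by blast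
    show "C \<subseteq> f ` D"
    proof
      fix x assume x: "x \<in> C"
      then have xM: "x \<in> M" using CM by blast
      have "\<forall>i. \<exists>k. d (e k) x \<le> inverse (real (Suc i))" using dense[OF xM] by simp
      then obtain \<alpha> where \<alpha>: "\<And>i. d (e (\<alpha> i)) x \<le> inverse (real (Suc i))" by metis
      then have xF: "x \<in> F \<alpha> n" for n unfolding F_def using x xM eM by simp
      then have \<alpha>D: "\<alpha> \<in> D" unfolding D_def by blast
      moreover have "x = f \<alpha>" using f[OF \<alpha>D] xF by blast
      ultimately show "x \<in> f ` D" by blast
    qed
  qed
  moreover have "C \<subseteq> topspace T" using CM Md(3) by simp
  ultimately show ?thesis by (intro analytic_inI)
qed

lemma analytic_in_open:
  assumes T: "completely_metrizable_space T" "separable_space T" and U: "openin T U"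
  shows "analytic_in T U"
proof -
  have "fsigma_in T U"
    using open_imp_fsigma_in[OF completely_metrizable_imp_metrizable_space[OF T(1)] U] .
  then obtain C :: "nat \<Rightarrow> _" where C: "\<And>n. closedin T (C n)" "(\<Union>n. C n) = U"
    unfolding fsigma_in_ascending by auto
  show ?thesis using analytic_in_UN[of T C] analytic_in_closed[OF T C(1)] C(2) by simp
qed

text \<open>Complements of analytic sets need not be analytic, so the induction carries a set
  together with its complement. The generator is left general because it is once the open sets and
  once the measurable rectangles.\<close>

lemma analytic_in_sigma_sets:
  assumes T: "Hausdorff_space T"
    and top: "analytic_in T (topspace T)"
    and G: "\<And>A. A \<in> G \<Longrightarrow> analytic_in T A \<and> analytic_in T (topspace T - A)"
    and A: "A \<in> sigma_sets (topspace T) G"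
  shows "analytic_in T A \<and> analytic_in T (topspace T - A)"
  using A
proof (induction rule: sigma_sets.induct)
  case Empty
  have "analytic_in T {}"
    unfolding analytic_in_def baire_closed_def baire_continuous_def by blast
  then show ?case using top by simp
next
  case (Compl a)
  then have "topspace T - (topspace T - a) = a" unfolding analytic_in_def by blast
  then show ?case using Compl by simp
next
  case (Union a)
  have "analytic_in T (\<Inter>i. topspace T - a i)" using Union by (intro analytic_in_INT[OF T]) auto
  then show ?case using Union by (auto intro: analytic_in_UN)
qed (use G in auto)

lemma analytic_in_borel:
  assumes T: "completely_metrizable_space T" "separable_space T"
    and A: "A \<in> sigma_sets (topspace T) {U. openin T U}"
  shows "analytic_in T A \<and> analytic_in T (topspace T - A)"
proof (rule analytic_in_sigma_sets[OF _ _ _ A])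
  show "Hausdorff_space T"
    by (intro metrizable_imp_Hausdorff_space completely_metrizable_imp_metrizable_space T(1))
  show "analytic_in T (topspace T)"
    by (rule analytic_in_open[OF T openin_topspace])
  fix U assume "U \<in> {U. openin T U}"
  then have U: "openin T U" by simp
  then have "closedin T (topspace T - U)" by (rule closedin_diff[OF closedin_topspace])
  then show "analytic_in T U \<and> analytic_in T (topspace T - U)"
    using analytic_in_open[OF T U] analytic_in_closed[OF T] by simp
qed

text \<open>If the sets cannot be separated, then one value after the other of parameters \<open>\<alpha>\<^sub>n\<close> can be fixed
  such that the pieces of the \<open>A n\<close> which remain are still not separated. The limit points
  \<open>f n \<alpha>\<^sub>n\<close> do not all coincide, and disjoint neighbourhoods of two of them separate.\<close>

lemma Novikov_separation:
  assumes T: "Hausdorff_space T" and X: "topspace T = space X" "\<And>U. openin T U \<Longrightarrow> U \<in> sets X"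
    and A: "\<And>n::nat. analytic_in T (A n)" and empty: "(\<Inter>n. A n) = {}"
  shows "\<exists>Z. (\<forall>n. Z n \<in> sets X \<and> A n \<subseteq> Z n) \<and> (\<Inter>n. Z n) = {}"
proof (rule ccontr)
  define sep where "sep H \<longleftrightarrow> (\<exists>Z. (\<forall>n. Z n \<in> sets X \<and> H n \<subseteq> Z n) \<and> (\<Inter>n. Z n) = {})"
    for H :: "nat \<Rightarrow> 'a set"
  have sep_UN: "sep G" if H: "\<And>v::nat. sep (H v)" and i: "G i = (\<Union>v. H v i)" and n: "\<And>n v. n \<noteq> i \<Longrightarrow> G n = H v n"
    for G H i
  proof -
    obtain Z where Z: "\<And>v n. Z v n \<in> sets X" "\<And>v n. H v n \<subseteq> Z v n" "\<And>v. (\<Inter>n. Z v n) = {}"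
      using H unfolding sep_def by metis
    \<comment> \<open>At the index \<open>i\<close>, where pieces are united, the separating sets
      are united too. At every other index the member is the same for all \<open>v\<close>, so it
      lies in the intersection of the sets separating it.\<close>
    define Y where "Y n = (if n = i then (\<Union>v. Z v i) else (\<Inter>v. Z v n))" for n
    have "Y n \<in> sets X" for n unfolding Y_def using Z(1) by auto
    moreover have "G n \<subseteq> Y n" for n unfolding Y_def using Z(2) i n[of n] by (auto; blast)
    moreover have "(\<Inter>n. Y n) = {}"
    proof (rule ccontr)
      assume "(\<Inter>n. Y n) \<noteq> {}"
      then obtain x where x: "\<And>n. x \<in> Y n" by blast
      obtain v where v: "x \<in> Z v i" using x[of i] unfolding Y_def by auto
      have "x \<in> Z v n" for n using x[of n] v unfolding Y_def by (auto split: if_splits)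
      then show False using Z(3)[of v] by blast
    qed
    ultimately show ?thesis unfolding sep_def by blast
  qed
  assume "\<not> ?thesis"
  then have nsep: "\<not> sep A" unfolding sep_def by blast
  obtain D f where Df: "\<And>i. baire_closed (D i)" "\<And>i. baire_continuous T (D i) (f i)" "\<And>i. f i ` D i = A i"
    and sub: "\<And>i. A i \<subseteq> topspace T"
    using A unfolding analytic_in_def by metis
  \<comment> \<open>One sequence \<open>\<gamma>\<close> holds the parameters of all sets,
    interleaved by the pairing function, and stage \<open>m\<close> fixes the values below
    \<open>m\<close>. Each further value constrains just one set, the one to which its position
    belongs.\<close>
  define H where "H \<gamma> m n = f n ` {\<alpha> \<in> D n. \<forall>j. prod_encode (n, j) < m \<longrightarrow> \<alpha> j = \<gamma> (prod_encode (n, j))}" for \<gamma> m n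
  have Hsub: "H \<gamma> m n \<subseteq> topspace T" for \<gamma> m n using Df(3) sub unfolding H_def by blast
  have Hcong: "H \<gamma> m = H \<gamma>' m" if "\<And>k. k < m \<Longrightarrow> \<gamma> k = \<gamma>' k" for \<gamma> \<gamma>' m
    unfolding H_def using that by (intro ext) auto
  have step: "\<exists>v. \<not> sep (H (\<gamma>(m := v)) (Suc m))" if ns: "\<not> sep (H \<gamma> m)" for \<gamma> m
  proof (rule ccontr)
    assume "\<nexists>v. \<not> sep (H (\<gamma>(m := v)) (Suc m))"
    then have s: "sep (H (\<gamma>(m := v)) (Suc m))" for v by blast
    obtain i j where ij: "m = prod_encode (i, j)" by (metis prod_decode_inverse surj_pair)
    have "sep (H \<gamma> m)"
    proof (rule sep_UN[OF s, of _ i])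
      show "H \<gamma> m i = (\<Union>v. H (\<gamma>(m := v)) (Suc m) i)"
      proof
        show "H \<gamma> m i \<subseteq> (\<Union>v. H (\<gamma>(m := v)) (Suc m) i)"
        proof
          fix x assume "x \<in> H \<gamma> m i"
          then obtain \<alpha> where \<alpha>: "x = f i \<alpha>" "\<alpha> \<in> D i" "\<forall>j. prod_encode (i, j) < m \<longrightarrow> \<alpha> j = \<gamma> (prod_encode (i, j))"
            unfolding H_def by blast
          have "\<forall>j'. prod_encode (i, j') < Suc m \<longrightarrow> \<alpha> j' = (\<gamma>(m := \<alpha> j)) (prod_encode (i, j'))"
            using \<alpha>(3) ij by (auto simp: less_Suc_eq prod_encode_eq)
          then show "x \<in> (\<Union>v. H (\<gamma>(m := v)) (Suc m) i)" using \<alpha>(1,2) unfolding H_def by blast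
        qed
        have "H (\<gamma>(m := v)) (Suc m) i \<subseteq> H \<gamma> m i" for v
        proof
          fix x assume "x \<in> H (\<gamma>(m := v)) (Suc m) i"
          then obtain \<alpha> where \<alpha>: "x = f i \<alpha>" "\<alpha> \<in> D i" "\<forall>j. prod_encode (i, j) < Suc m \<longrightarrow> \<alpha> j = (\<gamma>(m := v)) (prod_encode (i, j))"
            unfolding H_def by blast
          have "\<forall>j. prod_encode (i, j) < m \<longrightarrow> \<alpha> j = \<gamma> (prod_encode (i, j))"
            using \<alpha>(3) by auto
          then show "x \<in> H \<gamma> m i" using \<alpha>(1,2) unfolding H_def by blast
        qed
        then show "(\<Union>v. H (\<gamma>(m := v)) (Suc m) i) \<subseteq> H \<gamma> m i" by blast
      qed
      show "H \<gamma> m n = H (\<gamma>(m := v)) (Suc m) n" if "n \<noteq> i" for n v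
      proof -
        have "(prod_encode (n, j') < Suc m \<longrightarrow> \<alpha> j' = (\<gamma>(m := v)) (prod_encode (n, j'))) \<longleftrightarrow>
            (prod_encode (n, j') < m \<longrightarrow> \<alpha> j' = \<gamma> (prod_encode (n, j')))" for j' \<alpha>
          using that by (auto simp: ij less_Suc_eq prod_encode_eq)
        then show ?thesis unfolding H_def by simp
      qed
    qed
    with ns show False by blast
  qed
  \<comment> \<open>Stage \<open>m\<close> alters position \<open>m\<close> only, so the choices
    converge to a sequence with which stage \<open>m\<close> agrees below \<open>m\<close>.\<close>
  have "\<exists>g. \<forall>m. \<not> sep (H (g m) m) \<and> (\<exists>v. g (Suc m) = (g m)(m := v))"
  proof (rule dependent_nat_choice)
    show "\<exists>\<gamma>. \<not> sep (H \<gamma> 0)"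
    proof -
      have "H \<gamma> 0 = A" for \<gamma> unfolding H_def using Df(3) by auto
      then show ?thesis using nsep by simp
    qed
    show "\<exists>\<gamma>'. \<not> sep (H \<gamma>' (Suc m)) \<and> (\<exists>v. \<gamma>' = \<gamma>(m := v))" if "\<not> sep (H \<gamma> m)" for \<gamma> m
      using step[OF that] by blast
  qed
  then obtain g where g: "\<And>m. \<not> sep (H (g m) m)" "\<And>m. \<exists>v. g (Suc m) = (g m)(m := v)" by blast
  define \<gamma> where "\<gamma> m = g (Suc m) m" for m
  have g\<gamma>: "g m k = \<gamma> k" if "k < m" for m k
    using that
  proof (induction m)
    case (Suc m)
    show ?case
    proof (cases "k = m")
      case False
      then show ?thesis using Suc g(2)[of m] by auto
    qed (simp add: \<gamma>_def)
  qed simp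
  have ns: "\<not> sep (H \<gamma> m)" for m using g(1)[of m] Hcong[of m "g m" \<gamma>] g\<gamma> by simp
  \<comment> \<open>An empty piece would separate the family at once, covered by the empty set while
    the whole space covers the others.\<close>
  have ne: "H \<gamma> m n \<noteq> {}" for m n
  proof
    assume "H \<gamma> m n = {}"
    then have "sep (H \<gamma> m)" unfolding sep_def using X Hsub[of \<gamma> m]
      by (intro exI[of _ "\<lambda>k. if k = n then {} else space X"]) auto
    then show False using ns by blast
  qed
  define \<alpha> where "\<alpha> n = baire_slice n \<gamma>" for n
  have Hcyl: "\<exists>m. \<forall>m'\<ge>m. H \<gamma> m' n \<subseteq> f n ` (D n \<inter> cylinder (\<alpha> n) l)" for n l
  proof (intro exI allI impI)
    fix m' assume m': "Suc (\<Sum>j<l. prod_encode (n, j)) \<le> m'"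
    have "prod_encode (n, j) < m'" if "j < l" for j
      using member_le_sum[of j "{..<l}" "\<lambda>j. prod_encode (n, j)"] that m' by simp
    then show "H \<gamma> m' n \<subseteq> f n ` (D n \<inter> cylinder (\<alpha> n) l)"
      unfolding H_def cylinder_def \<alpha>_def baire_slice_def by blast
  qed
  have \<alpha>D: "\<alpha> n \<in> D n" for n
  proof -
    have "D n \<inter> cylinder (\<alpha> n) l \<noteq> {}" for l
      using Hcyl[of n l] ne by blast
    then show ?thesis using Df(1) unfolding baire_closed_def by blast
  qed
  have fT: "f n (\<alpha> n) \<in> topspace T" for n using \<alpha>D Df(3) sub by blast
  have "\<exists>n. f n (\<alpha> n) \<noteq> f 0 (\<alpha> 0)"
  proof (rule ccontr)
    assume "\<nexists>n. f n (\<alpha> n) \<noteq> f 0 (\<alpha> 0)"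
    then have "f 0 (\<alpha> 0) \<in> A n" for n using \<alpha>D Df(3) by (metis image_eqI)
    then show False using empty by blast
  qed
  then obtain i where i: "f i (\<alpha> i) \<noteq> f 0 (\<alpha> 0)" by blast
  then obtain U V where UV: "openin T U" "openin T V" "f i (\<alpha> i) \<in> U" "f 0 (\<alpha> 0) \<in> V" "disjnt U V"
    using T fT unfolding Hausdorff_space_def by metis
  obtain l where l: "f i ` (D i \<inter> cylinder (\<alpha> i) l) \<subseteq> U"
    using Df(2)[of i] \<alpha>D UV(1,3) unfolding baire_continuous_def by metis
  obtain l' where l': "f 0 ` (D 0 \<inter> cylinder (\<alpha> 0) l') \<subseteq> V"
    using Df(2)[of 0] \<alpha>D UV(2,4) unfolding baire_continuous_def by metis
  obtain m where m: "\<forall>m'\<ge>m. H \<gamma> m' i \<subseteq> U" using Hcyl[of i l] l by blast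
  obtain m2 where m2: "\<forall>m'\<ge>m2. H \<gamma> m' 0 \<subseteq> V" using Hcyl[of 0 l'] l' by blast
  have i0: "i \<noteq> 0" using i by metis
  have "sep (H \<gamma> (max m m2))"
    unfolding sep_def
  proof (intro exI[of _ "\<lambda>k. if k = i then U else if k = 0 then V else space X"] conjI allI)
    fix n
    show "(if n = i then U else if n = 0 then V else space X) \<in> sets X" using UV X(2) by simp
    show "H \<gamma> (max m m2) n \<subseteq> (if n = i then U else if n = 0 then V else space X)"
      using m m2 Hsub X(1) i0 by auto
    show "(\<Inter>n. if n = i then U else if n = 0 then V else space X) = {}"
    proof (rule ccontr)
      assume "(\<Inter>n. if n = i then U else if n = 0 then V else space X) \<noteq> {}"
      then obtain x where "\<And>n. x \<in> (if n = i then U else if n = 0 then V else space X)" by blast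
      from this[of i] this[of 0] i0 have "x \<in> U" "x \<in> V" by auto
      then show False using UV(5) by (auto simp: disjnt_iff)
    qed
  qed
  then show False using ns by blast
qed

text \<open>The supremum over \<open>t\<close> need not be Borel measurable in \<open>x\<close>, so the sublevel sets themselves
  cannot be used; Novikov's theorem separates the projections of \<open>{f > n}\<close> by Borel sets.\<close>

lemma bounded_exhaustion:
  fixes f :: "'a \<times> real \<Rightarrow> real"
  assumes X: "standard_borel X" and f: "f \<in> borel_measurable (X \<Otimes>\<^sub>M borel)"
    and bdd: "\<And>x. x \<in> space X \<Longrightarrow> \<exists>K. \<forall>t. f (x, t) \<le> K"
  obtains B :: "nat \<Rightarrow> 'a set" where "\<And>n. B n \<in> sets X" "(\<Union>n. B n) = space X"
    "\<And>n x t. x \<in> B n \<Longrightarrow> f (x, t) \<le> real n"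
proof -
  obtain T where T: "completely_metrizable_space T" "second_countable T" "topspace T = space X"
       "sets X = sigma_sets (topspace T) {U. openin T U}"
    using X unfolding standard_borel_def by blast
  note TT = T(1) second_countable_imp_separable_space[OF T(2)]
  have ED: "completely_metrizable_space (euclidean :: real topology)"
    by (rule completely_metrizable_space_euclidean)
  have ES: "separable_space (euclidean :: real topology)"
  proof -
    obtain Q :: "real set" where "countable Q" "\<And>U. open U \<Longrightarrow> U \<noteq> {} \<Longrightarrow> \<exists>d\<in>Q. d \<in> U"
      by (metis countable_dense_setE)
    moreover from this have "euclidean closure_of Q = UNIV"
      unfolding closure_of_def by auto
    ultimately show ?thesis unfolding separable_space_def by (intro exI[of _ Q]) simp
  qed
  let ?P = "prod_topology T (euclidean :: real topology)"
  have HT: "Hausdorff_space T"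
    by (intro metrizable_imp_Hausdorff_space completely_metrizable_imp_metrizable_space T(1))
  have HP: "Hausdorff_space ?P"
    using HT Hausdorff_space_euclidean[where 'a=real] unfolding Hausdorff_space_prod_topology by simp
  have aX: "analytic_in T A \<and> analytic_in T (topspace T - A)" if "A \<in> sets X" for A
    by (rule analytic_in_borel[OF TT]) (use that T(4) in simp)
  have aR: "analytic_in euclidean A \<and> analytic_in euclidean (topspace euclidean - A)" if "A \<in> sets borel" for A :: "real set"
    by (rule analytic_in_borel[OF ED ES]) (use that in \<open>simp add: borel_def\<close>)
  have aP: "analytic_in ?P E" if "E \<in> sets (X \<Otimes>\<^sub>M borel)" for E
  proof -
    have tp: "topspace ?P = space X \<times> (space borel :: real set)" using T(3) by simp
    have "analytic_in ?P E \<and> analytic_in ?P (topspace ?P - E)"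
    proof (rule analytic_in_sigma_sets[OF HP])
      show "E \<in> sigma_sets (topspace ?P) {a \<times> b |a b. a \<in> sets X \<and> b \<in> sets (borel :: real measure)}"
        using that unfolding tp sets_pair_measure .
      show "analytic_in ?P (topspace ?P)"
        using analytic_in_Times[of T "topspace T" "euclidean :: real topology" UNIV] aX[of "{}"] aR[of "{}"] by simp
      fix A assume "A \<in> {a \<times> b |a b. a \<in> sets X \<and> b \<in> sets (borel :: real measure)}"
      then obtain a b where ab: "A = a \<times> b" "a \<in> sets X" "b \<in> sets (borel :: real measure)" by blast
      \<comment> \<open>The complement of a rectangle is a union of two rectangles, written as a
        sequence that is constant from 1 on in order to fit the countable union.\<close>
      have "topspace ?P - A = (\<Union>i::nat. if i = 0 then (topspace T - a) \<times> UNIV else topspace T \<times> (UNIV - b))"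
        unfolding ab(1) using sets.sets_into_space[OF ab(2)] by (auto split: if_splits)
      moreover have "analytic_in ?P (if i = 0 then (topspace T - a) \<times> UNIV else topspace T \<times> (UNIV - b))" for i :: nat
        using aX[OF ab(2)] aX[of "{}"] aR[OF ab(3)] aR[of "{}"] by (auto intro!: analytic_in_Times)
      ultimately have "analytic_in ?P (topspace ?P - A)"
        using analytic_in_UN[of ?P "\<lambda>i. if i = 0 then (topspace T - a) \<times> UNIV else topspace T \<times> (UNIV - b)"] by simp
      then show "analytic_in ?P A \<and> analytic_in ?P (topspace ?P - A)"
        unfolding ab(1) using aX[OF ab(2)] aR[OF ab(3)] by (auto intro: analytic_in_Times)
    qed
    then show ?thesis ..
  qed
  define E where "E n = {z \<in> space (X \<Otimes>\<^sub>M borel). real n < f z}" for n :: nat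
  have "E n \<in> sets (X \<Otimes>\<^sub>M borel)" for n unfolding E_def using f by measurable
  then have aE: "analytic_in T (fst ` E n)" for n
    by (intro analytic_in_continuous_image[OF aP continuous_map_fst])
  \<comment> \<open>A state in all projections would have values above every \<open>n\<close>,
    contrary to \<open>bdd\<close>.\<close>
  have "(\<Inter>n. fst ` E n) = {}"
  proof (rule ccontr)
    assume "(\<Inter>n. fst ` E n) \<noteq> {}"
    then obtain x where "x \<in> (\<Inter>n. fst ` E n)" by (metis all_not_in_conv)
    then have x: "x \<in> fst ` E n" for n by (simp only: INT_iff UNIV_I ball_simps)
    have ex: "\<exists>t. x \<in> space X \<and> real n < f (x, t)" for n
    proof -
      obtain z where "z \<in> E n" "x = fst z" using x[of n] by blast
      then show ?thesis unfolding E_def by (cases z) (auto simp: space_pair_measure)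
    qed
    then have xX: "x \<in> space X" and lt: "\<And>n. \<exists>t. real n < f (x, t)" by blast+
    obtain K where K: "\<And>t. f (x, t) \<le> K" using bdd[OF xX] by blast
    obtain n where "K < real n" using reals_Archimedean2 by blast
    then show False using lt[of n] K by (meson not_less order_trans less_imp_le le_less_trans)
  qed
  then have "\<exists>Z. (\<forall>n. Z n \<in> sets X \<and> fst ` E n \<subseteq> Z n) \<and> (\<Inter>n. Z n) = {}"
    using T(4) by (intro Novikov_separation[OF HT T(3) _ aE]) (auto intro: sigma_sets.Basic)
  then obtain Z where Z: "\<And>n. Z n \<in> sets X" "\<And>n. fst ` E n \<subseteq> Z n" "(\<Inter>n. Z n) = {}" by metis
  show thesis
  \<comment> \<open>The complements avoid the projections, so \<open>f\<close> is at most
    \<open>n\<close> there, and they cover because the separating sets have empty intersection. They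
    need not increase with \<open>n\<close>.\<close>
  proof (rule that[of "\<lambda>n. space X - Z n"])
    show "space X - Z n \<in> sets X" for n using Z(1) by auto
    show "(\<Union>n. space X - Z n) = space X" using Z(3) by blast
    show "f (x, t) \<le> real n" if "x \<in> space X - Z n" for n x t
    proof (rule ccontr)
      assume "\<not> f (x, t) \<le> real n"
      then have "(x, t) \<in> E n" unfolding E_def using that by (auto simp: space_pair_measure)
      then show False using Z(2)[of n] that by force
    qed
  qed
qed

section \<open>Finite kernels\<close>

text \<open>In this form joint measurability of a curried function can be handed to the
  measurability prover as a rule, with arbitrary measurable expressions as arguments.\<close>

lemma measurable_uncurry2:
  assumes "(\<lambda>z. h (fst z) (snd z)) \<in> A \<Otimes>\<^sub>M B \<rightarrow>\<^sub>M L" "fa \<in> N \<rightarrow>\<^sub>M A" "fb \<in> N \<rightarrow>\<^sub>M B"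
  shows "(\<lambda>a. h (fa a) (fb a)) \<in> N \<rightarrow>\<^sub>M L"
  using measurable_compose[OF measurable_Pair[OF assms(2,3)] assms(1)] by simp

lemma measurable_uncurry3:
  assumes "(\<lambda>z. h (fst z) (fst (snd z)) (snd (snd z))) \<in> A \<Otimes>\<^sub>M B \<Otimes>\<^sub>M C \<rightarrow>\<^sub>M L"
    "fa \<in> N \<rightarrow>\<^sub>M A" "fb \<in> N \<rightarrow>\<^sub>M B" "fc \<in> N \<rightarrow>\<^sub>M C"
  shows "(\<lambda>a. h (fa a) (fb a) (fc a)) \<in> N \<rightarrow>\<^sub>M L"
  using measurable_compose[OF measurable_Pair[OF assms(2) measurable_Pair[OF assms(3,4)]] assms(1)] by simp

definition finite_kernel :: "'b measure \<Rightarrow> 'a measure \<Rightarrow> ('b \<Rightarrow> 'a measure) \<Rightarrow> bool" where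
  "finite_kernel M N K \<longleftrightarrow>
    (\<forall>a\<in>space M. sets (K a) = sets N \<and> finite_measure (K a)) \<and>
    (\<forall>B\<in>sets N. (\<lambda>a. emeasure (K a) B) \<in> borel_measurable M)"

lemma finite_kernelD:
  assumes "finite_kernel M N K" "a \<in> space M"
  shows "sets (K a) = sets N" "finite_measure (K a)" "space (K a) = space N"
  using assms sets_eq_imp_space_eq[of "K a" N] unfolding finite_kernel_def by auto

lemma finite_kernel_comp:
  assumes K: "finite_kernel M N K" and \<phi>: "\<phi> \<in> M' \<rightarrow>\<^sub>M M"
  shows "finite_kernel M' N (\<lambda>a. K (\<phi> a))"
proof -
  have "\<phi> a \<in> space M" if "a \<in> space M'" for a using measurable_space[OF \<phi> that] .
  moreover have "(\<lambda>a. emeasure (K (\<phi> a)) B) \<in> borel_measurable M'" if "B \<in> sets N" for B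
    using measurable_compose[OF \<phi>, of "\<lambda>a. emeasure (K a) B" borel] K that unfolding finite_kernel_def by blast
  ultimately show ?thesis using K unfolding finite_kernel_def by blast
qed

text \<open>Rectangles generate the product and are stable under intersection. Finiteness of the
  kernel permits the step to complements, where one extended number is subtracted from
  another.\<close>

lemma measurable_emeasure_kernel_section:
  assumes K: "finite_kernel M N K" and D: "D \<in> sets (M \<Otimes>\<^sub>M N)"
  shows "(\<lambda>a. emeasure (K a) (Pair a -` D)) \<in> borel_measurable M"
proof -
  have KB[measurable]: "(\<lambda>a. emeasure (K a) B) \<in> borel_measurable M" if "B \<in> sets N" for B
    using K that unfolding finite_kernel_def by blast
  have sec: "Pair a -` D \<in> sets (K a)" if "D \<in> sets (M \<Otimes>\<^sub>M N)" "a \<in> space M" for a D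
    using sets_Pair1[OF that(1)] finite_kernelD(1)[OF K that(2)] by simp
  have "D \<in> sigma_sets (space M \<times> space N) {a \<times> b |a b. a \<in> sets M \<and> b \<in> sets N}"
    using D unfolding sets_pair_measure .
  then show ?thesis
  proof (induction rule: sigma_sets_induct_disjoint[OF Int_stable_pair_measure_generator pair_measure_closed, consumes 1,
        case_names basic empty compl union])
    case (basic A)
    then obtain a b where ab: "A = a \<times> b" "a \<in> sets M" "b \<in> sets N" by blast
    have "(\<lambda>x. indicator a x * emeasure (K x) b) \<in> borel_measurable M" using ab by measurable
    also have "(\<lambda>x. indicator a x * emeasure (K x) b) = (\<lambda>x. emeasure (K x) (Pair x -` A))"
      by (auto simp: ab(1) split: split_indicator)
    finally show ?case .
  next
    case empty
    show ?case by simp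
  next
    case (compl A)
    have A: "A \<in> sets (M \<Otimes>\<^sub>M N)" using compl(1) unfolding sets_pair_measure .
    have "(\<lambda>x. emeasure (K x) (space N) - emeasure (K x) (Pair x -` A)) \<in> borel_measurable M"
      using compl(2) by measurable
    also have "?this \<longleftrightarrow> ?case"
    proof (rule measurable_cong)
      fix x assume x: "x \<in> space M"
      interpret finite_measure "K x" using finite_kernelD(2)[OF K x] .
      have "Pair x -` (space M \<times> space N - A) = space (K x) - Pair x -` A"
        using x finite_kernelD(3)[OF K x] by auto
      then show "emeasure (K x) (space N) - emeasure (K x) (Pair x -` A) = emeasure (K x) (Pair x -` (space M \<times> space N - A))"
        using emeasure_compl[OF sec[OF A x]] finite_kernelD(3)[OF K x] by simp
    qed
    finally show ?case .
  next
    case (union A)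
    have A: "A i \<in> sets (M \<Otimes>\<^sub>M N)" for i using union(2) unfolding sets_pair_measure by blast
    have "(\<lambda>x. \<Sum>i. emeasure (K x) (Pair x -` A i)) \<in> borel_measurable M"
      using union(3) by measurable
    also have "?this \<longleftrightarrow> ?case"
    proof (rule measurable_cong)
      fix x assume x: "x \<in> space M"
      have "disjoint_family (\<lambda>i. Pair x -` A i)"
        using union(1) unfolding disjoint_family_on_def by blast
      then have "(\<Sum>i. emeasure (K x) (Pair x -` A i)) = emeasure (K x) (\<Union>i. Pair x -` A i)"
        using sec[OF A x] by (intro suminf_emeasure) auto
      then show "(\<Sum>i. emeasure (K x) (Pair x -` A i)) = emeasure (K x) (Pair x -` \<Union> (range A))"
        by (simp add: vimage_UN)
    qed
    finally show ?case .
  qed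
qed

lemma measurable_nn_integral_kernel:
  fixes f :: "_ \<Rightarrow> ennreal"
  assumes K: "finite_kernel M N K" and f: "f \<in> borel_measurable (M \<Otimes>\<^sub>M N)"
  shows "(\<lambda>a. \<integral>\<^sup>+y. f (a, y) \<partial>K a) \<in> borel_measurable M"
proof -
  have sec: "(\<lambda>y. f (a, y)) \<in> borel_measurable (K a)"
    if "f \<in> borel_measurable (M \<Otimes>\<^sub>M N)" "a \<in> space M" for a and f :: "_ \<Rightarrow> ennreal"
    using measurable_compose[OF measurable_Pair1'[OF that(2)] that(1)] finite_kernelD(1)[OF K that(2)]
    by (simp cong: measurable_cong_sets)
  show ?thesis using f
  proof (induction rule: borel_measurable_induct)
    case (cong f g)
    have "(\<integral>\<^sup>+y. f (a, y) \<partial>K a) = (\<integral>\<^sup>+y. g (a, y) \<partial>K a)" if "a \<in> space M" for a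
      using cong(3) finite_kernelD(3)[OF K that] that by (intro nn_integral_cong) (auto simp: space_pair_measure)
    then show ?case using cong(4) by (simp cong: measurable_cong)
  next
    case (set A)
    have "(\<integral>\<^sup>+y. indicator A (a, y) \<partial>K a) = emeasure (K a) (Pair a -` A)" if "a \<in> space M" for a
    proof -
      have "Pair a -` A \<in> sets (K a)" using sets_Pair1[OF set] finite_kernelD(1)[OF K that] by simp
      then have "(\<integral>\<^sup>+y. indicator (Pair a -` A) y \<partial>K a) = emeasure (K a) (Pair a -` A)" by simp
      then show ?thesis by (simp add: indicator_def)
    qed
    then show ?case using measurable_emeasure_kernel_section[OF K set] by (simp cong: measurable_cong)
  next
    case (mult u c)
    have "(\<integral>\<^sup>+y. c * u (a, y) \<partial>K a) = c * (\<integral>\<^sup>+y. u (a, y) \<partial>K a)" if "a \<in> space M" for a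
      using sec[OF mult(2) that] by (rule nn_integral_cmult)
    then show ?case using mult(4) by (simp cong: measurable_cong)
  next
    case (add u v)
    have "(\<integral>\<^sup>+y. v (a, y) + u (a, y) \<partial>K a) = (\<integral>\<^sup>+y. v (a, y) \<partial>K a) + (\<integral>\<^sup>+y. u (a, y) \<partial>K a)" if "a \<in> space M" for a
      using sec[OF \<open>u \<in> borel_measurable _\<close> that] sec[OF \<open>v \<in> borel_measurable _\<close> that]
      by (intro nn_integral_add) auto
    then show ?case using add by (simp cong: measurable_cong)
  next
    case (seq U)
    have "(\<integral>\<^sup>+y. (SUP i. U i) (a, y) \<partial>K a) = (SUP i. \<integral>\<^sup>+y. U i (a, y) \<partial>K a)" if "a \<in> space M" for a
      unfolding SUP_apply using sec[OF \<open>\<And>i. U i \<in> borel_measurable _\<close> that] \<open>incseq U\<close>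
      by (intro nn_integral_monotone_convergence_SUP) (auto simp: incseq_def le_fun_def)
    then show ?case using seq by (simp cong: measurable_cong)
  qed
qed

lemma measurable_nn_integral_kernel_comp:
  fixes f :: "_ \<Rightarrow> ennreal"
  assumes "finite_kernel M N K" and "\<phi> \<in> M' \<rightarrow>\<^sub>M M" and "f \<in> borel_measurable (M' \<Otimes>\<^sub>M N)"
  shows "(\<lambda>a. \<integral>\<^sup>+y. f (a, y) \<partial>K (\<phi> a)) \<in> borel_measurable M'"
  by (rule measurable_nn_integral_kernel[OF finite_kernel_comp[OF assms(1,2)] assms(3)])

text \<open>Both sides integrate over \<open>u < w < v < t\<close>. Since the kernel depends on
  \<open>w\<close>, two applications of Fubini's theorem are made: \<open>y\<close> and
  \<open>v\<close> are exchanged at fixed \<open>w\<close>, then \<open>v\<close> and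
  \<open>w\<close> with \<open>y\<close> already integrated out.\<close>

lemma nn_integral_kernel_swap:
  fixes h :: "real \<Rightarrow> 'a \<Rightarrow> real \<Rightarrow> ennreal"
  assumes K: "finite_kernel borel N K"
    and h: "(\<lambda>(w, y, v). h w y v) \<in> borel_measurable (borel \<Otimes>\<^sub>M N \<Otimes>\<^sub>M borel)"
  shows "(\<integral>\<^sup>+w\<in>{u<..<t}. (\<integral>\<^sup>+y. (\<integral>\<^sup>+v\<in>{w<..<t}. h w y v \<partial>lborel) \<partial>K w) \<partial>lborel) =
         (\<integral>\<^sup>+v\<in>{u<..<t}. (\<integral>\<^sup>+w\<in>{u<..<v}. (\<integral>\<^sup>+y. h w y v \<partial>K w) \<partial>lborel) \<partial>lborel)"
proof -
  have hm[measurable]: "(\<lambda>z. h (fst z) (fst (snd z)) (snd (snd z))) \<in> borel_measurable (borel \<Otimes>\<^sub>M N \<Otimes>\<^sub>M borel)"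
    using h by (simp add: case_prod_beta')
  have hm3: "(\<lambda>z. h (fst (fst z)) (snd z) (snd (fst z))) \<in> borel_measurable ((borel \<Otimes>\<^sub>M borel) \<Otimes>\<^sub>M N)"
    by (rule measurable_compose[OF _ hm, of "\<lambda>z. (fst (fst z), snd z, snd (fst z))", simplified]) measurable
  define H where "H w v = (\<integral>\<^sup>+y. h w y v \<partial>K w)" for w v
  have Hm[measurable]: "(\<lambda>z. H (fst z) (snd z)) \<in> borel_measurable (borel \<Otimes>\<^sub>M borel)"
    unfolding H_def using measurable_nn_integral_kernel_comp[OF K measurable_fst hm3] by simp
  have "(\<integral>\<^sup>+w\<in>{u<..<t}. (\<integral>\<^sup>+y. (\<integral>\<^sup>+v\<in>{w<..<t}. h w y v \<partial>lborel) \<partial>K w) \<partial>lborel) =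
     (\<integral>\<^sup>+w. (\<integral>\<^sup>+v. H w v * indicator {w<..<t} v * indicator {u<..<t} w \<partial>lborel) \<partial>lborel)"
  proof (intro nn_integral_cong)
    fix w :: real
    interpret Kw: finite_measure "K w" using finite_kernelD(2)[OF K] by simp
    interpret pair_sigma_finite "K w" "lborel :: real measure" by unfold_locales
    have sK: "sets (K w) = sets N" using finite_kernelD(1)[OF K] by simp
    have m1: "(\<lambda>(y, v). h w y v * indicator {w<..<t} v) \<in> borel_measurable (K w \<Otimes>\<^sub>M lborel)"
    proof -
      have "(\<lambda>z. (w, fst z, snd z)) \<in> (N \<Otimes>\<^sub>M borel) \<rightarrow>\<^sub>M (borel \<Otimes>\<^sub>M N \<Otimes>\<^sub>M borel)" by measurable
      from measurable_compose[OF this hm] have [measurable]: "(\<lambda>z. h w (fst z) (snd z)) \<in> borel_measurable (N \<Otimes>\<^sub>M borel)" by simp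
      have "(\<lambda>z. h w (fst z) (snd z) * indicator {w<..<t} (snd z)) \<in> borel_measurable (N \<Otimes>\<^sub>M borel)" by measurable
      then show ?thesis using sK by (simp add: case_prod_beta' cong: measurable_cong_sets sets_pair_measure_cong)
    qed
    have m2: "(\<lambda>y. h w y v) \<in> borel_measurable (K w)" for v
    proof -
      have "(\<lambda>y. (w, y, v)) \<in> N \<rightarrow>\<^sub>M (borel \<Otimes>\<^sub>M N \<Otimes>\<^sub>M borel)" by measurable
      from measurable_compose[OF this hm] show ?thesis using sK by (simp cong: measurable_cong_sets)
    qed
    have "(\<integral>\<^sup>+y. (\<integral>\<^sup>+v\<in>{w<..<t}. h w y v \<partial>lborel) \<partial>K w) = (\<integral>\<^sup>+v. (\<integral>\<^sup>+y. h w y v * indicator {w<..<t} v \<partial>K w) \<partial>lborel)"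
      using Fubini'[OF m1] by simp
    also have "\<dots> = (\<integral>\<^sup>+v. H w v * indicator {w<..<t} v \<partial>lborel)"
      unfolding H_def using m2 by (simp add: nn_integral_multc)
    finally have "(\<integral>\<^sup>+y. (\<integral>\<^sup>+v\<in>{w<..<t}. h w y v \<partial>lborel) \<partial>K w) * indicator {u<..<t} w =
        (\<integral>\<^sup>+v. H w v * indicator {w<..<t} v \<partial>lborel) * indicator {u<..<t} w" by simp
    also have "\<dots> = (\<integral>\<^sup>+v. H w v * indicator {w<..<t} v * indicator {u<..<t} w \<partial>lborel)"
    proof (rule nn_integral_multc[symmetric])
      have "(\<lambda>v. H w v) \<in> borel_measurable borel"
        using measurable_compose[OF measurable_Pair1'[of w borel] Hm] by simp
      then show "(\<lambda>v. H w v * indicator {w<..<t} v) \<in> borel_measurable lborel" by simp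
    qed
    finally show "(\<integral>\<^sup>+y. (\<integral>\<^sup>+v\<in>{w<..<t}. h w y v \<partial>lborel) \<partial>K w) * indicator {u<..<t} w =
        (\<integral>\<^sup>+v. H w v * indicator {w<..<t} v * indicator {u<..<t} w \<partial>lborel)" .
  qed
  also have "\<dots> = (\<integral>\<^sup>+v. (\<integral>\<^sup>+w. H w v * indicator {w<..<t} v * indicator {u<..<t} w \<partial>lborel) \<partial>lborel)"
  proof (rule lborel_pair.Fubini'[symmetric])
    have "(\<lambda>z. H (fst z) (snd z) * (if fst z < snd z \<and> snd z < t then 1 else 0) * (if u < fst z \<and> fst z < t then 1 else 0))
        \<in> borel_measurable (borel \<Otimes>\<^sub>M borel)"
      by measurable
    then show "(\<lambda>(w, v). H w v * indicator {w<..<t} v * indicator {u<..<t} w) \<in> borel_measurable (lborel \<Otimes>\<^sub>M lborel)"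
      by (simp add: case_prod_beta' indicator_def of_bool_def cong: measurable_cong_sets sets_pair_measure_cong)
  qed
  also have "\<dots> = (\<integral>\<^sup>+v. (\<integral>\<^sup>+w. H w v * indicator {u<..<v} w \<partial>lborel) * indicator {u<..<t} v \<partial>lborel)"
  proof (intro nn_integral_cong)
    fix v :: real
    have "H w v * indicator {w<..<t} v * indicator {u<..<t} w = H w v * indicator {u<..<v} w * indicator {u<..<t} v" for w
      by (auto split: split_indicator)
    moreover have "(\<lambda>w. H w v * indicator {u<..<v} w) \<in> borel_measurable borel"
      using measurable_compose[OF measurable_Pair2'[of v borel borel] Hm] by simp
    ultimately show "(\<integral>\<^sup>+w. H w v * indicator {w<..<t} v * indicator {u<..<t} w \<partial>lborel) =
        (\<integral>\<^sup>+w. H w v * indicator {u<..<v} w \<partial>lborel) * indicator {u<..<t} v"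
      by (simp add: nn_integral_multc)
  qed
  finally show ?thesis unfolding H_def .
qed

section \<open>Jump kernels with rates bounded in time\<close>

text \<open>Conservativity is built in, as the exit rate \<open>r\<close> is the total mass of the
  jump kernel. The bound on the rates is uniform in time but may vary with the state.\<close>

locale jump_rates =
  fixes X :: "'a measure" and Q :: "'a \<Rightarrow> real \<Rightarrow> 'a measure"
  assumes Q: "finite_kernel (X \<Otimes>\<^sub>M borel) X (\<lambda>(x, w). Q x w)"
    and bdd: "\<And>x. x \<in> space X \<Longrightarrow> \<exists>K. \<forall>w. emeasure (Q x w) (space X) \<le> ennreal K"
begin

definition r :: "'a \<Rightarrow> real \<Rightarrow> real" where
  "r x w = measure (Q x w) (space X)"

definition S :: "'a \<Rightarrow> real \<Rightarrow> real \<Rightarrow> real" where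
  "S x u t = exp (- (LINT s:{u..t}|lborel. r x s))"

lemma sets_Q: "x \<in> space X \<Longrightarrow> sets (Q x w) = sets X"
  and space_Q: "x \<in> space X \<Longrightarrow> space (Q x w) = space X"
  and finite_Q: "x \<in> space X \<Longrightarrow> finite_measure (Q x w)"
  using finite_kernelD[OF Q, of "(x, w)"] by (auto simp: space_pair_measure)

lemma Q_kernel: "x \<in> space X \<Longrightarrow> finite_kernel borel X (Q x)"
  using finite_kernel_comp[OF Q, of "\<lambda>w. (x, w)" borel] by simp

lemma emeasure_Q_space: "x \<in> space X \<Longrightarrow> emeasure (Q x w) (space X) = ennreal (r x w)"
  unfolding r_def using finite_measure.emeasure_eq_measure[OF finite_Q] .

lemma r_nonneg: "0 \<le> r x w"
  unfolding r_def by simp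

lemma r_bounded: "x \<in> space X \<Longrightarrow> \<exists>K. \<forall>w. r x w \<le> K"
proof -
  assume x: "x \<in> space X"
  obtain K where "\<And>w. emeasure (Q x w) (space X) \<le> ennreal K" using bdd[OF x] by blast
  then have "r x w \<le> max 0 K" for w
    using emeasure_Q_space[OF x, of w] r_nonneg[of x w]
    by (metis ennreal_le_iff ennreal_max_0 max.cobounded1)
  then show ?thesis by blast
qed

lemma measurable_r[measurable (raw)]:
  assumes "f \<in> N \<rightarrow>\<^sub>M X" "h \<in> borel_measurable N"
  shows "(\<lambda>a. r (f a) (h a)) \<in> borel_measurable N"
proof -
  have "(\<lambda>z. emeasure (case z of (x, w) \<Rightarrow> Q x w) (space X)) \<in> borel_measurable (X \<Otimes>\<^sub>M borel)"
    using Q unfolding finite_kernel_def by blast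
  moreover have "(\<lambda>a. (f a, h a)) \<in> N \<rightarrow>\<^sub>M X \<Otimes>\<^sub>M borel" using assms by measurable
  ultimately have "(\<lambda>a. emeasure (Q (f a) (h a)) (space X)) \<in> borel_measurable N"
    by (auto dest: measurable_compose[rotated])
  then show ?thesis unfolding r_def measure_def by measurable
qed

lemma measurable_nn_integral_Q[measurable (raw)]:
  fixes k :: "'b \<Rightarrow> 'a \<Rightarrow> ennreal"
  assumes "(\<lambda>z. k (fst z) (snd z)) \<in> borel_measurable (N \<Otimes>\<^sub>M X)" "f \<in> N \<rightarrow>\<^sub>M X" "h \<in> borel_measurable N"
  shows "(\<lambda>a. \<integral>\<^sup>+z. k a z \<partial>Q (f a) (h a)) \<in> borel_measurable N"
proof -
  have "(\<lambda>a. (f a, h a)) \<in> N \<rightarrow>\<^sub>M X \<Otimes>\<^sub>M borel" using assms by measurable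
  from measurable_nn_integral_kernel_comp[OF Q this assms(1)] show ?thesis by simp
qed

lemma measurable_S[measurable (raw)]:
  assumes [measurable]: "f \<in> N \<rightarrow>\<^sub>M X" "a \<in> borel_measurable N" "b \<in> borel_measurable N"
  shows "(\<lambda>c. S (f c) (a c) (b c)) \<in> borel_measurable N"
proof -
  have "(\<lambda>c. \<integral>s. indicator {a c..b c} s *\<^sub>R r (f c) s \<partial>lborel) \<in> borel_measurable N"
  proof (rule lborel.borel_measurable_lebesgue_integral)
    have "(\<lambda>z. (if a (fst z) \<le> snd z \<and> snd z \<le> b (fst z) then 1 else 0) *\<^sub>R r (f (fst z)) (snd z)) \<in> borel_measurable (N \<Otimes>\<^sub>M lborel)"
      by measurable
    then show "(\<lambda>(c, s). indicator {a c..b c} s *\<^sub>R r (f c) s) \<in> borel_measurable (N \<Otimes>\<^sub>M lborel)"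
      by (simp add: case_prod_beta' indicator_def of_bool_def)
  qed
  then show ?thesis unfolding S_def set_lebesgue_integral_def by measurable
qed

lemma S_pos: "0 < S x u t"
  unfolding S_def by simp

lemma S_le_1: "S x u t \<le> 1"
proof -
  have "0 \<le> (LINT s:{u..t}|lborel. r x s)"
    unfolding set_lebesgue_integral_def using r_nonneg by (intro integral_nonneg_AE) auto
  then show ?thesis unfolding S_def by simp
qed

lemma r_S_integral:
  assumes x: "x \<in> space X" and ut: "u \<le> t"
  shows "(\<integral>\<^sup>+w\<in>{u<..<t}. ennreal (r x w * S x u w) \<partial>lborel) = ennreal (1 - S x u t)"
    and "(\<integral>\<^sup>+w\<in>{u<..<t}. ennreal (r x w * S x w t) \<partial>lborel) = ennreal (1 - S x u t)"
proof -
  obtain K where K: "\<And>w. r x w \<le> K" using r_bounded[OF x] by blast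
  have "(\<lambda>w. r x w) \<in> borel_measurable borel" using x by measurable
  from exp_integral_identities[OF this r_nonneg K ut]
  show "(\<integral>\<^sup>+w\<in>{u<..<t}. ennreal (r x w * S x u w) \<partial>lborel) = ennreal (1 - S x u t)"
    "(\<integral>\<^sup>+w\<in>{u<..<t}. ennreal (r x w * S x w t) \<partial>lborel) = ennreal (1 - S x u t)"
    unfolding S_def by simp_all
qed

lemma S_add_compl: "ennreal (S x u t) + ennreal (1 - S x u t) = 1"
  using S_le_1[of x u t] less_imp_le[OF S_pos[of x u t]] by (simp flip: ennreal_plus)

section \<open>First-jump iterates and their last-jump decomposition\<close>

text \<open>The last argument is a function because splitting off the last jump replaces the
  indicator of a set by \<open>G t w g\<close>, which in general is no indicator.\<close>

primrec U :: "nat \<Rightarrow> real \<Rightarrow> 'a \<Rightarrow> real \<Rightarrow> ('a \<Rightarrow> ennreal) \<Rightarrow> ennreal" where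
  "U 0 u x t g = g x * ennreal (S x u t)"
| "U (Suc n) u x t g =
    (\<integral>\<^sup>+ w \<in> {u<..<t}. (\<integral>\<^sup>+ y. ennreal (S x u w) * U n w y t g \<partial>Q x w) \<partial>lborel)"

text \<open>The function \<open>g\<close> carries a parameter from a further space \<open>M\<close>.
  In the last-jump decomposition it becomes \<open>G t w g\<close>, and the parameter is the time of
  the jump.\<close>

lemma measurable_U_aux:
  assumes g[measurable]: "g \<in> borel_measurable (M \<Otimes>\<^sub>M X)"
  shows "(\<lambda>a. U n (fst (snd a)) (fst (snd (snd a))) (snd (snd (snd a))) (\<lambda>y. g (fst a, y)))
    \<in> borel_measurable (M \<Otimes>\<^sub>M borel \<Otimes>\<^sub>M X \<Otimes>\<^sub>M borel)"
proof (induction n)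
  case 0
  show ?case unfolding U.simps by measurable
next
  case (Suc n)
  let ?N = "M \<Otimes>\<^sub>M borel \<Otimes>\<^sub>M X \<Otimes>\<^sub>M borel"
  have "(\<lambda>c. (fst (fst (fst c)), snd (fst c), snd c, snd (snd (snd (fst (fst c)))))) \<in> (?N \<Otimes>\<^sub>M borel) \<Otimes>\<^sub>M X \<rightarrow>\<^sub>M ?N"
    by measurable
  from measurable_compose[OF this Suc]
  have [measurable]: "(\<lambda>c. U n (snd (fst c)) (snd c) (snd (snd (snd (fst (fst c))))) (\<lambda>y. g (fst (fst (fst c)), y)))
      \<in> borel_measurable ((?N \<Otimes>\<^sub>M borel) \<Otimes>\<^sub>M X)" by simp
  have [measurable]: "(\<lambda>b. \<integral>\<^sup>+ y. ennreal (S (fst (snd (snd (fst b)))) (fst (snd (fst b))) (snd b)) *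
        U n (snd b) y (snd (snd (snd (fst b)))) (\<lambda>y. g (fst (fst b), y)) \<partial>Q (fst (snd (snd (fst b)))) (snd b))
      \<in> borel_measurable (?N \<Otimes>\<^sub>M borel)"
    by (rule measurable_nn_integral_Q) measurable
  have "(\<lambda>a. \<integral>\<^sup>+ w. (\<integral>\<^sup>+ y. ennreal (S (fst (snd (snd a))) (fst (snd a)) w) *
        U n w y (snd (snd (snd a))) (\<lambda>y. g (fst a, y)) \<partial>Q (fst (snd (snd a))) w) * indicator {fst (snd a)<..<snd (snd (snd a))} w \<partial>lborel)
      \<in> borel_measurable ?N"
  proof (rule lborel.borel_measurable_nn_integral)
    have "(\<lambda>b. (\<integral>\<^sup>+ y. ennreal (S (fst (snd (snd (fst b)))) (fst (snd (fst b))) (snd b)) *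
        U n (snd b) y (snd (snd (snd (fst b)))) (\<lambda>y. g (fst (fst b), y)) \<partial>Q (fst (snd (snd (fst b)))) (snd b)) *
        (if fst (snd (fst b)) < snd b \<and> snd b < snd (snd (snd (fst b))) then 1 else 0)) \<in> borel_measurable (?N \<Otimes>\<^sub>M borel)"
      by measurable
    then show "(\<lambda>(a, w). (\<integral>\<^sup>+ y. ennreal (S (fst (snd (snd a))) (fst (snd a)) w) *
        U n w y (snd (snd (snd a))) (\<lambda>y. g (fst a, y)) \<partial>Q (fst (snd (snd a))) w) * indicator {fst (snd a)<..<snd (snd (snd a))} w)
        \<in> borel_measurable (?N \<Otimes>\<^sub>M lborel)"
      by (simp add: case_prod_beta' indicator_def of_bool_def cong: measurable_cong_sets sets_pair_measure_cong)
  qed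
  then show ?case by simp
qed

lemma measurable_U[measurable (raw)]:
  assumes [measurable]: "(\<lambda>z. g (fst z) (snd z)) \<in> borel_measurable (N \<Otimes>\<^sub>M X)" "fu \<in> borel_measurable N" "fx \<in> N \<rightarrow>\<^sub>M X" "ft \<in> borel_measurable N"
  shows "(\<lambda>a. U n (fu a) (fx a) (ft a) (g a)) \<in> borel_measurable N"
proof -
  have "(\<lambda>a. (a, fu a, fx a, ft a)) \<in> N \<rightarrow>\<^sub>M N \<Otimes>\<^sub>M borel \<Otimes>\<^sub>M X \<Otimes>\<^sub>M borel" by measurable
  from measurable_compose[OF this measurable_U_aux[OF assms(1)]] show ?thesis by simp
qed

text \<open>The contribution of a last jump: out of \<open>y\<close> at time \<open>w\<close>,
  followed by survival in the new state until \<open>t\<close>.\<close>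

definition G :: "real \<Rightarrow> real \<Rightarrow> ('a \<Rightarrow> ennreal) \<Rightarrow> 'a \<Rightarrow> ennreal" where
  "G t w g y = (\<integral>\<^sup>+z. ennreal (S z w t) * g z \<partial>Q y w)"

lemma measurable_G[measurable (raw)]:
  assumes [measurable]: "(\<lambda>z. g (fst z) (snd z)) \<in> borel_measurable (N \<Otimes>\<^sub>M X)" "ft \<in> borel_measurable N" "fw \<in> borel_measurable N" "fy \<in> N \<rightarrow>\<^sub>M X"
  shows "(\<lambda>a. G (ft a) (fw a) (g a) (fy a)) \<in> borel_measurable N"
  unfolding G_def by (rule measurable_nn_integral_Q) measurable

text \<open>\<^const>\<open>U\<close> is defined by conditioning on the first jump; this is the decomposition at the
  last jump, obtained from it by Fubini's theorem.\<close>

lemma U_forward: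
  assumes x: "x \<in> space X" and g[measurable]: "g \<in> borel_measurable X"
  shows "U (Suc n) u x t g = (\<integral>\<^sup>+w\<in>{u<..<t}. U n u x w (G t w g) \<partial>lborel)"
  using x
proof (induction n arbitrary: u x)
  case 0
  have "(\<integral>\<^sup>+y. ennreal (S x u w) * U 0 w y t g \<partial>Q x w) = U 0 u x w (G t w g)" for w
  proof -
    have "(\<lambda>y. ennreal (S y w t) * g y) \<in> borel_measurable X" by measurable
    then have "(\<lambda>y. ennreal (S y w t) * g y) \<in> borel_measurable (Q x w)"
      using sets_Q[OF 0] by (simp cong: measurable_cong_sets)
    from nn_integral_cmult[OF this, of "ennreal (S x u w)"]
    show ?thesis unfolding U.simps G_def by (simp add: mult_ac)
  qed
  then show ?case by simp
next
  case (Suc n)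
  have "U (Suc (Suc n)) u x t g = (\<integral>\<^sup>+w\<in>{u<..<t}. (\<integral>\<^sup>+y. ennreal (S x u w) * U (Suc n) w y t g \<partial>Q x w) \<partial>lborel)"
    by simp
  also have "\<dots> = (\<integral>\<^sup>+w\<in>{u<..<t}. (\<integral>\<^sup>+y. (\<integral>\<^sup>+v\<in>{w<..<t}. ennreal (S x u w) * U n w y v (G t v g) \<partial>lborel) \<partial>Q x w) \<partial>lborel)"
  proof (intro nn_integral_cong arg_cong2[where f="(*)"] refl)
    fix w y assume "y \<in> space (Q x w)"
    then have y: "y \<in> space X" using space_Q[OF Suc.prems] by simp
    have "(\<lambda>v. U n w y v (G t v g) * indicator {w<..<t} v) \<in> borel_measurable lborel" using y by measurable
    from nn_integral_cmult[OF this, of "ennreal (S x u w)"]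
    show "ennreal (S x u w) * U (Suc n) w y t g = (\<integral>\<^sup>+v\<in>{w<..<t}. ennreal (S x u w) * U n w y v (G t v g) \<partial>lborel)"
      unfolding Suc.IH[OF y] by (simp add: mult_ac)
  qed
  \<comment> \<open>The first jump is at \<open>w\<close> and the last at \<open>v\<close>;
    exchanging the order of integration makes the last jump the outer one.\<close>
  also have "\<dots> = (\<integral>\<^sup>+v\<in>{u<..<t}. (\<integral>\<^sup>+w\<in>{u<..<v}. (\<integral>\<^sup>+y. ennreal (S x u w) * U n w y v (G t v g) \<partial>Q x w) \<partial>lborel) \<partial>lborel)"
    by (rule nn_integral_kernel_swap[OF Q_kernel[OF Suc.prems]])
       (use Suc.prems in \<open>simp add: case_prod_beta', measurable\<close>)
  also have "\<dots> = (\<integral>\<^sup>+v\<in>{u<..<t}. U (Suc n) u x v (G t v g) \<partial>lborel)" by simp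
  finally show ?case .
qed

text \<open>Induction over the first jump: the probability of no jump until \<open>t\<close> and
  that of a first jump before \<open>t\<close> add up to 1, by \<open>r_S_integral\<close>.\<close>

lemma U_sum_le_1:
  assumes "x \<in> space X"
  shows "(\<Sum>n<N. U n u x t (\<lambda>_. 1)) \<le> 1"
  using assms
proof (induction N arbitrary: u x)
  case (Suc N)
  note x = Suc.prems
  show ?case
  proof (cases "u \<le> t")
    \<comment> \<open>Times in reverse order occur because the bound is used for all
      \<open>t\<close>, to make \<open>Vm\<close> a finite kernel on the whole line.\<close>
    case False
    then have "U (Suc n) u x t (\<lambda>_. 1) = 0" for n by simp
    then have "(\<Sum>n<Suc N. U n u x t (\<lambda>_. 1)) = ennreal (S x u t)"
      by (simp add: sum.lessThan_Suc_shift del: sum.lessThan_Suc U.simps(2))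
    then show ?thesis using S_le_1[of x u t] by (simp add: ennreal_le_1)
  next
    case True
    have "(\<Sum>n<N. U (Suc n) u x t (\<lambda>_. 1)) =
        (\<integral>\<^sup>+w\<in>{u<..<t}. (\<integral>\<^sup>+y. ennreal (S x u w) * (\<Sum>n<N. U n w y t (\<lambda>_. 1)) \<partial>Q x w) \<partial>lborel)"
    proof -
      have eq: "(\<integral>\<^sup>+y. ennreal (S x u w) * (\<Sum>n<N. U n w y t (\<lambda>_. 1)) \<partial>Q x w) =
         (\<Sum>n<N. \<integral>\<^sup>+y. ennreal (S x u w) * U n w y t (\<lambda>_. 1) \<partial>Q x w)" for w
      proof -
        have "(\<lambda>y. ennreal (S x u w) * U n w y t (\<lambda>_. 1)) \<in> borel_measurable X" for n using x by measurable
        then have "(\<lambda>y. ennreal (S x u w) * U n w y t (\<lambda>_. 1)) \<in> borel_measurable (Q x w)" for n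
          using sets_Q[OF x] by (simp cong: measurable_cong_sets)
        then show ?thesis by (simp add: sum_distrib_left nn_integral_sum)
      qed

      have "(\<lambda>w. (\<integral>\<^sup>+y. ennreal (S x u w) * U n w y t (\<lambda>_. 1) \<partial>Q x w) * indicator {u<..<t} w) \<in> borel_measurable lborel" for n
        using x by measurable
      then show ?thesis
        unfolding U.simps eq sum_distrib_right by (intro nn_integral_sum[symmetric])
    qed
    also have "\<dots> \<le> (\<integral>\<^sup>+w\<in>{u<..<t}. ennreal (r x w * S x u w) \<partial>lborel)"
    proof (intro nn_integral_mono mult_right_mono)
      fix w
      have "(\<integral>\<^sup>+y. ennreal (S x u w) * (\<Sum>n<N. U n w y t (\<lambda>_. 1)) \<partial>Q x w) \<le> (\<integral>\<^sup>+y. ennreal (S x u w) * 1 \<partial>Q x w)"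
        using Suc.IH space_Q[OF x] by (intro nn_integral_mono mult_left_mono) auto
      also have "\<dots> = ennreal (r x w * S x u w)"
        using emeasure_Q_space[OF x, of w] space_Q[OF x] S_pos[of x u w] r_nonneg[of x w]
        by (simp add: ennreal_mult mult.commute)
      finally show "(\<integral>\<^sup>+y. ennreal (S x u w) * (\<Sum>n<N. U n w y t (\<lambda>_. 1)) \<partial>Q x w) \<le> ennreal (r x w * S x u w)" .
    qed simp
    also have "\<dots> = ennreal (1 - S x u t)" by (rule r_S_integral(1)[OF x True])
    finally have "(\<Sum>n<Suc N. U n u x t (\<lambda>_. 1)) \<le> ennreal (S x u t) + ennreal (1 - S x u t)"
      by (simp add: sum.lessThan_Suc_shift del: sum.lessThan_Suc U.simps(2))
    then show ?thesis unfolding S_add_compl .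
  qed
qed simp

section \<open>Linearity and monotone continuity of the iterates\<close>

lemma measurable_Q_cong: "x \<in> space X \<Longrightarrow> borel_measurable (Q x w) = borel_measurable X"
  using sets_Q by (intro measurable_cong_sets) auto

lemma nn_integral_Q_cong:
  "x \<in> space X \<Longrightarrow> (\<And>y. y \<in> space X \<Longrightarrow> f y = g y) \<Longrightarrow> (\<integral>\<^sup>+y. f y \<partial>Q x w) = (\<integral>\<^sup>+y. g y \<partial>Q x w)"
  using space_Q[of x w] by (intro nn_integral_cong) simp

lemma U_cong:
  assumes "x \<in> space X" and "\<And>y. y \<in> space X \<Longrightarrow> f y = g y"
  shows "U n u x t f = U n u x t g"
  using assms(1)
proof (induction n arbitrary: u x)
  case (Suc n)
  have "(\<integral>\<^sup>+y. ennreal (S x u w) * U n w y t f \<partial>Q x w) = (\<integral>\<^sup>+y. ennreal (S x u w) * U n w y t g \<partial>Q x w)" for w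
    by (rule nn_integral_Q_cong[OF Suc.prems]) (simp add: Suc.IH)
  then show ?case by simp
qed (simp add: assms(2))

lemma U_add:
  assumes "x \<in> space X" and [measurable]: "f \<in> borel_measurable X" "g \<in> borel_measurable X"
  shows "U n u x t (\<lambda>y. f y + g y) = U n u x t f + U n u x t g"
  using assms(1)
proof (induction n arbitrary: u x)
  case (Suc n)
  note x = Suc.prems
  have "(\<integral>\<^sup>+y. ennreal (S x u w) * U n w y t (\<lambda>y. f y + g y) \<partial>Q x w) =
      (\<integral>\<^sup>+y. ennreal (S x u w) * U n w y t f \<partial>Q x w) + (\<integral>\<^sup>+y. ennreal (S x u w) * U n w y t g \<partial>Q x w)" for w
  proof -
    have "(\<integral>\<^sup>+y. ennreal (S x u w) * U n w y t (\<lambda>y. f y + g y) \<partial>Q x w) =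
      (\<integral>\<^sup>+y. ennreal (S x u w) * U n w y t f + ennreal (S x u w) * U n w y t g \<partial>Q x w)"
      by (rule nn_integral_Q_cong[OF x]) (simp add: Suc.IH distrib_left)
    also have "\<dots> = (\<integral>\<^sup>+y. ennreal (S x u w) * U n w y t f \<partial>Q x w) + (\<integral>\<^sup>+y. ennreal (S x u w) * U n w y t g \<partial>Q x w)"
      using x by (intro nn_integral_add; simp only: measurable_Q_cong[OF x]; measurable)
    finally show ?thesis .
  qed
  then show ?case
    using x by (simp add: distrib_right) (intro nn_integral_add; measurable)
qed (simp add: distrib_right)

lemma U_cmult:
  assumes "x \<in> space X" and [measurable]: "f \<in> borel_measurable X"
  shows "U n u x t (\<lambda>y. c * f y) = c * U n u x t f"
  using assms(1)
proof (induction n arbitrary: u x)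
  case (Suc n)
  note x = Suc.prems
  have "(\<integral>\<^sup>+y. ennreal (S x u w) * U n w y t (\<lambda>y. c * f y) \<partial>Q x w) =
      c * (\<integral>\<^sup>+y. ennreal (S x u w) * U n w y t f \<partial>Q x w)" for w
  proof -
    have "(\<integral>\<^sup>+y. ennreal (S x u w) * U n w y t (\<lambda>y. c * f y) \<partial>Q x w) =
      (\<integral>\<^sup>+y. c * (ennreal (S x u w) * U n w y t f) \<partial>Q x w)"
      by (rule nn_integral_Q_cong[OF x]) (simp add: Suc.IH mult_ac)
    also have "\<dots> = c * (\<integral>\<^sup>+y. ennreal (S x u w) * U n w y t f \<partial>Q x w)"
      using x by (intro nn_integral_cmult; simp only: measurable_Q_cong[OF x]; measurable)
    finally show ?thesis .
  qed
  then show ?case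
    using x by (simp add: mult.assoc) (intro nn_integral_cmult; measurable)
qed (simp add: mult.assoc)

lemma U_mono:
  assumes "x \<in> space X" and "\<And>y. y \<in> space X \<Longrightarrow> f y \<le> g y"
  shows "U n u x t f \<le> U n u x t g"
  using assms(1)
proof (induction n arbitrary: u x)
  case (Suc n)
  show ?case unfolding U.simps
    using Suc.IH space_Q[OF Suc.prems] by (intro nn_integral_mono mult_right_mono mult_left_mono) auto
qed (simp add: assms(2) mult_right_mono)

text \<open>Together with additivity this makes each iterate behave like an integral of its last
  argument; the countable additivity of \<open>Vm\<close> rests on it.\<close>

lemma U_SUP:
  assumes "x \<in> space X" and [measurable]: "\<And>i::nat. F i \<in> borel_measurable X" and F: "incseq F"
  shows "U n u x t (\<lambda>y. SUP i. F i y) = (SUP i. U n u x t (F i))"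
  using assms(1)
proof (induction n arbitrary: u x)
  case 0
  then show ?case by (simp add: SUP_mult_right_ennreal)
next
  case (Suc n)
  note x = Suc.prems
  have Fm: "F i y \<le> F j y" if "i \<le> j" for i j y using F that by (auto simp: incseq_def le_fun_def)
  have mono: "U n w y t (F i) \<le> U n w y t (F j)" if "i \<le> j" "y \<in> space X" for i j w y
    using Fm that by (intro U_mono) auto
  have "(\<integral>\<^sup>+y. ennreal (S x u w) * U n w y t (\<lambda>y. SUP i. F i y) \<partial>Q x w) =
      (SUP i. \<integral>\<^sup>+y. ennreal (S x u w) * U n w y t (F i) \<partial>Q x w)" for w
  proof -
    have "(\<integral>\<^sup>+y. ennreal (S x u w) * U n w y t (\<lambda>y. SUP i. F i y) \<partial>Q x w) =
      (\<integral>\<^sup>+y. (SUP i. ennreal (S x u w) * U n w y t (F i)) \<partial>Q x w)"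
      by (rule nn_integral_Q_cong[OF x]) (simp add: Suc.IH SUP_mult_left_ennreal)
    also have "\<dots> = (SUP i. \<integral>\<^sup>+y. ennreal (S x u w) * U n w y t (F i) \<partial>Q x w)"
    proof (rule nn_integral_monotone_convergence_SUP_AE)
      show "AE y in Q x w. ennreal (S x u w) * U n w y t (F i) \<le> ennreal (S x u w) * U n w y t (F (Suc i))" for i
        using space_Q[OF x] mono[of i "Suc i"] by (intro AE_I2 mult_left_mono) auto
      show "(\<lambda>y. ennreal (S x u w) * U n w y t (F i)) \<in> borel_measurable (Q x w)" for i
        unfolding measurable_Q_cong[OF x] using x by measurable
    qed
    finally show ?thesis .
  qed
  then have "U (Suc n) u x t (\<lambda>y. SUP i. F i y) =
     (\<integral>\<^sup>+w. (SUP i. (\<integral>\<^sup>+y. ennreal (S x u w) * U n w y t (F i) \<partial>Q x w) * indicator {u<..<t} w) \<partial>lborel)"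
    by (simp add: SUP_mult_right_ennreal)
  also have "\<dots> = (SUP i. U (Suc n) u x t (F i))"
    unfolding U.simps
  proof (rule nn_integral_monotone_convergence_SUP)
    show "incseq (\<lambda>i w. (\<integral>\<^sup>+y. ennreal (S x u w) * U n w y t (F i) \<partial>Q x w) * indicator {u<..<t} w)"
      unfolding incseq_def le_fun_def
      using mono space_Q[OF x] by (intro allI impI mult_right_mono nn_integral_mono mult_left_mono) auto
    show "(\<lambda>w. (\<integral>\<^sup>+y. ennreal (S x u w) * U n w y t (F i) \<partial>Q x w) * indicator {u<..<t} w) \<in> borel_measurable lborel" for i
      using x by measurable
  qed
  finally show ?case .
qed

section \<open>The sum of the iterates as a measure\<close>

definition V :: "real \<Rightarrow> 'a \<Rightarrow> real \<Rightarrow> ('a \<Rightarrow> ennreal) \<Rightarrow> ennreal" where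
  "V u x t g = (\<Sum>n. U n u x t g)"

definition Vm :: "real \<Rightarrow> 'a \<Rightarrow> real \<Rightarrow> 'a measure" where
  "Vm u x t = measure_of (space X) (sets X) (\<lambda>B. V u x t (indicator B))"

lemma measurable_V[measurable (raw)]:
  assumes [measurable]: "(\<lambda>z. g (fst z) (snd z)) \<in> borel_measurable (N \<Otimes>\<^sub>M X)" "fu \<in> borel_measurable N" "fx \<in> N \<rightarrow>\<^sub>M X" "ft \<in> borel_measurable N"
  shows "(\<lambda>a. V (fu a) (fx a) (ft a) (g a)) \<in> borel_measurable N"
  unfolding V_def by measurable

lemma sets_Vm[simp]: "sets (Vm u x t) = sets X" and space_Vm[simp]: "space (Vm u x t) = space X"
  unfolding Vm_def by (simp_all add: sets.sets_measure_of_eq sets.space_measure_of_eq)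

lemma V_add:
  assumes "x \<in> space X" "f \<in> borel_measurable X" "g \<in> borel_measurable X"
  shows "V u x t (\<lambda>y. f y + g y) = V u x t f + V u x t g"
  unfolding V_def U_add[OF assms] by (simp add: suminf_add)

lemma V_SUP:
  assumes "x \<in> space X" and "\<And>i::nat. F i \<in> borel_measurable X" and F: "incseq F"
  shows "V u x t (\<lambda>y. SUP i. F i y) = (SUP i. V u x t (F i))"
  unfolding V_def U_SUP[OF assms]
proof (rule ennreal_suminf_SUP_eq)
  show "incseq (\<lambda>i. U n u x t (F i))" for n
    unfolding incseq_def using F by (intro allI impI U_mono assms(1)) (auto simp: incseq_def le_fun_def)
qed

lemma V_zero: "x \<in> space X \<Longrightarrow> V u x t (\<lambda>_. 0) = 0"
  using U_cmult[of x "\<lambda>_. 0" _ u t 0] by (simp add: V_def)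

lemma emeasure_Vm:
  assumes x: "x \<in> space X" and B: "B \<in> sets X"
  shows "emeasure (Vm u x t) B = V u x t (indicator B)"
proof (rule emeasure_measure_of[OF Vm_def])
  show "countably_additive (sets (Vm u x t)) (\<lambda>B. V u x t (indicator B))"
    unfolding countably_additive_def sets_Vm
  proof (intro allI impI)
    fix A :: "nat \<Rightarrow> 'a set" assume A: "range A \<subseteq> sets X" "disjoint_family A" "\<Union> (range A) \<in> sets X"
    have Am[measurable]: "indicator (A i) \<in> borel_measurable X" for i using A(1) by auto
    have fin: "V u x t (\<lambda>y. \<Sum>i<n. indicator (A i) y) = (\<Sum>i<n. V u x t (indicator (A i)))" for n
    proof (induction n)
      case (Suc n)
      have "(\<lambda>y. \<Sum>i<n. indicator (A i) y :: ennreal) \<in> borel_measurable X" by measurable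
      from V_add[OF x this Am[of n]] show ?case using Suc by simp
    qed (simp add: V_zero[OF x])
    have "(\<lambda>y. SUP n. \<Sum>i<n. indicator (A i) y) = (indicator (\<Union> (range A)) :: 'a \<Rightarrow> ennreal)"
      using suminf_indicator[OF A(2)] by (simp add: suminf_eq_SUP[symmetric] fun_eq_iff)
    then have "V u x t (indicator (\<Union> (range A))) = V u x t (\<lambda>y. SUP n. \<Sum>i<n. indicator (A i) y)" by simp
    also have "\<dots> = (SUP n. V u x t (\<lambda>y. \<Sum>i<n. indicator (A i) y))"
      by (rule V_SUP[OF x]) (auto simp: incseq_def le_fun_def intro!: sum_mono2)
    finally show "(\<Sum>i. V u x t (indicator (A i))) = V u x t (indicator (\<Union> (range A)))"
      unfolding fin by (simp add: suminf_eq_SUP)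
  qed
  show "positive (sets (Vm u x t)) (\<lambda>B. V u x t (indicator B))"
  proof -
    have "indicator {} = (\<lambda>_::'a. 0::ennreal)" by (simp add: fun_eq_iff)
    then show ?thesis using V_zero[OF x, of u t] by (simp add: positive_def)
  qed
qed (use B sets.space_closed in auto)

text \<open>The measure is defined from \<open>V\<close> on indicators. That \<open>V\<close>
  integrates all functions against it lets the last-jump equation, where \<open>G t w g\<close>
  appears, be written as an equation for \<open>Vm\<close>.\<close>

lemma nn_integral_Vm:
  assumes x: "x \<in> space X" and g: "g \<in> borel_measurable X"
  shows "(\<integral>\<^sup>+y. g y \<partial>Vm u x t) = V u x t g"
  using g
proof (induction rule: borel_measurable_induct)
  case (cong f g)
  have "V u x t f = V u x t g" unfolding V_def using cong(3) by (simp add: U_cong[OF x, of f g])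
  moreover have "(\<integral>\<^sup>+y. f y \<partial>Vm u x t) = (\<integral>\<^sup>+y. g y \<partial>Vm u x t)" using cong(3) by (intro nn_integral_cong) simp
  ultimately show ?case using cong(4) by simp
next
  case (set A)
  then show ?case using emeasure_Vm[OF x] by simp
next
  case (mult f c)
  have "V u x t (\<lambda>y. c * f y) = c * V u x t f"
    unfolding V_def using mult(2) by (simp add: U_cmult[OF x])
  then show ?case using mult by (subst nn_integral_cmult) (auto cong: measurable_cong_sets)
next
  case (add f g)
  then show ?case
    by (subst nn_integral_add) (auto simp: V_add[OF x] cong: measurable_cong_sets)
next
  case (seq F)
  have "(\<integral>\<^sup>+y. (SUP i. F i y) \<partial>Vm u x t) = (SUP i. \<integral>\<^sup>+y. F i y \<partial>Vm u x t)"
    using seq by (intro nn_integral_monotone_convergence_SUP) (auto cong: measurable_cong_sets)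
  then show ?case using V_SUP[OF x, of F u t] seq by (simp add: SUP_apply[abs_def] image_comp)
qed

lemma V_one_le: "x \<in> space X \<Longrightarrow> V u x t (\<lambda>_. 1) \<le> 1"
  unfolding V_def suminf_eq_SUP using U_sum_le_1 by (intro SUP_least)

lemma emeasure_Vm_le_1: "x \<in> space X \<Longrightarrow> emeasure (Vm u x t) B \<le> 1"
proof -
  assume x: "x \<in> space X"
  have "emeasure (Vm u x t) B \<le> emeasure (Vm u x t) (space (Vm u x t))" by (rule emeasure_space)
  also have "\<dots> = V u x t (\<lambda>_. 1)" using nn_integral_Vm[OF x, of "\<lambda>_. 1" u t] by simp
  finally show ?thesis using V_one_le[OF x, of u t] by simp
qed

lemma Vm_kernel: "x \<in> space X \<Longrightarrow> finite_kernel borel X (Vm u x)"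
proof -
  assume x: "x \<in> space X"
  have "emeasure (Vm u x w) (space X) < top" for w
    using le_less_trans[OF emeasure_Vm_le_1[OF x] ennreal_one_less_top] .
  then have "finite_measure (Vm u x w)" for w
    by (intro finite_measureI) (simp add: less_top[symmetric])
  moreover have "(\<lambda>w. emeasure (Vm u x w) B) \<in> borel_measurable borel" if "B \<in> sets X" for B
    unfolding emeasure_Vm[OF x that] using x that by measurable
  ultimately show ?thesis unfolding finite_kernel_def by simp
qed

text \<open>This is \<open>U_forward\<close> summed over all iterates, with the term 0 split off;
  the shift of the index turns the series under the integral into \<open>V\<close> again.\<close>

lemma Vm_mild:
  assumes x: "x \<in> space X" and g[measurable]: "g \<in> borel_measurable X"
  shows "(\<integral>\<^sup>+y. g y \<partial>Vm u x t) = g x * ennreal (S x u t) + (\<integral>\<^sup>+w\<in>{u<..<t}. (\<integral>\<^sup>+y. G t w g y \<partial>Vm u x w) \<partial>lborel)"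
proof -
  have "V u x t g = (\<Sum>n. U (Suc n) u x t g) + U 0 u x t g"
    unfolding V_def by (rule sums_unique[OF sums_Suc[OF summable_sums[OF summableI]], symmetric])
  also have "(\<Sum>n. U (Suc n) u x t g) = (\<Sum>n. \<integral>\<^sup>+w\<in>{u<..<t}. U n u x w (G t w g) \<partial>lborel)"
    unfolding U_forward[OF x g] ..
  also have "\<dots> = (\<integral>\<^sup>+w. (\<Sum>n. U n u x w (G t w g) * indicator {u<..<t} w) \<partial>lborel)"
    using x by (intro nn_integral_suminf[symmetric]) measurable
  also have "\<dots> = (\<integral>\<^sup>+w\<in>{u<..<t}. V u x w (G t w g) \<partial>lborel)"
    by (simp add: V_def)
  also have "\<dots> = (\<integral>\<^sup>+w\<in>{u<..<t}. (\<integral>\<^sup>+y. G t w g y \<partial>Vm u x w) \<partial>lborel)"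
    using nn_integral_Vm[OF x, of "G t _ g" u] by (simp add: measurable_G)
  finally show ?thesis unfolding nn_integral_Vm[OF x g] by (simp add: add.commute)
qed

section \<open>From the last-jump equation to the integrated equation and back\<close>

lemma Q_Fubini:
  fixes k :: "'a \<Rightarrow> real \<Rightarrow> ennreal"
  assumes y: "y \<in> space X" and k[measurable]: "(\<lambda>z. k (fst z) (snd z)) \<in> borel_measurable (X \<Otimes>\<^sub>M borel)"
  shows "(\<integral>\<^sup>+v\<in>{w<..<t}. (\<integral>\<^sup>+z. k z v \<partial>Q y w') \<partial>lborel) = (\<integral>\<^sup>+z. (\<integral>\<^sup>+v\<in>{w<..<t}. k z v \<partial>lborel) \<partial>Q y w')"
proof -
  note [measurable (raw)] = measurable_uncurry2[OF k]
  interpret Qf: finite_measure "Q y w'" by (rule finite_Q[OF y])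
  interpret pair_sigma_finite "Q y w'" "lborel :: real measure" by unfold_locales
  have km: "(\<lambda>z. k z v) \<in> borel_measurable (Q y w')" for v
    unfolding measurable_Q_cong[OF y] by measurable
  have "(\<integral>\<^sup>+v\<in>{w<..<t}. (\<integral>\<^sup>+z. k z v \<partial>Q y w') \<partial>lborel) = (\<integral>\<^sup>+v. (\<integral>\<^sup>+z. k z v * indicator {w<..<t} v \<partial>Q y w') \<partial>lborel)"
    using km by (simp add: nn_integral_multc)
  also have "\<dots> = (\<integral>\<^sup>+z. (\<integral>\<^sup>+v\<in>{w<..<t}. k z v \<partial>lborel) \<partial>Q y w')"
  proof (rule Fubini')
    have "(\<lambda>z. k (fst z) (snd z) * indicator {w<..<t} (snd z)) \<in> borel_measurable (X \<Otimes>\<^sub>M borel)" by measurable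
    then show "(\<lambda>(z, v). k z v * indicator {w<..<t} v) \<in> borel_measurable (Q y w' \<Otimes>\<^sub>M lborel)"
      using sets_Q[OF y] by (simp add: case_prod_beta' cong: measurable_cong_sets sets_pair_measure_cong)
  qed
  finally show ?thesis .
qed

lemma r_S_integral_cmult:
  assumes x: "x \<in> space X" and ut: "u \<le> t"
  shows "(\<integral>\<^sup>+w\<in>{u<..<t}. c * ennreal (r x w * S x u w) \<partial>lborel) = c * ennreal (1 - S x u t)"
    and "(\<integral>\<^sup>+w\<in>{u<..<t}. c * ennreal (r x w * S x w t) \<partial>lborel) = c * ennreal (1 - S x u t)"
proof -
  have "(\<lambda>w. ennreal (r x w * S x u w) * indicator {u<..<t} w) \<in> borel_measurable lborel" using x by measurable
  from nn_integral_cmult[OF this, of c]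
  show "(\<integral>\<^sup>+w\<in>{u<..<t}. c * ennreal (r x w * S x u w) \<partial>lborel) = c * ennreal (1 - S x u t)"
    using r_S_integral(1)[OF x ut] by (simp add: mult.assoc)
  have "(\<lambda>w. ennreal (r x w * S x w t) * indicator {u<..<t} w) \<in> borel_measurable lborel" using x by measurable
  from nn_integral_cmult[OF this, of c]
  show "(\<integral>\<^sup>+w\<in>{u<..<t}. c * ennreal (r x w * S x w t) \<partial>lborel) = c * ennreal (1 - S x u t)"
    using r_S_integral(2)[OF x ut] by (simp add: mult.assoc)
qed

lemma S_compl_split: "c = c * ennreal (S x u t) + c * ennreal (1 - S x u t)"
  using S_add_compl[of x u t] by (metis distrib_left mult.right_neutral)

text \<open>What arrives by a jump at \<open>w\<close> either survives in its state until
  \<open>t\<close> or leaves it before.\<close>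

lemma G_compl:
  assumes y: "y \<in> space X" and [measurable]: "g \<in> borel_measurable X"
  shows "(\<integral>\<^sup>+z. g z \<partial>Q y w) = G t w g y + (\<integral>\<^sup>+z. g z * ennreal (1 - S z w t) \<partial>Q y w)"
proof -
  have "(\<integral>\<^sup>+z. g z \<partial>Q y w) = (\<integral>\<^sup>+z. ennreal (S z w t) * g z + g z * ennreal (1 - S z w t) \<partial>Q y w)"
    using S_compl_split by (intro nn_integral_cong) (simp add: mult.commute)
  also have "\<dots> = G t w g y + (\<integral>\<^sup>+z. g z * ennreal (1 - S z w t) \<partial>Q y w)"
    unfolding G_def by (intro nn_integral_add; simp only: measurable_Q_cong[OF y]; measurable)
  finally show ?thesis .
qed

text \<open>The kernel property is a premise, so that it can be supplied to the measurability prover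
  as a declared fact wherever a family is fixed.\<close>

lemma measurable_nn_integral_family[measurable (raw)]:
  fixes k :: "'b \<Rightarrow> 'a \<Rightarrow> ennreal"
  assumes "finite_kernel borel X \<mu>" "(\<lambda>z. k (fst z) (snd z)) \<in> borel_measurable (N \<Otimes>\<^sub>M X)" "h \<in> borel_measurable N"
  shows "(\<lambda>a. \<integral>\<^sup>+z. k a z \<partial>\<mu> (h a)) \<in> borel_measurable N"
  using measurable_nn_integral_kernel_comp[OF assms(1,3,2)] by simp

context
  fixes \<mu> :: "real \<Rightarrow> 'a measure" and u :: real and x :: 'a
  assumes \<mu>: "finite_kernel borel X \<mu>" and x: "x \<in> space X"
begin

lemma sets_mu: "sets (\<mu> w) = sets X" and space_mu: "space (\<mu> w) = space X"
  using finite_kernelD[OF \<mu>] by auto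

lemma measurable_mu_cong: "borel_measurable (\<mu> w) = borel_measurable X"
  using sets_mu by (intro measurable_cong_sets) auto

lemma nn_integral_mu_cong: "(\<And>y. y \<in> space X \<Longrightarrow> f y = g y) \<Longrightarrow> (\<integral>\<^sup>+y. f y \<partial>\<mu> w) = (\<integral>\<^sup>+y. g y \<partial>\<mu> w)"
  using space_mu[of w] by (intro nn_integral_cong) simp

text \<open>The last-jump equation for \<open>g * r\<close> at every time \<open>v\<close> before
  \<open>t\<close> expresses the loss. Integrated over \<open>v\<close>, the densities
  \<open>r * S\<close> add up to the factors \<open>1 - S\<close>, and these complete the factors
  \<open>S\<close> in the last-jump equation for \<open>g\<close> at time \<open>t\<close>.\<close>

lemma mild_imp_integrated:
  assumes ut: "u < t" and g[measurable]: "g \<in> borel_measurable X"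
    and mild: "\<And>v f. u < v \<Longrightarrow> v \<le> t \<Longrightarrow> f \<in> borel_measurable X \<Longrightarrow>
      (\<integral>\<^sup>+y. f y \<partial>\<mu> v) = f x * ennreal (S x u v) + (\<integral>\<^sup>+w\<in>{u<..<v}. (\<integral>\<^sup>+y. G v w f y \<partial>\<mu> w) \<partial>lborel)"
  shows "(\<integral>\<^sup>+y. g y \<partial>\<mu> t) + (\<integral>\<^sup>+v\<in>{u<..<t}. (\<integral>\<^sup>+y. g y * ennreal (r y v) \<partial>\<mu> v) \<partial>lborel) =
    g x + (\<integral>\<^sup>+w\<in>{u<..<t}. (\<integral>\<^sup>+y. (\<integral>\<^sup>+z. g z \<partial>Q y w) \<partial>\<mu> w) \<partial>lborel)"
proof -
  note [measurable] = \<mu> x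
  define h where "h w y v = G v w (\<lambda>z. g z * ennreal (r z v)) y" for w y v
  have hm: "(\<lambda>z. h (fst z) (fst (snd z)) (snd (snd z))) \<in> borel_measurable (borel \<Otimes>\<^sub>M X \<Otimes>\<^sub>M borel)"
    unfolding h_def by measurable
  note [measurable (raw)] = measurable_uncurry3[OF hm]
  \<comment> \<open>The counterpart of \<open>G t w g\<close>: arrivals by a jump at
    \<open>w\<close> that leave their new state before \<open>t\<close>.\<close>
  define H where "H w y = (\<integral>\<^sup>+z. g z * ennreal (1 - S z w t) \<partial>Q y w)" for w y
  have Hm: "(\<lambda>z. H (fst z) (snd z)) \<in> borel_measurable (borel \<Otimes>\<^sub>M X)" unfolding H_def by measurable
  note [measurable (raw)] = measurable_uncurry2[OF Hm]
  have [measurable]: "H w \<in> borel_measurable X" for w unfolding H_def by measurable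
  have "(\<integral>\<^sup>+v\<in>{u<..<t}. (\<integral>\<^sup>+y. g y * ennreal (r y v) \<partial>\<mu> v) \<partial>lborel) =
    (\<integral>\<^sup>+v\<in>{u<..<t}. g x * ennreal (r x v * S x u v) + (\<integral>\<^sup>+w\<in>{u<..<v}. (\<integral>\<^sup>+y. h w y v \<partial>\<mu> w) \<partial>lborel) \<partial>lborel)"
  proof (rule nn_integral_set_cong)
    fix v assume v: "u < v" "v < t"
    have "(\<lambda>y. g y * ennreal (r y v)) \<in> borel_measurable X" by measurable
    from mild[OF v(1) less_imp_le[OF v(2)] this]
    show "(\<integral>\<^sup>+y. g y * ennreal (r y v) \<partial>\<mu> v) =
        g x * ennreal (r x v * S x u v) + (\<integral>\<^sup>+w\<in>{u<..<v}. (\<integral>\<^sup>+y. h w y v \<partial>\<mu> w) \<partial>lborel)"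
      unfolding h_def using r_nonneg less_imp_le[OF S_pos] by (simp add: ennreal_mult mult.assoc)
  qed
  also have "\<dots> = (\<integral>\<^sup>+v\<in>{u<..<t}. g x * ennreal (r x v * S x u v) \<partial>lborel) +
      (\<integral>\<^sup>+v\<in>{u<..<t}. (\<integral>\<^sup>+w\<in>{u<..<v}. (\<integral>\<^sup>+y. h w y v \<partial>\<mu> w) \<partial>lborel) \<partial>lborel)"
  proof (rule nn_integral_set_add)
    show "(\<lambda>v. \<integral>\<^sup>+w\<in>{u<..<v}. (\<integral>\<^sup>+y. h w y v \<partial>\<mu> w) \<partial>lborel) \<in> borel_measurable borel"
    proof (rule lborel.borel_measurable_nn_integral)
      have "(\<lambda>z. (\<integral>\<^sup>+y. h (snd z) y (fst z) \<partial>\<mu> (snd z)) * (if u < snd z \<and> snd z < fst z then 1 else 0)) \<in> borel_measurable (borel \<Otimes>\<^sub>M borel)"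
        by measurable
      then show "(\<lambda>(v, w). (\<integral>\<^sup>+y. h w y v \<partial>\<mu> w) * indicator {u<..<v} w) \<in> borel_measurable (borel \<Otimes>\<^sub>M lborel)"
        by (simp add: case_prod_beta' indicator_def of_bool_def cong: measurable_cong_sets sets_pair_measure_cong)
    qed
  qed measurable
  also have "(\<integral>\<^sup>+v\<in>{u<..<t}. g x * ennreal (r x v * S x u v) \<partial>lborel) = g x * ennreal (1 - S x u t)"
    using ut by (intro r_S_integral_cmult x) simp
  also have "(\<integral>\<^sup>+v\<in>{u<..<t}. (\<integral>\<^sup>+w\<in>{u<..<v}. (\<integral>\<^sup>+y. h w y v \<partial>\<mu> w) \<partial>lborel) \<partial>lborel) =
      (\<integral>\<^sup>+w\<in>{u<..<t}. (\<integral>\<^sup>+y. (\<integral>\<^sup>+v\<in>{w<..<t}. h w y v \<partial>lborel) \<partial>\<mu> w) \<partial>lborel)"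
    by (rule nn_integral_kernel_swap[OF \<mu>, symmetric]) (simp add: case_prod_beta', measurable)
  also have "\<dots> = (\<integral>\<^sup>+w\<in>{u<..<t}. (\<integral>\<^sup>+y. H w y \<partial>\<mu> w) \<partial>lborel)"
  proof (intro nn_integral_set_cong nn_integral_mu_cong)
    fix w y assume w: "w < t" and y: "y \<in> space X"
    have "(\<integral>\<^sup>+v\<in>{w<..<t}. h w y v \<partial>lborel) = (\<integral>\<^sup>+v\<in>{w<..<t}. (\<integral>\<^sup>+z. g z * ennreal (r z v * S z w v) \<partial>Q y w) \<partial>lborel)"
      unfolding h_def G_def using r_nonneg less_imp_le[OF S_pos] by (simp add: ennreal_mult mult_ac)
    also have "\<dots> = (\<integral>\<^sup>+z. (\<integral>\<^sup>+v\<in>{w<..<t}. g z * ennreal (r z v * S z w v) \<partial>lborel) \<partial>Q y w)"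
      by (rule Q_Fubini[OF y]) measurable
    also have "\<dots> = H w y"
      unfolding H_def using w by (intro nn_integral_Q_cong[OF y] r_S_integral_cmult) auto
    finally show "(\<integral>\<^sup>+v\<in>{w<..<t}. h w y v \<partial>lborel) = H w y" .
  qed
  finally have I: "(\<integral>\<^sup>+v\<in>{u<..<t}. (\<integral>\<^sup>+y. g y * ennreal (r y v) \<partial>\<mu> v) \<partial>lborel) =
      g x * ennreal (1 - S x u t) + (\<integral>\<^sup>+w\<in>{u<..<t}. (\<integral>\<^sup>+y. H w y \<partial>\<mu> w) \<partial>lborel)" .
  have J: "(\<integral>\<^sup>+w\<in>{u<..<t}. (\<integral>\<^sup>+y. (\<integral>\<^sup>+z. g z \<partial>Q y w) \<partial>\<mu> w) \<partial>lborel) =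
      (\<integral>\<^sup>+w\<in>{u<..<t}. (\<integral>\<^sup>+y. G t w g y \<partial>\<mu> w) \<partial>lborel) + (\<integral>\<^sup>+w\<in>{u<..<t}. (\<integral>\<^sup>+y. H w y \<partial>\<mu> w) \<partial>lborel)"
  proof -
    have "(\<integral>\<^sup>+y. (\<integral>\<^sup>+z. g z \<partial>Q y w) \<partial>\<mu> w) = (\<integral>\<^sup>+y. G t w g y \<partial>\<mu> w) + (\<integral>\<^sup>+y. H w y \<partial>\<mu> w)" for w
    proof -
      have "(\<integral>\<^sup>+y. (\<integral>\<^sup>+z. g z \<partial>Q y w) \<partial>\<mu> w) = (\<integral>\<^sup>+y. G t w g y + H w y \<partial>\<mu> w)"
        unfolding H_def by (intro nn_integral_mu_cong G_compl g)
      also have "\<dots> = (\<integral>\<^sup>+y. G t w g y \<partial>\<mu> w) + (\<integral>\<^sup>+y. H w y \<partial>\<mu> w)"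
        by (intro nn_integral_add; simp only: measurable_mu_cong; measurable)
      finally show ?thesis .
    qed
    then show ?thesis by (simp only:) (rule nn_integral_set_add; measurable)
  qed
  show ?thesis
    unfolding I J mild[OF ut order_refl g] using S_compl_split[of "g x" x u t] by (simp add: ac_simps)
qed

text \<open>The hypothesis for \<open>f = 1\<^sub>C(y) r(y, v) S(y, v, t)\<close>, integrated over \<open>v\<close>, cancels the loss term.\<close>

lemma integrated_imp_mild:
  assumes ut: "u < t" and C: "C \<in> sets X"
    and int: "\<And>v f. u < v \<Longrightarrow> v \<le> t \<Longrightarrow> f \<in> borel_measurable X \<Longrightarrow> (\<And>y. y \<notin> C \<Longrightarrow> f y = 0) \<Longrightarrow>
      (\<integral>\<^sup>+y. f y \<partial>\<mu> v) + (\<integral>\<^sup>+w\<in>{u<..<v}. (\<integral>\<^sup>+y. f y * ennreal (r y w) \<partial>\<mu> w) \<partial>lborel) =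
      f x + (\<integral>\<^sup>+w\<in>{u<..<v}. (\<integral>\<^sup>+y. (\<integral>\<^sup>+z. f z \<partial>Q y w) \<partial>\<mu> w) \<partial>lborel)"
    and fin: "(\<integral>\<^sup>+w\<in>{u<..<t}. (\<integral>\<^sup>+y. indicator C y * ennreal (r y w) \<partial>\<mu> w) \<partial>lborel) < \<infinity>"
  shows "emeasure (\<mu> t) C = indicator C x * ennreal (S x u t) +
    (\<integral>\<^sup>+w\<in>{u<..<t}. (\<integral>\<^sup>+y. G t w (indicator C) y \<partial>\<mu> w) \<partial>lborel)"
proof -
  note [measurable] = \<mu> x C
  define g :: "'a \<Rightarrow> ennreal" where "g = indicator C"
  have gm[measurable]: "g \<in> borel_measurable X" unfolding g_def by measurable
  define f where "f v z = g z * ennreal (r z v * S z v t)" for v z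
  have fm: "(\<lambda>z. f (fst z) (snd z)) \<in> borel_measurable (borel \<Otimes>\<^sub>M X)" unfolding f_def by measurable
  note [measurable (raw)] = measurable_uncurry2[OF fm]
  have [measurable]: "f v \<in> borel_measurable X" for v unfolding f_def by measurable
  have f0: "f v y = 0" if "y \<notin> C" for v y using that unfolding f_def g_def by simp
  define H where "H w y = (\<integral>\<^sup>+z. g z * ennreal (1 - S z w t) \<partial>Q y w)" for w y
  have Hm: "(\<lambda>z. H (fst z) (snd z)) \<in> borel_measurable (borel \<Otimes>\<^sub>M X)" unfolding H_def by measurable
  note [measurable (raw)] = measurable_uncurry2[OF Hm]
  have [measurable]: "H w \<in> borel_measurable X" for w unfolding H_def by measurable
  define I where "I = (\<integral>\<^sup>+w\<in>{u<..<t}. (\<integral>\<^sup>+y. g y * ennreal (r y w) \<partial>\<mu> w) \<partial>lborel)"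
  define b where "b = (\<integral>\<^sup>+w\<in>{u<..<t}. (\<integral>\<^sup>+y. H w y \<partial>\<mu> w) \<partial>lborel)"
  have inner: "(\<lambda>v. \<integral>\<^sup>+w\<in>{u<..<v}. (\<integral>\<^sup>+y. k w y v \<partial>\<mu> w) \<partial>lborel) \<in> borel_measurable borel"
    if k: "(\<lambda>z. k (fst z) (fst (snd z)) (snd (snd z))) \<in> borel_measurable (borel \<Otimes>\<^sub>M X \<Otimes>\<^sub>M borel)" for k :: "real \<Rightarrow> 'a \<Rightarrow> real \<Rightarrow> ennreal"
  proof (rule lborel.borel_measurable_nn_integral)
    note [measurable (raw)] = measurable_uncurry3[OF k]
    have "(\<lambda>z. (\<integral>\<^sup>+y. k (snd z) y (fst z) \<partial>\<mu> (snd z)) * (if u < snd z \<and> snd z < fst z then 1 else 0)) \<in> borel_measurable (borel \<Otimes>\<^sub>M borel)"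
      by measurable
    then show "(\<lambda>(v, w). (\<integral>\<^sup>+y. k w y v \<partial>\<mu> w) * indicator {u<..<v} w) \<in> borel_measurable (borel \<Otimes>\<^sub>M lborel)"
      by (simp add: case_prod_beta' indicator_def of_bool_def cong: measurable_cong_sets sets_pair_measure_cong)
  qed
  have "(\<integral>\<^sup>+v\<in>{u<..<t}. (\<integral>\<^sup>+y. f v y \<partial>\<mu> v) \<partial>lborel) +
      (\<integral>\<^sup>+v\<in>{u<..<t}. (\<integral>\<^sup>+w\<in>{u<..<v}. (\<integral>\<^sup>+y. f v y * ennreal (r y w) \<partial>\<mu> w) \<partial>lborel) \<partial>lborel) =
      (\<integral>\<^sup>+v\<in>{u<..<t}. (\<integral>\<^sup>+y. f v y \<partial>\<mu> v) + (\<integral>\<^sup>+w\<in>{u<..<v}. (\<integral>\<^sup>+y. f v y * ennreal (r y w) \<partial>\<mu> w) \<partial>lborel) \<partial>lborel)"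
  proof (rule nn_integral_set_add[symmetric])
    show "(\<lambda>v. \<integral>\<^sup>+y. f v y \<partial>\<mu> v) \<in> borel_measurable borel"
      by measurable
    show "(\<lambda>v. \<integral>\<^sup>+w\<in>{u<..<v}. (\<integral>\<^sup>+y. f v y * ennreal (r y w) \<partial>\<mu> w) \<partial>lborel) \<in> borel_measurable borel"
      by (rule inner) measurable
  qed
  also have "\<dots> = (\<integral>\<^sup>+v\<in>{u<..<t}. f v x + (\<integral>\<^sup>+w\<in>{u<..<v}. (\<integral>\<^sup>+y. (\<integral>\<^sup>+z. f v z \<partial>Q y w) \<partial>\<mu> w) \<partial>lborel) \<partial>lborel)"
    by (intro nn_integral_set_cong int) (auto simp: f0)
  also have "\<dots> = (\<integral>\<^sup>+v\<in>{u<..<t}. f v x \<partial>lborel) +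
      (\<integral>\<^sup>+v\<in>{u<..<t}. (\<integral>\<^sup>+w\<in>{u<..<v}. (\<integral>\<^sup>+y. (\<integral>\<^sup>+z. f v z \<partial>Q y w) \<partial>\<mu> w) \<partial>lborel) \<partial>lborel)"
  proof (rule nn_integral_set_add)
    show "(\<lambda>v. f v x) \<in> borel_measurable borel"
      by measurable
    show "(\<lambda>v. \<integral>\<^sup>+w\<in>{u<..<v}. (\<integral>\<^sup>+y. (\<integral>\<^sup>+z. f v z \<partial>Q y w) \<partial>\<mu> w) \<partial>lborel) \<in> borel_measurable borel"
      by (rule inner) measurable
  qed
  also have "(\<integral>\<^sup>+v\<in>{u<..<t}. f v x \<partial>lborel) = g x * ennreal (1 - S x u t)"
    unfolding f_def using ut by (intro r_S_integral_cmult x) simp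
  also have "(\<integral>\<^sup>+v\<in>{u<..<t}. (\<integral>\<^sup>+w\<in>{u<..<v}. (\<integral>\<^sup>+y. (\<integral>\<^sup>+z. f v z \<partial>Q y w) \<partial>\<mu> w) \<partial>lborel) \<partial>lborel) =
      (\<integral>\<^sup>+w\<in>{u<..<t}. (\<integral>\<^sup>+y. (\<integral>\<^sup>+v\<in>{w<..<t}. (\<integral>\<^sup>+z. f v z \<partial>Q y w) \<partial>lborel) \<partial>\<mu> w) \<partial>lborel)"
    by (rule nn_integral_kernel_swap[OF \<mu>, symmetric]) (simp add: case_prod_beta', measurable)
  also have "\<dots> = b"
    unfolding b_def
  proof (intro nn_integral_set_cong nn_integral_mu_cong)
    fix w y assume w: "w < t" and y: "y \<in> space X"
    have "(\<integral>\<^sup>+v\<in>{w<..<t}. (\<integral>\<^sup>+z. f v z \<partial>Q y w) \<partial>lborel) = (\<integral>\<^sup>+z. (\<integral>\<^sup>+v\<in>{w<..<t}. f v z \<partial>lborel) \<partial>Q y w)"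
      by (rule Q_Fubini[OF y]) measurable
    also have "\<dots> = H w y"
      unfolding H_def f_def using w by (intro nn_integral_Q_cong[OF y] r_S_integral_cmult) auto
    finally show "(\<integral>\<^sup>+v\<in>{w<..<t}. (\<integral>\<^sup>+z. f v z \<partial>Q y w) \<partial>lborel) = H w y" .
  qed
  also have "(\<integral>\<^sup>+v\<in>{u<..<t}. (\<integral>\<^sup>+w\<in>{u<..<v}. (\<integral>\<^sup>+y. f v y * ennreal (r y w) \<partial>\<mu> w) \<partial>lborel) \<partial>lborel) =
      (\<integral>\<^sup>+w\<in>{u<..<t}. (\<integral>\<^sup>+y. (\<integral>\<^sup>+v\<in>{w<..<t}. f v y * ennreal (r y w) \<partial>lborel) \<partial>\<mu> w) \<partial>lborel)"
    by (rule nn_integral_kernel_swap[OF \<mu>, symmetric]) (simp add: case_prod_beta', measurable)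
  also have "\<dots> = (\<integral>\<^sup>+w\<in>{u<..<t}. (\<integral>\<^sup>+y. g y * ennreal (r y w) * ennreal (1 - S y w t) \<partial>\<mu> w) \<partial>lborel)"
  proof (intro nn_integral_set_cong nn_integral_mu_cong)
    fix w y assume w: "w < t" and y: "y \<in> space X"
    have "(\<integral>\<^sup>+v\<in>{w<..<t}. f v y * ennreal (r y w) \<partial>lborel) =
        (\<integral>\<^sup>+v\<in>{w<..<t}. (g y * ennreal (r y w)) * ennreal (r y v * S y v t) \<partial>lborel)"
      unfolding f_def by (simp add: mult_ac)
    also have "\<dots> = g y * ennreal (r y w) * ennreal (1 - S y w t)"
      using w by (intro r_S_integral_cmult y) simp
    finally show "(\<integral>\<^sup>+v\<in>{w<..<t}. f v y * ennreal (r y w) \<partial>lborel) = g y * ennreal (r y w) * ennreal (1 - S y w t)" .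
  qed
  \<comment> \<open>The two parts of the left side carry the factors \<open>S\<close> and
    \<open>1 - S\<close> at the same rate, so together they are the whole loss integral
    \<open>I\<close>.\<close>
  also have "(\<integral>\<^sup>+v\<in>{u<..<t}. (\<integral>\<^sup>+y. f v y \<partial>\<mu> v) \<partial>lborel) + \<dots> =
     (\<integral>\<^sup>+v\<in>{u<..<t}. (\<integral>\<^sup>+y. f v y \<partial>\<mu> v) + (\<integral>\<^sup>+y. g y * ennreal (r y v) * ennreal (1 - S y v t) \<partial>\<mu> v) \<partial>lborel)"
    by (rule nn_integral_set_add[symmetric]) measurable
  also have "\<dots> = I"
    unfolding I_def
  proof (rule nn_integral_set_cong)
    fix v
    have "(\<integral>\<^sup>+y. g y * ennreal (r y v) \<partial>\<mu> v) = (\<integral>\<^sup>+y. f v y + g y * ennreal (r y v) * ennreal (1 - S y v t) \<partial>\<mu> v)"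
      unfolding f_def using r_nonneg less_imp_le[OF S_pos] S_compl_split[of "g _ * ennreal (r _ v)" _ v t]
      by (intro nn_integral_cong) (simp add: ennreal_mult mult.assoc)
    also have "\<dots> = (\<integral>\<^sup>+y. f v y \<partial>\<mu> v) + (\<integral>\<^sup>+y. g y * ennreal (r y v) * ennreal (1 - S y v t) \<partial>\<mu> v)"
      by (intro nn_integral_add; simp only: measurable_mu_cong; measurable)
    finally show "(\<integral>\<^sup>+y. f v y \<partial>\<mu> v) + (\<integral>\<^sup>+y. g y * ennreal (r y v) * ennreal (1 - S y v t) \<partial>\<mu> v) =
        (\<integral>\<^sup>+y. g y * ennreal (r y v) \<partial>\<mu> v)" by simp
  qed
  finally have Ieq: "I = g x * ennreal (1 - S x u t) + b" .
  have J: "(\<integral>\<^sup>+w\<in>{u<..<t}. (\<integral>\<^sup>+y. (\<integral>\<^sup>+z. g z \<partial>Q y w) \<partial>\<mu> w) \<partial>lborel) =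
      (\<integral>\<^sup>+w\<in>{u<..<t}. (\<integral>\<^sup>+y. G t w g y \<partial>\<mu> w) \<partial>lborel) + b"
  proof -
    have "(\<integral>\<^sup>+y. (\<integral>\<^sup>+z. g z \<partial>Q y w) \<partial>\<mu> w) = (\<integral>\<^sup>+y. G t w g y \<partial>\<mu> w) + (\<integral>\<^sup>+y. H w y \<partial>\<mu> w)" for w
    proof -
      have "(\<integral>\<^sup>+y. (\<integral>\<^sup>+z. g z \<partial>Q y w) \<partial>\<mu> w) = (\<integral>\<^sup>+y. G t w g y + H w y \<partial>\<mu> w)"
        unfolding H_def by (intro nn_integral_mu_cong G_compl gm)
      also have "\<dots> = (\<integral>\<^sup>+y. G t w g y \<partial>\<mu> w) + (\<integral>\<^sup>+y. H w y \<partial>\<mu> w)"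
        by (intro nn_integral_add; simp only: measurable_mu_cong; measurable)
      finally show ?thesis .
    qed
    then show ?thesis unfolding b_def by (simp only:) (rule nn_integral_set_add; measurable)
  qed
  have "(\<integral>\<^sup>+y. g y \<partial>\<mu> t) + I = g x + (\<integral>\<^sup>+w\<in>{u<..<t}. (\<integral>\<^sup>+y. (\<integral>\<^sup>+z. g z \<partial>Q y w) \<partial>\<mu> w) \<partial>lborel)"
    unfolding I_def by (rule int[OF ut order_refl gm]) (simp add: g_def)
  also have "\<dots> = (g x * ennreal (S x u t) + g x * ennreal (1 - S x u t)) +
      ((\<integral>\<^sup>+w\<in>{u<..<t}. (\<integral>\<^sup>+y. G t w g y \<partial>\<mu> w) \<partial>lborel) + b)"
    unfolding J using S_compl_split[of "g x" x u t] by simp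
  also have "\<dots> = (g x * ennreal (S x u t) + (\<integral>\<^sup>+w\<in>{u<..<t}. (\<integral>\<^sup>+y. G t w g y \<partial>\<mu> w) \<partial>lborel)) + I"
    unfolding Ieq by (simp add: ac_simps)
  \<comment> \<open>\<open>I\<close> stands on both sides and is cancelled; this is where its
    finiteness \<open>fin\<close> enters.\<close>
  finally have "(\<integral>\<^sup>+y. g y \<partial>\<mu> t) = g x * ennreal (S x u t) + (\<integral>\<^sup>+w\<in>{u<..<t}. (\<integral>\<^sup>+y. G t w g y \<partial>\<mu> w) \<partial>lborel)"
    using fin unfolding I_def g_def by (auto simp: ennreal_add_left_cancel add.commute)
  then show ?thesis unfolding g_def using C sets_mu by simp
qed

end

lemma Vm_integrated:
  assumes x: "x \<in> space X" and ut: "u < t" and g: "g \<in> borel_measurable X"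
  shows "(\<integral>\<^sup>+y. g y \<partial>Vm u x t) + (\<integral>\<^sup>+v\<in>{u<..<t}. (\<integral>\<^sup>+y. g y * ennreal (r y v) \<partial>Vm u x v) \<partial>lborel) =
    g x + (\<integral>\<^sup>+w\<in>{u<..<t}. (\<integral>\<^sup>+y. (\<integral>\<^sup>+z. g z \<partial>Q y w) \<partial>Vm u x w) \<partial>lborel)"
  by (rule mild_imp_integrated[OF Vm_kernel[OF x] x ut g]) (rule Vm_mild[OF x])

section \<open>Passage from bounded sets to functions, and minimality\<close>

context
  fixes \<mu> :: "real \<Rightarrow> 'a measure" and u :: real and x :: 'a
  assumes \<mu>: "finite_kernel borel X \<mu>" and x: "x \<in> space X"
begin

text \<open>The forward equation speaks of sets, but \<open>integrated_imp_mild\<close> applies it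
  to functions that are no indicators. Both sides are linear and continuous along increasing
  sequences; the induction is run for \<open>f * indicator C\<close>, which makes sense of the claim
  for every measurable \<open>f\<close>.\<close>

lemma integrated_extend:
  assumes C: "C \<in> sets X"
    and ind: "\<And>A. A \<in> sets X \<Longrightarrow> A \<subseteq> C \<Longrightarrow>
      emeasure (\<mu> t) A + (\<integral>\<^sup>+w\<in>{u<..<t}. (\<integral>\<^sup>+y. indicator A y * ennreal (r y w) \<partial>\<mu> w) \<partial>lborel) =
      indicator A x + (\<integral>\<^sup>+w\<in>{u<..<t}. (\<integral>\<^sup>+y. emeasure (Q y w) A \<partial>\<mu> w) \<partial>lborel)"
    and f: "f \<in> borel_measurable X" and f0: "\<And>y. y \<notin> C \<Longrightarrow> f y = 0"
  shows "(\<integral>\<^sup>+y. f y \<partial>\<mu> t) + (\<integral>\<^sup>+w\<in>{u<..<t}. (\<integral>\<^sup>+y. f y * ennreal (r y w) \<partial>\<mu> w) \<partial>lborel) =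
      f x + (\<integral>\<^sup>+w\<in>{u<..<t}. (\<integral>\<^sup>+y. (\<integral>\<^sup>+z. f z \<partial>Q y w) \<partial>\<mu> w) \<partial>lborel)"
proof -
  note [measurable] = \<mu> C
  note mc = measurable_mu_cong[OF \<mu> x] and ic = nn_integral_mu_cong[OF \<mu> x]
  define L where "L f = (\<integral>\<^sup>+y. f y \<partial>\<mu> t) + (\<integral>\<^sup>+w\<in>{u<..<t}. (\<integral>\<^sup>+y. f y * ennreal (r y w) \<partial>\<mu> w) \<partial>lborel)" for f
  define R where "R f = f x + (\<integral>\<^sup>+w\<in>{u<..<t}. (\<integral>\<^sup>+y. (\<integral>\<^sup>+z. f z \<partial>Q y w) \<partial>\<mu> w) \<partial>lborel)" for f
  have LRcong: "L f = L g" "R f = R g" if "\<And>y. y \<in> space X \<Longrightarrow> f y = g y" for f g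
  proof -
    show "L f = L g" unfolding L_def
      using that by (simp cong: nn_integral_cong add: ic[of f g])
        (simp add: ic[of "\<lambda>y. f y * ennreal (r y _)" "\<lambda>y. g y * ennreal (r y _)"])
    have "(\<integral>\<^sup>+y. (\<integral>\<^sup>+z. f z \<partial>Q y w) \<partial>\<mu> w) = (\<integral>\<^sup>+y. (\<integral>\<^sup>+z. g z \<partial>Q y w) \<partial>\<mu> w)" for w
      using that by (intro ic nn_integral_Q_cong)
    then show "R f = R g" unfolding R_def using that[OF x] by simp
  qed
  have LRadd: "L (\<lambda>y. f y + g y) = L f + L g" "R (\<lambda>y. f y + g y) = R f + R g"
    if [measurable]: "f \<in> borel_measurable X" "g \<in> borel_measurable X" for f g
  proof -
    have 1: "(\<integral>\<^sup>+y. f y + g y \<partial>\<mu> t) = (\<integral>\<^sup>+y. f y \<partial>\<mu> t) + (\<integral>\<^sup>+y. g y \<partial>\<mu> t)"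
      by (rule nn_integral_add) (simp_all add: mc)
    have 2: "(\<integral>\<^sup>+y. (f y + g y) * ennreal (r y w) \<partial>\<mu> w) =
        (\<integral>\<^sup>+y. f y * ennreal (r y w) \<partial>\<mu> w) + (\<integral>\<^sup>+y. g y * ennreal (r y w) \<partial>\<mu> w)" for w
      unfolding distrib_right by (rule nn_integral_add; simp only: mc; measurable)
    have 3: "(\<integral>\<^sup>+w\<in>{u<..<t}. (\<integral>\<^sup>+y. (f y + g y) * ennreal (r y w) \<partial>\<mu> w) \<partial>lborel) =
       (\<integral>\<^sup>+w\<in>{u<..<t}. (\<integral>\<^sup>+y. f y * ennreal (r y w) \<partial>\<mu> w) \<partial>lborel) +
       (\<integral>\<^sup>+w\<in>{u<..<t}. (\<integral>\<^sup>+y. g y * ennreal (r y w) \<partial>\<mu> w) \<partial>lborel)"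
      unfolding 2 by (rule nn_integral_set_add; measurable)
    show "L (\<lambda>y. f y + g y) = L f + L g" unfolding L_def 1 3 by (simp add: ac_simps)
    have 4: "(\<integral>\<^sup>+y. (\<integral>\<^sup>+z. f z + g z \<partial>Q y w) \<partial>\<mu> w) =
        (\<integral>\<^sup>+y. (\<integral>\<^sup>+z. f z \<partial>Q y w) \<partial>\<mu> w) + (\<integral>\<^sup>+y. (\<integral>\<^sup>+z. g z \<partial>Q y w) \<partial>\<mu> w)" for w
    proof -
      have "(\<integral>\<^sup>+y. (\<integral>\<^sup>+z. f z + g z \<partial>Q y w) \<partial>\<mu> w) = (\<integral>\<^sup>+y. (\<integral>\<^sup>+z. f z \<partial>Q y w) + (\<integral>\<^sup>+z. g z \<partial>Q y w) \<partial>\<mu> w)"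
        by (intro ic nn_integral_add) (simp_all add: measurable_Q_cong)
      also have "\<dots> = (\<integral>\<^sup>+y. (\<integral>\<^sup>+z. f z \<partial>Q y w) \<partial>\<mu> w) + (\<integral>\<^sup>+y. (\<integral>\<^sup>+z. g z \<partial>Q y w) \<partial>\<mu> w)"
        by (rule nn_integral_add; simp only: mc; measurable)
      finally show ?thesis .
    qed
    have 5: "(\<integral>\<^sup>+w\<in>{u<..<t}. (\<integral>\<^sup>+y. (\<integral>\<^sup>+z. f z + g z \<partial>Q y w) \<partial>\<mu> w) \<partial>lborel) =
       (\<integral>\<^sup>+w\<in>{u<..<t}. (\<integral>\<^sup>+y. (\<integral>\<^sup>+z. f z \<partial>Q y w) \<partial>\<mu> w) \<partial>lborel) +
       (\<integral>\<^sup>+w\<in>{u<..<t}. (\<integral>\<^sup>+y. (\<integral>\<^sup>+z. g z \<partial>Q y w) \<partial>\<mu> w) \<partial>lborel)"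
      unfolding 4 by (rule nn_integral_set_add; measurable)
    show "R (\<lambda>y. f y + g y) = R f + R g" unfolding R_def 5 by (simp add: ac_simps)
  qed
  have LRcmult: "L (\<lambda>y. c * f y) = c * L f" "R (\<lambda>y. c * f y) = c * R f"
    if [measurable]: "f \<in> borel_measurable X" for c f
  proof -
    have 1: "(\<integral>\<^sup>+y. c * f y \<partial>\<mu> t) = c * (\<integral>\<^sup>+y. f y \<partial>\<mu> t)"
      by (rule nn_integral_cmult) (simp add: mc)
    have 2: "(\<integral>\<^sup>+y. c * f y * ennreal (r y w) \<partial>\<mu> w) = c * (\<integral>\<^sup>+y. f y * ennreal (r y w) \<partial>\<mu> w)" for w
      unfolding mult.assoc by (rule nn_integral_cmult; simp only: mc; measurable)
    have 3: "(\<integral>\<^sup>+w\<in>{u<..<t}. (\<integral>\<^sup>+y. c * f y * ennreal (r y w) \<partial>\<mu> w) \<partial>lborel) =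
       c * (\<integral>\<^sup>+w\<in>{u<..<t}. (\<integral>\<^sup>+y. f y * ennreal (r y w) \<partial>\<mu> w) \<partial>lborel)"
      unfolding 2 unfolding mult.assoc by (rule nn_integral_cmult; measurable)
    show "L (\<lambda>y. c * f y) = c * L f" unfolding L_def 1 3 by (simp add: distrib_left)
    have 4: "(\<integral>\<^sup>+y. (\<integral>\<^sup>+z. c * f z \<partial>Q y w) \<partial>\<mu> w) = c * (\<integral>\<^sup>+y. (\<integral>\<^sup>+z. f z \<partial>Q y w) \<partial>\<mu> w)" for w
    proof -
      have "(\<integral>\<^sup>+y. (\<integral>\<^sup>+z. c * f z \<partial>Q y w) \<partial>\<mu> w) = (\<integral>\<^sup>+y. c * (\<integral>\<^sup>+z. f z \<partial>Q y w) \<partial>\<mu> w)"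
        by (intro ic nn_integral_cmult) (simp add: measurable_Q_cong)
      also have "\<dots> = c * (\<integral>\<^sup>+y. (\<integral>\<^sup>+z. f z \<partial>Q y w) \<partial>\<mu> w)"
        by (rule nn_integral_cmult; simp only: mc; measurable)
      finally show ?thesis .
    qed
    have 5: "(\<integral>\<^sup>+w\<in>{u<..<t}. (\<integral>\<^sup>+y. (\<integral>\<^sup>+z. c * f z \<partial>Q y w) \<partial>\<mu> w) \<partial>lborel) =
       c * (\<integral>\<^sup>+w\<in>{u<..<t}. (\<integral>\<^sup>+y. (\<integral>\<^sup>+z. f z \<partial>Q y w) \<partial>\<mu> w) \<partial>lborel)"
      unfolding 4 unfolding mult.assoc by (rule nn_integral_cmult; measurable)
    show "R (\<lambda>y. c * f y) = c * R f" unfolding R_def 5 by (simp add: distrib_left)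
  qed
  have LRsup: "L (\<lambda>y. SUP i. F i y) = (SUP i. L (F i))" "R (\<lambda>y. SUP i. F i y) = (SUP i. R (F i))"
    if [measurable]: "\<And>i::nat. F i \<in> borel_measurable X" and F: "incseq F" for F
  proof -
    have Fm: "F i y \<le> F j y" if "i \<le> j" for i j y using F that by (auto simp: incseq_def le_fun_def)
    have 1: "(\<integral>\<^sup>+y. (SUP i. F i y) \<partial>\<mu> t) = (SUP i. \<integral>\<^sup>+y. F i y \<partial>\<mu> t)"
      by (rule nn_integral_monotone_convergence_SUP[OF F]) (simp add: mc)
    have 2: "(\<integral>\<^sup>+y. (SUP i. F i y) * ennreal (r y w) \<partial>\<mu> w) = (SUP i. \<integral>\<^sup>+y. F i y * ennreal (r y w) \<partial>\<mu> w)" for w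
      unfolding SUP_mult_right_ennreal
      by (rule nn_integral_monotone_convergence_SUP)
         (auto simp: incseq_def le_fun_def mc intro!: mult_right_mono Fm)
    have 3: "(\<integral>\<^sup>+w\<in>{u<..<t}. (\<integral>\<^sup>+y. (SUP i. F i y) * ennreal (r y w) \<partial>\<mu> w) \<partial>lborel) =
       (SUP i. \<integral>\<^sup>+w\<in>{u<..<t}. (\<integral>\<^sup>+y. F i y * ennreal (r y w) \<partial>\<mu> w) \<partial>lborel)"
      unfolding 2 unfolding SUP_mult_right_ennreal
    proof (rule nn_integral_monotone_convergence_SUP)
      show "incseq (\<lambda>i w. (\<integral>\<^sup>+y. F i y * ennreal (r y w) \<partial>\<mu> w) * indicator {u<..<t} w)"
        by (auto simp: incseq_def le_fun_def intro!: mult_right_mono nn_integral_mono Fm)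
    qed measurable
    show "L (\<lambda>y. SUP i. F i y) = (SUP i. L (F i))"
      unfolding L_def 1 3
      by (rule ennreal_SUP_add[symmetric]) (auto simp: incseq_def intro!: mult_right_mono nn_integral_mono Fm)
    have 4: "(\<integral>\<^sup>+y. (\<integral>\<^sup>+z. (SUP i. F i z) \<partial>Q y w) \<partial>\<mu> w) = (SUP i. \<integral>\<^sup>+y. (\<integral>\<^sup>+z. F i z \<partial>Q y w) \<partial>\<mu> w)" for w
    proof -
      have "(\<integral>\<^sup>+y. (\<integral>\<^sup>+z. (SUP i. F i z) \<partial>Q y w) \<partial>\<mu> w) = (\<integral>\<^sup>+y. (SUP i. \<integral>\<^sup>+z. F i z \<partial>Q y w) \<partial>\<mu> w)"
        by (intro ic nn_integral_monotone_convergence_SUP F) (simp add: measurable_Q_cong)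
      also have "\<dots> = (SUP i. \<integral>\<^sup>+y. (\<integral>\<^sup>+z. F i z \<partial>Q y w) \<partial>\<mu> w)"
      proof (rule nn_integral_monotone_convergence_SUP)
        show "(\<lambda>y. \<integral>\<^sup>+z. F i z \<partial>Q y w) \<in> borel_measurable (\<mu> w)" for i
          unfolding mc by measurable
      qed (auto simp: incseq_def le_fun_def intro!: nn_integral_mono Fm)
      finally show ?thesis .
    qed
    have 5: "(\<integral>\<^sup>+w\<in>{u<..<t}. (\<integral>\<^sup>+y. (\<integral>\<^sup>+z. (SUP i. F i z) \<partial>Q y w) \<partial>\<mu> w) \<partial>lborel) =
       (SUP i. \<integral>\<^sup>+w\<in>{u<..<t}. (\<integral>\<^sup>+y. (\<integral>\<^sup>+z. F i z \<partial>Q y w) \<partial>\<mu> w) \<partial>lborel)"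
      unfolding 4 unfolding SUP_mult_right_ennreal
    proof (rule nn_integral_monotone_convergence_SUP)
      show "incseq (\<lambda>i w. (\<integral>\<^sup>+y. (\<integral>\<^sup>+z. F i z \<partial>Q y w) \<partial>\<mu> w) * indicator {u<..<t} w)"
        by (auto simp: incseq_def le_fun_def intro!: mult_right_mono nn_integral_mono Fm)
    qed measurable
    show "R (\<lambda>y. SUP i. F i y) = (SUP i. R (F i))"
      unfolding R_def 5
      by (rule ennreal_SUP_add[symmetric]) (auto simp: incseq_def intro!: mult_right_mono nn_integral_mono Fm)
  qed
  have "L (\<lambda>y. f y * indicator C y) = R (\<lambda>y. f y * indicator C y)"
    using f
  proof (induction rule: borel_measurable_induct)
    case (cong f g)
    have e: "f y * indicator C y = g y * indicator C y" if "y \<in> space X" for y using cong(3)[OF that] by simp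
    show ?case using cong(4) LRcong[OF e] by simp
  next
    case (set A)
    have "A \<inter> C \<in> sets X" using set C by blast
    from ind[OF this] have "L (indicator (A \<inter> C)) = R (indicator (A \<inter> C))"
      unfolding L_def R_def
      using \<open>A \<inter> C \<in> sets X\<close> sets_mu[OF \<mu> x] sets_Q
      by (simp add: ic[of "\<lambda>y. integral\<^sup>N (Q y _) (indicator (A \<inter> C))" "\<lambda>y. emeasure (Q y _) (A \<inter> C)"])
    moreover have "(\<lambda>y. indicator A y * indicator C y) = (indicator (A \<inter> C) :: 'a \<Rightarrow> ennreal)"
      by (auto simp: fun_eq_iff split: split_indicator)
    ultimately show ?case by simp
  next
    case (mult f c)
    then show ?case using LRcmult[of "\<lambda>y. f y * indicator C y" c] by (simp add: mult.assoc)
  next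
    case (add f g)
    then show ?case using LRadd[of "\<lambda>y. g y * indicator C y" "\<lambda>y. f y * indicator C y"]
      by (simp add: distrib_right)
  next
    case (seq F)
    have "incseq (\<lambda>i y. F i y * indicator C y)"
      using \<open>incseq F\<close> by (auto simp: incseq_def le_fun_def intro!: mult_right_mono)
    moreover have "(\<lambda>y. F i y * indicator C y) \<in> borel_measurable X" for i
      using \<open>\<And>i. F i \<in> borel_measurable X\<close> by measurable
    ultimately have "L (\<lambda>y. SUP i. F i y * indicator C y) = R (\<lambda>y. SUP i. F i y * indicator C y)"
      using LRsup[of "\<lambda>i y. F i y * indicator C y"] \<open>\<And>i. L (\<lambda>y. F i y * indicator C y) = R (\<lambda>y. F i y * indicator C y)\<close> by simp
    then show ?case by (simp add: SUP_apply SUP_mult_right_ennreal image_comp comp_def)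
  qed
  moreover have "(\<lambda>y. f y * indicator C y) = f" using f0 by (auto simp: fun_eq_iff split: split_indicator)
  ultimately have "L f = R f" by simp
  then show ?thesis unfolding L_def R_def .
qed

text \<open>The comparison is known for subsets of the sets \<open>C n\<close> only. Made disjoint,
  these cut any measurable set into countably many pieces over which the inequality is added up;
  from sets it passes to functions.\<close>

lemma U_sum_le:
  assumes C: "\<And>n::nat. C n \<in> sets X" "(\<Union>n. C n) = space X"
    and le: "\<And>A n. A \<in> sets X \<Longrightarrow> A \<subseteq> C n \<Longrightarrow> (\<Sum>k<N. U k u x t (indicator A)) \<le> emeasure (\<mu> t) A"
    and f: "f \<in> borel_measurable X"
  shows "(\<Sum>k<N. U k u x t f) \<le> (\<integral>\<^sup>+y. f y \<partial>\<mu> t)"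
proof -
  note mc = measurable_mu_cong[OF \<mu> x] and sm = sets_mu[OF \<mu> x]
  define W where "W f = (\<Sum>k<N. U k u x t f)" for f
  have Wadd: "W (\<lambda>y. f y + g y) = W f + W g" if "f \<in> borel_measurable X" "g \<in> borel_measurable X" for f g
    unfolding W_def U_add[OF x that] by (rule sum.distrib)
  have Wcmult: "W (\<lambda>y. c * f y) = c * W f" if "f \<in> borel_measurable X" for c f
    unfolding W_def U_cmult[OF x that] by (rule sum_distrib_left[symmetric])
  have Wcong: "W f = W g" if "\<And>y. y \<in> space X \<Longrightarrow> f y = g y" for f g
    unfolding W_def using U_cong[OF x that] by simp
  have WSUP: "W (\<lambda>y. SUP i. F i y) = (SUP i. W (F i))"
    if F: "\<And>i::nat. F i \<in> borel_measurable X" "incseq F" for F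
  proof -
    have "incseq (\<lambda>i. U k u x t (F i))" for k
      unfolding incseq_def using F(2) by (intro allI impI U_mono x) (auto simp: incseq_def le_fun_def)
    then show ?thesis unfolding W_def U_SUP[OF x F] by (rule ennreal_SUP_sum[symmetric])
  qed
  have "W f \<le> (\<integral>\<^sup>+y. f y \<partial>\<mu> t)"
    using f
  proof (induction rule: borel_measurable_induct)
    case (cong f g)
    then show ?case using Wcong[OF cong(3)] nn_integral_mu_cong[OF \<mu> x cong(3)] by simp
  next
    case (set A)
    define D where "D n = A \<inter> disjointed C n" for n
    have "range (disjointed C) \<subseteq> sets X" by (rule sets.range_disjointed_sets) (use C(1) in auto)
    then have "disjointed C n \<in> sets X" for n by auto
    then have Ds: "D n \<in> sets X" for n unfolding D_def by (rule sets.Int[OF set])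
    have DC: "D n \<subseteq> C n" for n unfolding D_def using disjointed_subset[of C n] by blast
    have dj: "disjoint_family D" unfolding D_def using disjoint_family_disjointed[of C]
      unfolding disjoint_family_on_def by blast
    have "(\<Union>n. D n) = A \<inter> (\<Union>n. disjointed C n)" unfolding D_def by (rule Int_UN_distrib[symmetric])
    then have DA: "(\<Union>n. D n) = A"
      unfolding UN_disjointed_eq C(2) using sets.sets_into_space[OF set] by auto
    have Dm[measurable]: "indicator (D n) \<in> borel_measurable X" for n using Ds by simp
    have fin: "W (\<lambda>y. \<Sum>i<n. indicator (D i) y) \<le> (\<Sum>i<n. emeasure (\<mu> t) (D i))" for n
    proof (induction n)
      case 0
      have "W (\<lambda>_. 0) = 0" using Wcmult[of "\<lambda>_. 0" 0] by simp
      then show ?case by simp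
    next
      case (Suc n)
      have "(\<lambda>y. \<Sum>i<n. indicator (D i) y :: ennreal) \<in> borel_measurable X" by measurable
      from Wadd[OF this Dm[of n]] have "W (\<lambda>y. \<Sum>i<Suc n. indicator (D i) y) = W (\<lambda>y. \<Sum>i<n. indicator (D i) y) + W (indicator (D n))"
        by simp
      then show ?case using Suc le[OF Ds DC, of n] unfolding W_def[of "indicator (D n)"] by (simp add: add_mono)
    qed
    have "(\<lambda>y. SUP n. \<Sum>i<n. indicator (D i) y) = (indicator A :: 'a \<Rightarrow> ennreal)"
      using suminf_indicator[OF dj] DA by (simp add: suminf_eq_SUP[symmetric] fun_eq_iff)
    then have "W (indicator A) = W (\<lambda>y. SUP n. \<Sum>i<n. indicator (D i) y)" by simp
    also have "\<dots> = (SUP n. W (\<lambda>y. \<Sum>i<n. indicator (D i) y))"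
      by (rule WSUP) (auto simp: incseq_def le_fun_def intro!: sum_mono2)
    also have "\<dots> \<le> (SUP n. \<Sum>i<n. emeasure (\<mu> t) (D i))" by (intro SUP_mono) (use fin in blast)
    also have "\<dots> = emeasure (\<mu> t) A"
      using suminf_emeasure[of D "\<mu> t"] Ds dj DA sm by (simp add: suminf_eq_SUP image_subset_iff)
    finally show ?case using set sm by simp
  next
    case (mult f c)
    then show ?case using Wcmult[of f c] by (subst nn_integral_cmult) (auto simp: mc intro: mult_left_mono)
  next
    case (add f g)
    then show ?case using Wadd[of g f] by (subst nn_integral_add) (auto simp: mc intro: add_mono)
  next
    case (seq F)
    have "(\<integral>\<^sup>+y. (SUP i. F i y) \<partial>\<mu> t) = (SUP i. \<integral>\<^sup>+y. F i y \<partial>\<mu> t)"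
      by (rule nn_integral_monotone_convergence_SUP) (use seq in \<open>auto simp: mc\<close>)
    moreover have "W (\<lambda>y. SUP i. F i y) = (SUP i. W (F i))" by (rule WSUP) (use seq in auto)
    moreover have "(SUP i. W (F i)) \<le> (SUP i. \<integral>\<^sup>+y. F i y \<partial>\<mu> t)" by (intro SUP_mono) (use seq in blast)
    ultimately show ?case by (simp add: SUP_apply[abs_def] image_comp)
  qed
  then show ?thesis unfolding W_def .
qed

text \<open>Induction over the number of iterates. Splitting off the last jump turns
  \<open>N + 1\<close> iterates on a subset \<open>A\<close> of some \<open>C n\<close> into
  \<open>N\<close> iterates on \<open>G t w (indicator A)\<close> at earlier times. This function
  need not vanish off any \<open>C n\<close>, so the induction hypothesis has to cover all
  measurable functions.\<close>

theorem Vm_minimal: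
  assumes C: "\<And>n::nat. C n \<in> sets X" "(\<Union>n. C n) = space X"
    and mild: "\<And>t A n. u < t \<Longrightarrow> t < s \<Longrightarrow> A \<in> sets X \<Longrightarrow> A \<subseteq> C n \<Longrightarrow>
      emeasure (\<mu> t) A = indicator A x * ennreal (S x u t) +
        (\<integral>\<^sup>+w\<in>{u<..<t}. (\<integral>\<^sup>+y. G t w (indicator A) y \<partial>\<mu> w) \<partial>lborel)"
    and t: "u < t" "t < s" and B: "B \<in> sets X"
  shows "emeasure (Vm u x t) B \<le> emeasure (\<mu> t) B"
proof -
  note [measurable] = \<mu> x
  have *: "(\<Sum>k<N. U k u x t f) \<le> (\<integral>\<^sup>+y. f y \<partial>\<mu> t)" if "u < t" "t < s" "f \<in> borel_measurable X" for N t f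
    using that
  proof (induction N arbitrary: t f)
    case (Suc N)
    show ?case
    proof (rule U_sum_le[OF C _ Suc.prems(3)])
      fix A n assume A[measurable]: "A \<in> sets X" and An: "A \<subseteq> C n"
      have "(\<Sum>k<Suc N. U k u x t (indicator A)) = U 0 u x t (indicator A) + (\<Sum>k<N. U (Suc k) u x t (indicator A))"
        by (simp add: sum.lessThan_Suc_shift del: sum.lessThan_Suc U.simps)
      also have "(\<Sum>k<N. U (Suc k) u x t (indicator A)) = (\<Sum>k<N. \<integral>\<^sup>+w\<in>{u<..<t}. U k u x w (G t w (indicator A)) \<partial>lborel)"
        by (intro sum.cong refl U_forward x) measurable
      also have "\<dots> = (\<integral>\<^sup>+w\<in>{u<..<t}. (\<Sum>k<N. U k u x w (G t w (indicator A))) \<partial>lborel)"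
        unfolding sum_distrib_right by (rule nn_integral_sum[symmetric]) measurable
      also have "\<dots> \<le> (\<integral>\<^sup>+w\<in>{u<..<t}. (\<integral>\<^sup>+y. G t w (indicator A) y \<partial>\<mu> w) \<partial>lborel)"
      proof (intro nn_integral_mono)
        fix w
        have "(\<Sum>k<N. U k u x w (G t w (indicator A))) \<le> (\<integral>\<^sup>+y. G t w (indicator A) y \<partial>\<mu> w)" if "u < w" "w < t"
        proof (rule Suc.IH)
          show "G t w (indicator A) \<in> borel_measurable X" by measurable
        qed (use that Suc.prems in auto)
        then show "(\<Sum>k<N. U k u x w (G t w (indicator A))) * indicator {u<..<t} w
            \<le> (\<integral>\<^sup>+y. G t w (indicator A) y \<partial>\<mu> w) * indicator {u<..<t} w"
          by (auto split: split_indicator)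
      qed
      finally show "(\<Sum>k<Suc N. U k u x t (indicator A)) \<le> emeasure (\<mu> t) A"
        unfolding mild[OF Suc.prems(1,2) A An] by (simp add: add_left_mono)
    qed
  qed simp
  have "emeasure (Vm u x t) B = (SUP N. \<Sum>k<N. U k u x t (indicator B))"
    unfolding emeasure_Vm[OF x B] V_def suminf_eq_SUP ..
  also have "\<dots> \<le> (\<integral>\<^sup>+y. indicator B y \<partial>\<mu> t)"
    by (intro SUP_least *) (use t B in auto)
  also have "\<dots> = emeasure (\<mu> t) B" using B sets_mu[OF \<mu> x] by simp
  finally show ?thesis .
qed

end

end

section \<open>The forward equation of a Q-function\<close>

text \<open>Two different points are separated by a member of a countable base, so the complement of
  the diagonal is a countable union of rectangles. This serves \<open>q x t (B - {x})\<close>, where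
  the removed point varies with the argument.\<close>

lemma diagonal_measurable:
  assumes X: "standard_borel X"
  shows "{z \<in> space (X \<Otimes>\<^sub>M X). fst z = snd z} \<in> sets (X \<Otimes>\<^sub>M X)"
proof -
  obtain T where T: "completely_metrizable_space T" "second_countable T" "topspace T = space X"
       "sets X = sigma_sets (topspace T) {U. openin T U}"
    using X unfolding standard_borel_def by blast
  have HT: "Hausdorff_space T"
    by (intro metrizable_imp_Hausdorff_space completely_metrizable_imp_metrizable_space T(1))
  obtain \<B> where \<B>: "countable \<B>" "\<And>V. V \<in> \<B> \<Longrightarrow> openin T V"
      "\<And>U x. openin T U \<Longrightarrow> x \<in> U \<Longrightarrow> \<exists>V\<in>\<B>. x \<in> V \<and> V \<subseteq> U"
    using T(2) unfolding second_countable_def by metis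
  have BX: "V \<in> sets X" if "V \<in> \<B>" for V using \<B>(2)[OF that] T(4) by (auto intro: sigma_sets.Basic)
  have "space (X \<Otimes>\<^sub>M X) - (\<Union>V\<in>\<B>. V \<times> (space X - V)) = {z \<in> space (X \<Otimes>\<^sub>M X). fst z = snd z}"
  proof -
    have "(x, y) \<in> (\<Union>V\<in>\<B>. V \<times> (space X - V))" if xy: "x \<in> space X" "y \<in> space X" "x \<noteq> y" for x y
    proof -
      obtain U V where UV: "openin T U" "openin T V" "x \<in> U" "y \<in> V" "disjnt U V"
        using HT xy T(3) unfolding Hausdorff_space_def by metis
      obtain W where "W \<in> \<B>" "x \<in> W" "W \<subseteq> U" using \<B>(3)[OF UV(1,3)] by blast
      then show ?thesis using UV xy unfolding disjnt_iff by blast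
    qed
    then show ?thesis by (auto simp: space_pair_measure, metis)
  qed
  moreover have "(\<Union>V\<in>\<B>. V \<times> (space X - V)) \<in> sets (X \<Otimes>\<^sub>M X)"
    using BX \<B>(1) by (intro sets.countable_UN') auto
  ultimately show ?thesis by (metis sets.compl_sets)
qed

lemma signed_measure_add:
  assumes \<mu>: "signed_measure X \<mu>" and A: "A \<in> sets X" "B \<in> sets X" "A \<inter> B = {}"
  shows "\<mu> (A \<union> B) = \<mu> A + \<mu> B"
proof -
  define F where "F = (\<lambda>n::nat. if n = 0 then A else if n = 1 then B else {})"
  have "range F \<subseteq> sets X" "disjoint_family F" using A unfolding F_def disjoint_family_on_def by auto
  then have "(\<lambda>n. \<mu> (F n)) sums \<mu> (\<Union>n. F n)" using \<mu> unfolding signed_measure_def by blast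
  moreover have "(\<Union>n. F n) = A \<union> B" unfolding F_def by (auto split: if_splits)
  moreover have "(\<lambda>n. \<mu> (F n)) sums (\<Sum>n<2. \<mu> (F n))"
    by (rule sums_finite) (use \<mu> in \<open>auto simp: F_def signed_measure_def\<close>)
  ultimately show ?thesis using sums_unique2 by (fastforce simp: F_def numeral_2_eq_2)
qed

section \<open>Jump kernels of a conservative Q-function\<close>

locale Q_rates =
  fixes X :: "'a measure" and T0 :: real and T1 :: ereal and q :: "'a rate_fun"
  assumes X: "standard_borel X" and T01: "ereal T0 < T1"
    and q: "Q_function X T0 T1 q" and cons: "conservative X T0 T1 q"
begin

lemma signed: "x \<in> space X \<Longrightarrow> t \<in> time_dom T0 T1 \<Longrightarrow> signed_measure X (q x t)"
  using q unfolding Q_function_def by blast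

lemma q_off_nonneg: "x \<in> space X \<Longrightarrow> t \<in> time_dom T0 T1 \<Longrightarrow> B \<in> sets X \<Longrightarrow> 0 \<le> q x t (B - {x})"
  using q unfolding Q_function_def by blast

lemma singleton_sets:
  assumes "x \<in> space X" shows "{x} \<in> sets X"
proof -
  have "Pair x -` {z \<in> space (X \<Otimes>\<^sub>M X). fst z = snd z} \<in> sets X"
    by (rule sets_Pair1[OF diagonal_measurable[OF X]])
  also have "Pair x -` {z \<in> space (X \<Otimes>\<^sub>M X). fst z = snd z} = {x}"
    using assms by (auto simp: space_pair_measure)
  finally show ?thesis .
qed

text \<open>Measurability of \<open>q\<close> is given for a fixed set, but here the set varies with
  \<open>x\<close>. Rectangles reduce to fixed sets, and additivity of the signed measures carries
  the property to the generated sigma-algebra.\<close>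

lemma measurable_section:
  assumes D: "D \<in> sets (X \<Otimes>\<^sub>M X)"
  shows "(\<lambda>(x, t). q x t (Pair x -` D)) \<in> borel_measurable (X \<Otimes>\<^sub>M restrict_space borel (time_dom T0 T1))"
proof -
  let ?M = "X \<Otimes>\<^sub>M restrict_space borel (time_dom T0 T1)"
  have sp: "fst z \<in> space X \<and> snd z \<in> time_dom T0 T1" if "z \<in> space ?M" for z
    using that by (auto simp: space_pair_measure space_restrict_space)
  have qB: "(\<lambda>z. q (fst z) (snd z) B) \<in> borel_measurable ?M" if "B \<in> sets X" for B
    using q that unfolding Q_function_def by (simp add: case_prod_beta')
  note sec = sets_Pair1
  have "D \<in> sigma_sets (space X \<times> space X) {a \<times> b |a b. a \<in> sets X \<and> b \<in> sets X}"
    using D unfolding sets_pair_measure .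
  then have "(\<lambda>z. q (fst z) (snd z) (Pair (fst z) -` D)) \<in> borel_measurable ?M"
  proof (induction rule: sigma_sets_induct_disjoint[OF Int_stable_pair_measure_generator pair_measure_closed, consumes 1,
        case_names basic empty compl union])
    case (basic A)
    then obtain a b where ab: "A = a \<times> b" "a \<in> sets X" "b \<in> sets X" by blast
    have "(\<lambda>z. indicator a (fst z) * q (fst z) (snd z) b) \<in> borel_measurable ?M"
      using ab(2) qB[OF ab(3)] by (intro borel_measurable_times) (auto intro: measurable_compose[OF measurable_fst])
    also have "?this \<longleftrightarrow> ?case"
    proof (rule measurable_cong)
      fix z assume "z \<in> space ?M"
      then have "q (fst z) (snd z) {} = 0" using signed sp unfolding signed_measure_def by blast
      then show "indicator a (fst z) * q (fst z) (snd z) b = q (fst z) (snd z) (Pair (fst z) -` A)"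
        by (auto simp: ab(1) split: split_indicator)
    qed
    finally show ?case .
  next
    case empty
    show ?case using qB[of "{}"] by simp
  next
    case (compl A)
    have A: "A \<in> sets (X \<Otimes>\<^sub>M X)" using compl(1) unfolding sets_pair_measure .
    have "(\<lambda>z. q (fst z) (snd z) (space X) - q (fst z) (snd z) (Pair (fst z) -` A)) \<in> borel_measurable ?M"
      using compl(2) qB[OF sets.top] by (rule borel_measurable_diff[rotated])
    also have "?this \<longleftrightarrow> ?case"
    proof (rule measurable_cong)
      fix z assume z: "z \<in> space ?M"
      let ?A = "Pair (fst z) -` A"
      have eq: "Pair (fst z) -` (space X \<times> space X - A) = space X - ?A"
        using sp[OF z] by auto
      have "?A \<subseteq> space X" using sets.sets_into_space[OF sec[OF A]] .
      then have "?A \<union> (space X - ?A) = space X" by blast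
      then have "q (fst z) (snd z) (space X) = q (fst z) (snd z) ?A + q (fst z) (snd z) (space X - ?A)"
        using signed_measure_add[OF signed, of "fst z" "snd z" ?A "space X - ?A"] sp[OF z] sec[OF A] by auto
      then show "q (fst z) (snd z) (space X) - q (fst z) (snd z) ?A = q (fst z) (snd z) (Pair (fst z) -` (space X \<times> space X - A))"
        unfolding eq by simp
    qed
    finally show ?case .
  next
    case (union A)
    have A: "A i \<in> sets (X \<Otimes>\<^sub>M X)" for i using union(2) unfolding sets_pair_measure by blast
    have "(\<lambda>z. \<Sum>i. q (fst z) (snd z) (Pair (fst z) -` A i)) \<in> borel_measurable ?M"
      using union(3) by (intro borel_measurable_suminf)
    also have "?this \<longleftrightarrow> ?case"
    proof (rule measurable_cong)
      fix z assume z: "z \<in> space ?M"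
      have "disjoint_family (\<lambda>i. Pair (fst z) -` A i)" "range (\<lambda>i. Pair (fst z) -` A i) \<subseteq> sets X"
        using union(1) sec[OF A] unfolding disjoint_family_on_def by blast+
      then have "(\<lambda>i. q (fst z) (snd z) (Pair (fst z) -` A i)) sums q (fst z) (snd z) (\<Union>i. Pair (fst z) -` A i)"
        using signed[of "fst z" "snd z"] sp[OF z] unfolding signed_measure_def by blast
      then show "(\<Sum>i. q (fst z) (snd z) (Pair (fst z) -` A i)) = q (fst z) (snd z) (Pair (fst z) -` \<Union> (range A))"
        by (simp add: sums_unique[symmetric] vimage_UN)
    qed
    finally show ?case .
  qed
  then show ?thesis by (simp add: case_prod_beta')
qed

lemma measurable_q_off:
  assumes B: "B \<in> sets X"
  shows "(\<lambda>(x, t). q x t (B - {x})) \<in> borel_measurable (X \<Otimes>\<^sub>M restrict_space borel (time_dom T0 T1))"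
proof -
  let ?D = "space X \<times> B - {z \<in> space (X \<Otimes>\<^sub>M X). fst z = snd z}"
  have "?D \<in> sets (X \<Otimes>\<^sub>M X)" using B diagonal_measurable[OF X] by auto
  from measurable_section[OF this] show ?thesis
  proof (rule measurable_cong[THEN iffD1, rotated])
    fix z assume "z \<in> space (X \<Otimes>\<^sub>M restrict_space borel (time_dom T0 T1))"
    then have "fst z \<in> space X" by (auto simp: space_pair_measure)
    then have "Pair (fst z) -` ?D = B - {fst z}"
      using sets.sets_into_space[OF B] by (auto simp: space_pair_measure)
    then show "(case z of (x, t) \<Rightarrow> q x t (Pair x -` ?D)) = (case z of (x, t) \<Rightarrow> q x t (B - {x}))"
      by (cases z) simp
  qed
qed

text \<open>Total mass 0 means that the deficit at \<open>x\<close> equals the mass off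
  \<open>x\<close>. This makes the exit rate the total mass of the jump kernel, as in
  \<open>jump_rates\<close>.\<close>

lemma exit_rate_eq: "x \<in> space X \<Longrightarrow> t \<in> time_dom T0 T1 \<Longrightarrow> exit_rate q x t = q x t (space X - {x})"
  using signed_measure_add[OF signed, of x t "{x}" "space X - {x}"] singleton_sets[of x] cons
  unfolding conservative_def exit_rate_def by (auto simp: insert_absorb)

lemma q_plus_measure:
  assumes x: "x \<in> space X" and t: "t \<in> time_dom T0 T1"
  shows "emeasure (to_measure X (q_plus q x t)) B = (if B \<in> sets X then ennreal (q x t (B - {x})) else 0)"
    "sets (to_measure X (q_plus q x t)) = sets X" "space (to_measure X (q_plus q x t)) = space X"
proof -
  show s: "sets (to_measure X (q_plus q x t)) = sets X"
    unfolding to_measure_def by (simp add: sets.sets_measure_of_eq)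
  show "space (to_measure X (q_plus q x t)) = space X"
    unfolding to_measure_def by (simp add: sets.space_measure_of_eq)
  have "measure_space (space X) (sets X) (\<lambda>B. ennreal (q_plus q x t B))"
    unfolding measure_space_def
  proof (intro conjI)
    show "sigma_algebra (space X) (sets X)" by (rule sets.sigma_algebra_axioms)
    show "positive (sets X) (\<lambda>B. ennreal (q_plus q x t B))"
      using signed[OF x t] unfolding positive_def signed_measure_def q_plus_def by simp
    show "countably_additive (sets X) (\<lambda>B. ennreal (q_plus q x t B))"
      unfolding countably_additive_def q_plus_def
    proof (intro allI impI)
      fix A :: "nat \<Rightarrow> 'a set" assume A: "range A \<subseteq> sets X" "disjoint_family A" "\<Union> (range A) \<in> sets X"
      have "range (\<lambda>n. A n - {x}) \<subseteq> sets X" using A(1) singleton_sets[OF x] by auto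
      moreover have "disjoint_family (\<lambda>n. A n - {x})" using A(2) unfolding disjoint_family_on_def by blast
      ultimately have "(\<lambda>n. q x t (A n - {x})) sums q x t (\<Union>n. A n - {x})"
        using signed[OF x t] unfolding signed_measure_def by blast
      moreover have "(\<Union>n. A n - {x}) = \<Union> (range A) - {x}" by blast
      ultimately show "(\<Sum>i. ennreal (q x t (A i - {x}))) = ennreal (q x t (\<Union> (range A) - {x}))"
        using A(1) q_off_nonneg[OF x t] by (intro suminf_ennreal_eq) (auto simp: range_subsetD)
    qed
  qed
  then show "emeasure (to_measure X (q_plus q x t)) B = (if B \<in> sets X then ennreal (q x t (B - {x})) else 0)"
    using s unfolding to_measure_def
    by (auto simp: emeasure_measure_of_sigma measure_space_def q_plus_def sets.sigma_algebra_axioms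
        intro!: emeasure_notin_sets)
qed

text \<open>Rates are cut off at a horizon \<open>s < T1\<close>, which makes them bounded in time on all of \<open>\<real>\<close>.\<close>

definition Qs :: "real \<Rightarrow> 'a \<Rightarrow> real \<Rightarrow> 'a measure" where
  "Qs s x w = (if x \<in> space X \<and> T0 \<le> w \<and> w < s then to_measure X (q_plus q x w) else null_measure X)"

lemma Qs_kernel:
  assumes s: "ereal s < T1"
  shows "finite_kernel (X \<Otimes>\<^sub>M borel) X (\<lambda>(x, w). Qs s x w)"
proof -
  have dom: "w \<in> time_dom T0 T1" if "T0 \<le> w" "w < s" for w
    using that s less_trans[of "ereal w" "ereal s" T1] unfolding time_dom_def by auto
  \<comment> \<open>Times outside the window are moved to \<open>T0\<close>, inside the domain where
    joint measurability is given; the indicator discards the value found there.\<close>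
  have em: "emeasure (Qs s x w) B = indicator {T0..<s} w * ennreal (q x (if T0 \<le> w \<and> w < s then w else T0) (B - {x}))"
    if "x \<in> space X" "B \<in> sets X" for x w B
    using that q_plus_measure(1)[OF that(1) dom] unfolding Qs_def by (auto split: split_indicator)
  have "sets (Qs s x w) = sets X" "finite_measure (Qs s x w)" for x w
  proof -
    show "sets (Qs s x w) = sets X" using q_plus_measure(2) dom unfolding Qs_def by simp
    show "finite_measure (Qs s x w)"
      using q_plus_measure[OF _ dom] unfolding Qs_def by (auto intro!: finite_measureI)
  qed
  moreover have "(\<lambda>a. emeasure (case a of (x, w) \<Rightarrow> Qs s x w) B) \<in> borel_measurable (X \<Otimes>\<^sub>M borel)" if B: "B \<in> sets X" for B
  proof -
    have "T0 \<in> time_dom T0 T1" using T01 unfolding time_dom_def by simp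
    then have "(\<lambda>w. if T0 \<le> w \<and> w < s then w else T0) \<in> borel \<rightarrow>\<^sub>M restrict_space borel (time_dom T0 T1)"
      using dom by (intro measurable_restrict_space2) auto
    then have "(\<lambda>z. (fst z, if T0 \<le> snd z \<and> snd z < s then snd z else T0)) \<in> X \<Otimes>\<^sub>M borel \<rightarrow>\<^sub>M X \<Otimes>\<^sub>M restrict_space borel (time_dom T0 T1)"
      by (intro measurable_Pair measurable_fst measurable_compose[OF measurable_snd])
    from measurable_compose[OF this measurable_q_off[OF B]]
    have [measurable]: "(\<lambda>z. q (fst z) (if T0 \<le> snd z \<and> snd z < s then snd z else T0) (B - {fst z})) \<in> borel_measurable (X \<Otimes>\<^sub>M borel)"
      by simp
    have "(\<lambda>z. indicator {T0..<s} (snd z) * ennreal (q (fst z) (if T0 \<le> snd z \<and> snd z < s then snd z else T0) (B - {fst z})))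
        \<in> borel_measurable (X \<Otimes>\<^sub>M borel)"
      by measurable
    then show ?thesis
      by (rule measurable_cong[THEN iffD1, rotated]) (auto simp: em[OF _ B] space_pair_measure)
  qed
  ultimately show ?thesis unfolding finite_kernel_def by auto
qed

end

lemma to_measure_eqI:
  assumes "sets M = sets X" and "\<And>B. B \<in> sets X \<Longrightarrow> ennreal (\<nu> B) = emeasure M B"
  shows "to_measure X \<nu> = M"
proof -
  have sp: "space M = space X" using assms(1) by (rule sets_eq_imp_space_eq)
  have "to_measure X \<nu> = measure_of (space X) (sets X) (emeasure M)"
    unfolding to_measure_def by (rule measure_of_eq[OF sets.space_closed]) (simp add: sets.sigma_sets_eq assms(2))
  also have "\<dots> = M" using measure_of_of_measure[of M] assms(1) sp by simp
  finally show ?thesis .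
qed

lemma sets_to_measure[simp]: "sets (to_measure X \<nu>) = sets X"
  and space_to_measure[simp]: "space (to_measure X \<nu>) = space X"
  unfolding to_measure_def by (simp_all add: sets.sets_measure_of_eq sets.space_measure_of_eq)

lemma emeasure_to_measure:
  assumes "measure_space (space X) (sets X) (\<lambda>B. ennreal (\<nu> B))" "B \<in> sets X"
  shows "emeasure (to_measure X \<nu>) B = ennreal (\<nu> B)"
  using assms unfolding to_measure_def
  by (intro emeasure_measure_of_sigma) (auto simp: measure_space_def)

lemma nonneg_integral_eq:
  fixes f :: "'a \<Rightarrow> real"
  assumes "f \<in> borel_measurable M" "\<And>y. y \<in> space M \<Longrightarrow> 0 \<le> f y"
  shows "integrable M f \<longleftrightarrow> (\<integral>\<^sup>+y. ennreal (f y) \<partial>M) < \<infinity>"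
    and "(\<integral>y. f y \<partial>M) = enn2real (\<integral>\<^sup>+y. ennreal (f y) \<partial>M)"
proof -
  have "(\<integral>\<^sup>+y. ennreal (norm (f y)) \<partial>M) = (\<integral>\<^sup>+y. ennreal (f y) \<partial>M)"
    using assms(2) by (intro nn_integral_cong) simp
  then show "integrable M f \<longleftrightarrow> (\<integral>\<^sup>+y. ennreal (f y) \<partial>M) < \<infinity>"
    using assms(1) by (simp add: integrable_iff_bounded)
  show "(\<integral>y. f y \<partial>M) = enn2real (\<integral>\<^sup>+y. ennreal (f y) \<partial>M)"
    by (rule integral_eq_nn_integral) (use assms in auto)
qed

lemma time_dom_less: "w < s \<Longrightarrow> T0 \<le> w \<Longrightarrow> ereal s < T1 \<Longrightarrow> w \<in> time_dom T0 T1"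
  unfolding time_dom_def using less_trans[of "ereal w" "ereal s" T1] by simp

lemma real_between_ereal:
  assumes "ereal t < T1" obtains s where "t < s" "ereal s < T1"
proof -
  obtain z where "ereal t < z" "z < T1" using dense[OF assms] by blast
  then show thesis using that by (cases z) auto
qed

section \<open>The series below a horizon and its comparison with other solutions\<close>

locale Q_bounded = Q_rates +
  assumes rate_bdd: "\<And>s x. T0 < s \<Longrightarrow> ereal s < T1 \<Longrightarrow> x \<in> space X \<Longrightarrow> bdd_above ((\<lambda>t. exit_rate q x t) ` {T0..<s})"
begin

lemma Qs_eq: "x \<in> space X \<Longrightarrow> T0 \<le> w \<Longrightarrow> w < s \<Longrightarrow> Qs s x w = to_measure X (q_plus q x w)"
  unfolding Qs_def by simp

lemma emeasure_Qs:
  "ereal s < T1 \<Longrightarrow> x \<in> space X \<Longrightarrow> T0 \<le> w \<Longrightarrow> w < s \<Longrightarrow> B \<in> sets X \<Longrightarrow> emeasure (Qs s x w) B = ennreal (q x w (B - {x}))"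
  by (simp add: Qs_eq q_plus_measure(1) time_dom_less)

lemma Qs_outside: "\<not> (T0 \<le> w \<and> w < s) \<Longrightarrow> emeasure (Qs s x w) B = 0"
  unfolding Qs_def by auto

lemma jump_rates_Qs:
  assumes s: "T0 < s" "ereal s < T1"
  shows "jump_rates X (Qs s)"
proof
  show "finite_kernel (X \<Otimes>\<^sub>M borel) X (\<lambda>(x, w). Qs s x w)" by (rule Qs_kernel[OF s(2)])
  fix x assume x: "x \<in> space X"
  obtain K where K: "\<forall>t\<in>{T0..<s}. exit_rate q x t \<le> K"
    using rate_bdd[OF s x] unfolding bdd_above_def by auto
  have "emeasure (Qs s x w) (space X) \<le> ennreal K" for w
  proof (cases "T0 \<le> w \<and> w < s")
    case True
    then have "emeasure (Qs s x w) (space X) = ennreal (exit_rate q x w)"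
      using s x exit_rate_eq[OF x time_dom_less[of w s]] by (simp add: emeasure_Qs)
    then show ?thesis using K True by (simp add: ennreal_leI)
  qed (simp add: Qs_outside)
  then show "\<exists>K. \<forall>w. emeasure (Qs s x w) (space X) \<le> ennreal K" by blast
qed

context
  fixes s :: real
  assumes s: "T0 < s" "ereal s < T1"
begin

interpretation J: jump_rates X "Qs s"
  by (rule jump_rates_Qs[OF s])

lemma r_eq: "x \<in> space X \<Longrightarrow> T0 \<le> w \<Longrightarrow> w < s \<Longrightarrow> J.r x w = exit_rate q x w"
  using s unfolding J.r_def measure_def
  by (simp add: emeasure_Qs exit_rate_eq time_dom_less q_off_nonneg)

lemma r_outside: "\<not> (T0 \<le> w \<and> w < s) \<Longrightarrow> J.r x w = 0"
  unfolding J.r_def measure_def by (simp add: Qs_outside)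

lemma survival_eq: "x \<in> space X \<Longrightarrow> T0 \<le> u \<Longrightarrow> t < s \<Longrightarrow> survival q x u t = J.S x u t"
  unfolding survival_def J.S_def set_lebesgue_integral_def
  by (auto intro!: Bochner_Integration.integral_cong simp: r_eq split: split_indicator)

text \<open>Up to a time \<open>t < s\<close> only rates at times before \<open>s\<close> enter, and
  these are untouched by the cut-off.\<close>

lemma Pbar_iter_eq:
  assumes "x \<in> space X" "T0 \<le> u" "t < s"
  shows "Pbar_iter X q n u x t B = J.U n u x t (indicator B)"
  using assms(1,2)
proof (induction n arbitrary: u x)
  case 0
  then show ?case using assms(3) by (simp add: survival_eq)
next
  case (Suc n)
  have "(\<integral>\<^sup>+ y. ennreal (survival q x u w) * Pbar_iter X q n w y t B \<partial>to_measure X (q_plus q x w)) =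
      (\<integral>\<^sup>+ y. ennreal (J.S x u w) * J.U n w y t (indicator B) \<partial>Qs s x w)" if "u < w" "w < t" for w
  proof -
    have w: "T0 \<le> w" "w < s" using that Suc.prems assms(3) by auto
    show ?thesis
      unfolding Qs_eq[OF Suc.prems(1) w, symmetric] survival_eq[OF Suc.prems w(2)]
      using Suc.IH[OF _ w(1)] J.space_Q[OF Suc.prems(1)] by (intro nn_integral_cong) simp
  qed
  then show ?case by (auto intro!: nn_integral_cong split: split_indicator)
qed

lemma Pbar_series_eq:
  "x \<in> space X \<Longrightarrow> T0 \<le> u \<Longrightarrow> t < s \<Longrightarrow> B \<in> sets X \<Longrightarrow> Pbar_series X q u x t B = emeasure (J.Vm u x t) B"
  unfolding Pbar_series_def by (simp add: Pbar_iter_eq J.emeasure_Vm J.V_def)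

lemma ennreal_Pbar:
  assumes "x \<in> space X" "T0 \<le> u" "t < s" "B \<in> sets X"
  shows "ennreal (Pbar X q u x t B) = emeasure (J.Vm u x t) B"
  using J.emeasure_Vm_le_1[OF assms(1), of u t B] unfolding Pbar_def Pbar_series_eq[OF assms]
  by (intro ennreal_enn2real) (auto simp: le_less_trans)

lemma to_measure_Pbar:
  assumes "x \<in> space X" "T0 \<le> u" "t < s"
  shows "to_measure X (Pbar X q u x t) = J.Vm u x t"
  by (rule to_measure_eqI) (simp_all add: ennreal_Pbar assms)

text \<open>The forward equation is stated with Bochner integrals, the kernels work with extended
  ones. Both integrands are non-negative, so integrability is finiteness of \<open>a\<close> and of
  \<open>b\<close>.\<close>

lemma forward_terms:
  assumes M: "sets M = sets X" and t: "T0 \<le> t" "t < s" and B: "B \<in> sets X"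
  defines "a \<equiv> \<integral>\<^sup>+y. indicator B y * ennreal (J.r y t) \<partial>M"
    and "b \<equiv> \<integral>\<^sup>+y. emeasure (Qs s y t) B \<partial>M"
  shows "set_integrable M B (\<lambda>y. exit_rate q y t) \<longleftrightarrow> a < \<infinity>"
    and "(LINT y:B|M. exit_rate q y t) = enn2real a"
    and "integrable M (\<lambda>y. q y t (B - {y})) \<longleftrightarrow> b < \<infinity>"
    and "(LINT y|M. q y t (B - {y})) = enn2real b"
proof -
  have sp: "space M = space X" using M by (rule sets_eq_imp_space_eq)
  note [measurable] = B
  have mX: "borel_measurable M = (borel_measurable X :: ('a \<Rightarrow> real) set)" using M by (intro measurable_cong_sets) auto
  have "(\<lambda>y. indicator B y * J.r y t) \<in> borel_measurable X" by measurable
  also have "?this \<longleftrightarrow> (\<lambda>y. indicator B y *\<^sub>R exit_rate q y t) \<in> borel_measurable X"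
    by (intro measurable_cong) (simp add: r_eq t)
  finally have m1: "(\<lambda>y. indicator B y *\<^sub>R exit_rate q y t) \<in> borel_measurable M" unfolding mX .
  have p1: "0 \<le> indicator B y *\<^sub>R exit_rate q y t" if "y \<in> space M" for y
    using that sp J.r_nonneg[of y t] r_eq[of y t] t by simp
  have e1: "(\<integral>\<^sup>+y. ennreal (indicator B y *\<^sub>R exit_rate q y t) \<partial>M) = a"
    unfolding a_def using sp t by (intro nn_integral_cong) (auto simp: r_eq split: split_indicator)
  show "set_integrable M B (\<lambda>y. exit_rate q y t) \<longleftrightarrow> a < \<infinity>"
    "(LINT y:B|M. exit_rate q y t) = enn2real a"
    using nonneg_integral_eq[OF m1 p1] unfolding set_integrable_def set_lebesgue_integral_def e1 by auto
  have "(\<lambda>y. emeasure (Qs s y t) B) \<in> borel_measurable X"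
  proof -
    have 1: "(\<lambda>y. (y, t)) \<in> X \<rightarrow>\<^sub>M X \<Otimes>\<^sub>M borel" by measurable
    have 2: "(\<lambda>z. emeasure (case z of (x, w) \<Rightarrow> Qs s x w) B) \<in> borel_measurable (X \<Otimes>\<^sub>M borel)"
      using J.Q B unfolding finite_kernel_def by blast
    from measurable_compose[OF 1 2] show ?thesis by simp
  qed
  then have "(\<lambda>y. enn2real (emeasure (Qs s y t) B)) \<in> borel_measurable X" by measurable
  also have "?this \<longleftrightarrow> (\<lambda>y. q y t (B - {y})) \<in> borel_measurable X"
    using s B t by (intro measurable_cong) (simp add: emeasure_Qs q_off_nonneg time_dom_less)
  finally have m2: "(\<lambda>y. q y t (B - {y})) \<in> borel_measurable M" unfolding mX .
  have p2: "0 \<le> q y t (B - {y})" if "y \<in> space M" for y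
    using that sp t s B by (intro q_off_nonneg time_dom_less) auto
  have e2: "(\<integral>\<^sup>+y. ennreal (q y t (B - {y})) \<partial>M) = b"
    unfolding b_def using sp t s B by (intro nn_integral_cong) (simp add: emeasure_Qs)
  show "integrable M (\<lambda>y. q y t (B - {y})) \<longleftrightarrow> b < \<infinity>" "(LINT y|M. q y t (B - {y})) = enn2real b"
    using nonneg_integral_eq[OF m2 p2] unfolding e2 by auto
qed

lemma qs_bounded_rate:
  assumes "qs_bounded X T0 q (ereal s) B"
  obtains K where "0 \<le> K" "\<And>y w. y \<in> B \<Longrightarrow> J.r y w \<le> K"
proof -
  have B: "B \<in> sets X" using assms unfolding qs_bounded_def by simp
  obtain K where K: "\<And>y w. y \<in> B \<Longrightarrow> T0 \<le> w \<Longrightarrow> w < s \<Longrightarrow> \<bar>exit_rate q y w\<bar> \<le> K"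
    using assms unfolding qs_bounded_def bounded_iff by auto
  have "J.r y w \<le> max 0 K" if "y \<in> B" for y w
  proof (cases "T0 \<le> w \<and> w < s")
    case True
    then have "J.r y w = exit_rate q y w" using sets.sets_into_space[OF B] that by (intro r_eq) auto
    then show ?thesis using K[of y w] True that by auto
  qed (simp add: r_outside)
  then show thesis using that[of "max 0 K"] by simp
qed

lemma rate_integral_le:
  assumes "0 \<le> K" "\<And>y. y \<in> B \<Longrightarrow> J.r y w \<le> K" "B \<in> sets M"
  shows "(\<integral>\<^sup>+y. indicator B y * ennreal (J.r y w) \<partial>M) \<le> ennreal K * emeasure M B"
proof -
  have "(\<integral>\<^sup>+y. indicator B y * ennreal (J.r y w) \<partial>M) \<le> (\<integral>\<^sup>+y. ennreal K * indicator B y \<partial>M)"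
    using assms by (intro nn_integral_mono) (auto split: split_indicator intro: ennreal_leI)
  also have "\<dots> = ennreal K * emeasure M B" using assms(3) by (rule nn_integral_cmult_indicator)
  finally show ?thesis .
qed

lemma Pbar_forward:
  assumes u: "T0 \<le> u" "u < s" and x: "x \<in> space X" and B: "qs_bounded X T0 q (ereal s) B"
  shows "((\<lambda>t. Pbar X q u x t B) \<longlongrightarrow> indicator B x) (at_right u)"
    and "abs_continuous_on {u<..<s} (\<lambda>t. Pbar X q u x t B)"
    and "AE t in lborel. t \<in> {u<..<s} \<longrightarrow> forward_equation_at X q (Pbar X q) u x t B"
proof -
  have Bs[measurable]: "B \<in> sets X" using B unfolding qs_bounded_def by simp
  note [measurable] = J.Vm_kernel[OF x]
  obtain K where K: "0 \<le> K" "\<And>y w. y \<in> B \<Longrightarrow> J.r y w \<le> K" using qs_bounded_rate[OF B] by metis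
  define a where "a w = (\<integral>\<^sup>+y. indicator B y * ennreal (J.r y w) \<partial>J.Vm u x w)" for w
  define b where "b w = (\<integral>\<^sup>+y. emeasure (Qs s y w) B \<partial>J.Vm u x w)" for w
  have b': "b w = (\<integral>\<^sup>+y. (\<integral>\<^sup>+z. indicator B z \<partial>Qs s y w) \<partial>J.Vm u x w)" for w
    unfolding b_def using J.sets_Q by (intro nn_integral_cong) simp
  have am: "a \<in> borel_measurable borel" unfolding a_def by measurable
  have bm: "b \<in> borel_measurable borel" unfolding b' by measurable
  have int: "emeasure (J.Vm u x t) B + (\<integral>\<^sup>+w\<in>{u<..<t}. a w \<partial>lborel) = indicator B x + (\<integral>\<^sup>+w\<in>{u<..<t}. b w \<partial>lborel)" if "u < t" for t
    using J.Vm_integrated[OF x that, of "indicator B"] unfolding a_def b' by simp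
  have aK: "a w \<le> ennreal K" for w
  proof -
    have "a w \<le> ennreal K * emeasure (J.Vm u x w) B"
      unfolding a_def by (rule rate_integral_le[OF K(1)]) (use K(2) in auto)
    also have "\<dots> \<le> ennreal K * 1" using J.emeasure_Vm_le_1[OF x] by (intro mult_left_mono) auto
    finally show ?thesis by simp
  qed
  \<comment> \<open>The loss integral is finite because the rates on \<open>B\<close> are bounded;
    the integrated equation then bounds the gain. It is read off at time \<open>s\<close> itself,
    where it holds for the measure \<open>Vm\<close> built from the cut-off rates.\<close>
  have afin: "(\<integral>\<^sup>+w\<in>{u<..<s}. a w \<partial>lborel) < \<infinity>" by (rule nn_integral_interval_bounded[OF aK])
  have "(\<integral>\<^sup>+w\<in>{u<..<s}. b w \<partial>lborel) \<le> indicator B x + (\<integral>\<^sup>+w\<in>{u<..<s}. b w \<partial>lborel)" by (simp add: add_increasing)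
  also have "\<dots> = emeasure (J.Vm u x s) B + (\<integral>\<^sup>+w\<in>{u<..<s}. a w \<partial>lborel)" by (rule int[OF u(2), symmetric])
  also have "\<dots> < \<infinity>" using afin le_less_trans[OF J.emeasure_Vm_le_1[OF x, of u s B] ennreal_one_less_top] by simp
  finally have bfin: "(\<integral>\<^sup>+w\<in>{u<..<s}. b w \<partial>lborel) < \<infinity>" .
  have eq: "ennreal (Pbar X q u x t B) + (\<integral>\<^sup>+w\<in>{u<..<t}. a w \<partial>lborel) =
     ennreal (indicator B x) + (\<integral>\<^sup>+w\<in>{u<..<t}. b w \<partial>lborel)" if "t \<in> {u<..<s}" for t
    using int[of t] that x u(1) by (simp add: ennreal_Pbar ennreal_indicator)
  note D = integrated_imp_derivative[OF u(2) am bm afin bfin _ _ eq]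
  show "abs_continuous_on {u<..<s} (\<lambda>t. Pbar X q u x t B)"
    by (rule D(1)) (simp_all add: Pbar_def)
  show "((\<lambda>t. Pbar X q u x t B) \<longlongrightarrow> indicator B x) (at_right u)"
    by (rule D(2)) (simp_all add: Pbar_def)
  have "AE t in lborel. t \<in> {u<..<s} \<longrightarrow> a t < \<infinity> \<and> b t < \<infinity> \<and>
      ((\<lambda>t. Pbar X q u x t B) has_real_derivative - enn2real (a t) + enn2real (b t)) (at t)"
    by (rule D(3)) (simp_all add: Pbar_def)
  then show "AE t in lborel. t \<in> {u<..<s} \<longrightarrow> forward_equation_at X q (Pbar X q) u x t B"
  proof eventually_elim
    case (elim t)
    show ?case
    proof
      assume t: "t \<in> {u<..<s}"
      then have tt: "T0 \<le> t" "t < s" using u by auto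
      note F = forward_terms[OF J.sets_Vm[of u x t] tt Bs, folded a_def b_def]
      show "forward_equation_at X q (Pbar X q) u x t B"
        unfolding forward_equation_at_def to_measure_Pbar[OF x u(1) tt(2)] F using elim t by blast
    qed
  qed
qed

text \<open>For fixed \<open>u\<close> and \<open>x\<close> the competitor satisfies the integrated
  equation on the measurable subsets of the exhausting sets \<open>C n\<close>, whose rates up to
  \<open>s\<close> are bounded. This yields the last-jump equation on the same sets, as
  \<open>Vm_minimal\<close> requires.\<close>

lemma Pbar_le:
  assumes P: "P \<in> P_hat X T0 T1" "initial_and_ac X T0 T1 q P" "forward_equation X T0 T1 q P"
    and u: "T0 \<le> u" "u < t" "t < s" and x: "x \<in> space X" and B: "B \<in> sets X"
  shows "Pbar X q u x t B \<le> P u x t B"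
proof -
  have us: "u < s" using u by simp
  have ud: "u \<in> time_dom T0 T1" using time_dom_less[OF us u(1) s(2)] .
  have wd: "ereal w < T1" if "w < s" for w using that s(2) less_trans[of "ereal w" "ereal s" T1] by simp
  have ms: "measure_space (space X) (sets X) (\<lambda>B. ennreal (P u x w B))" if "u < w" "w < s" for w
    using P(1) ud x that wd[OF that(2)] unfolding P_hat_def by blast
  have P0: "0 \<le> P u x w B" if "u < w" "w < s" "B \<in> sets X" for w B
    using P(1) ud x that wd[OF that(2)] unfolding P_hat_def trans_dom_def by blast
  \<comment> \<open>Zero outside \<open>]u, s[\<close>, so that the family becomes a finite kernel
    on the whole line.\<close>
  define \<mu> where "\<mu> w = (if u < w \<and> w < s then to_measure X (P u x w) else null_measure X)" for w
  have em: "emeasure (\<mu> w) B = (if u < w \<and> w < s then ennreal (P u x w B) else 0)" if "B \<in> sets X" for w B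
    unfolding \<mu>_def using emeasure_to_measure[OF ms that] by simp
  have s\<mu>: "sets (\<mu> w) = sets X" "space (\<mu> w) = space X" for w unfolding \<mu>_def by simp_all
  have \<mu>: "finite_kernel borel X \<mu>"
    unfolding finite_kernel_def
  proof (intro conjI ballI)
    show "sets (\<mu> w) = sets X" for w by (rule s\<mu>)
    show "finite_measure (\<mu> w)" for w
      by (rule finite_measureI) (simp add: s\<mu> em)
    fix B assume B: "B \<in> sets X"
    let ?T = "{t. u < t \<and> ereal t < T1}"
    have "(\<lambda>t. P u x t B) \<in> borel_measurable (restrict_space borel ?T)"
      using P(1) ud x B unfolding P_hat_def by blast
    \<comment> \<open>The midpoint is merely some admissible time at which the discarded values are
      taken.\<close>
    moreover have "(\<lambda>w. if u < w \<and> w < s then w else (u + s) / 2) \<in> borel \<rightarrow>\<^sub>M restrict_space borel ?T"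
      using us wd by (intro measurable_restrict_space2) auto
    ultimately have [measurable]: "(\<lambda>w. P u x (if u < w \<and> w < s then w else (u + s) / 2) B) \<in> borel_measurable borel"
      by (auto dest: measurable_compose[rotated])
    have "(\<lambda>w. if u < w \<and> w < s then ennreal (P u x (if u < w \<and> w < s then w else (u + s) / 2) B) else 0) \<in> borel_measurable borel"
      by measurable
    also have "(\<lambda>w. if u < w \<and> w < s then ennreal (P u x (if u < w \<and> w < s then w else (u + s) / 2) B) else 0) = (\<lambda>w. emeasure (\<mu> w) B)"
      using em[OF B] by (auto simp: fun_eq_iff)
    finally show "(\<lambda>w. emeasure (\<mu> w) B) \<in> borel_measurable borel" .
  qed
  note [measurable] = \<mu>
  obtain C :: "nat \<Rightarrow> 'a set" where C: "\<And>n. C n \<in> sets X" "(\<Union>n. C n) = space X"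
    and Cr: "\<And>n x t. x \<in> C n \<Longrightarrow> J.r x t \<le> real n"
  proof -
    have m: "(\<lambda>z. J.r (fst z) (snd z)) \<in> borel_measurable (X \<Otimes>\<^sub>M borel)" by measurable
    show thesis
    proof (rule bounded_exhaustion[OF X m])
      show "\<exists>K. \<forall>t. J.r (fst (x, t)) (snd (x, t)) \<le> K" if "x \<in> space X" for x
        using J.r_bounded[OF that] by simp
      fix B :: "nat \<Rightarrow> 'a set"
      assume "\<And>n. B n \<in> sets X" "(\<Union>n. B n) = space X"
        "\<And>n x t. x \<in> B n \<Longrightarrow> J.r (fst (x, t)) (snd (x, t)) \<le> real n"
      then show thesis by (intro that[of B]) auto
    qed
  qed
  have bounded: "qs_bounded X T0 q (ereal s) A" if "A \<in> sets X" "A \<subseteq> C n" for A n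
    unfolding qs_bounded_def bounded_iff
  proof (intro conjI exI[of _ "real n"] ballI that(1))
    fix z assume "z \<in> (\<lambda>(x, t). exit_rate q x t) ` (A \<times> {t. T0 \<le> t \<and> ereal t < ereal s})"
    then obtain y w where yw: "z = exit_rate q y w" "y \<in> A" "T0 \<le> w" "w < s" by auto
    then have "z = J.r y w" using sets.sets_into_space[OF that(1)] by (subst r_eq) auto
    then show "norm z \<le> real n" using Cr[of y n w] yw that(2) J.r_nonneg[of y w] by auto
  qed
  have main: "emeasure (\<mu> v) A + (\<integral>\<^sup>+w\<in>{u<..<v}. (\<integral>\<^sup>+y. indicator A y * ennreal (J.r y w) \<partial>\<mu> w) \<partial>lborel) =
      indicator A x + (\<integral>\<^sup>+w\<in>{u<..<v}. (\<integral>\<^sup>+y. emeasure (Qs s y w) A \<partial>\<mu> w) \<partial>lborel)"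
    and fin: "(\<integral>\<^sup>+w\<in>{u<..<v}. (\<integral>\<^sup>+y. indicator A y * ennreal (J.r y w) \<partial>\<mu> w) \<partial>lborel) < \<infinity>"
    if A: "A \<in> sets X" "A \<subseteq> C n" and v: "u < v" "v < s" for A n v
  proof -
    note bA = bounded[OF A]
    note [measurable] = A(1)
    define a where "a w = (\<integral>\<^sup>+y. indicator A y * ennreal (J.r y w) \<partial>\<mu> w)" for w
    define b where "b w = (\<integral>\<^sup>+y. emeasure (Qs s y w) A \<partial>\<mu> w)" for w
    have b': "b w = (\<integral>\<^sup>+y. (\<integral>\<^sup>+z. indicator A z \<partial>Qs s y w) \<partial>\<mu> w)" for w
      unfolding b_def using J.sets_Q A(1) s\<mu> by (intro nn_integral_cong) simp
    have am: "a \<in> borel_measurable borel" unfolding a_def by measurable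
    have bm: "b \<in> borel_measurable borel" unfolding b' by measurable
    have ac: "abs_continuous_on {u<..<s} (\<lambda>t. P u x t A)"
      and lim: "((\<lambda>t. P u x t A) \<longlongrightarrow> indicator A x) (at_right u)"
      using P(2) ud us s(2) x bA unfolding initial_and_ac_def by blast+
    obtain M where M: "\<And>t. t \<in> {u<..<s} \<Longrightarrow> \<bar>P u x t A\<bar> \<le> M" using abs_continuous_on_bounded[OF ac] by blast
    \<comment> \<open>The bound is uniform in time: the rates on \<open>A\<close> are at most
      \<open>n\<close>, and absolute continuity bounds the mass of \<open>A\<close>.\<close>
    have aM: "a w \<le> ennreal (real n * max 0 M)" for w
    proof -
      have "a w \<le> ennreal (real n) * emeasure (\<mu> w) A"
        unfolding a_def by (rule rate_integral_le) (use Cr A s\<mu> in auto)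
      also have "emeasure (\<mu> w) A \<le> ennreal (max 0 M)"
        unfolding em[OF A(1)] using M[of w] by (auto intro!: ennreal_leI)
      finally show ?thesis by (simp add: ennreal_mult mult_left_mono)
    qed
    show "(\<integral>\<^sup>+w\<in>{u<..<v}. (\<integral>\<^sup>+y. indicator A y * ennreal (J.r y w) \<partial>\<mu> w) \<partial>lborel) < \<infinity>"
      unfolding a_def[symmetric] by (rule nn_integral_interval_bounded[OF aM])
    have "AE t in lborel. t \<in> {u<..<s} \<longrightarrow> forward_equation_at X q P u x t A"
      using P(3) ud us s(2) x bA unfolding forward_equation_def by blast
    then have der: "AE t in lborel. t \<in> {u<..<s} \<longrightarrow> b t < \<infinity> \<and>
        ((\<lambda>t. P u x t A) has_real_derivative - enn2real (a t) + enn2real (b t)) (at t)"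
    proof eventually_elim
      case (elim t)
      show ?case
      proof
        assume t: "t \<in> {u<..<s}"
        then have tt: "T0 \<le> t" "t < s" and mt: "to_measure X (P u x t) = \<mu> t" using u unfolding \<mu>_def by auto
        note F = forward_terms[OF s\<mu>(1) tt A(1), of t, folded a_def b_def]
        show "b t < \<infinity> \<and> ((\<lambda>t. P u x t A) has_real_derivative - enn2real (a t) + enn2real (b t)) (at t)"
          using elim t unfolding forward_equation_at_def mt F by blast
      qed
    qed
    have "ennreal (P u x v A) + (\<integral>\<^sup>+w\<in>{u<..<v}. a w \<partial>lborel) = ennreal (indicator A x) + (\<integral>\<^sup>+w\<in>{u<..<v}. b w \<partial>lborel)"
      by (rule derivative_imp_integrated[OF ac lim am bm aM der]) (use v P0 A(1) in auto)
    then show "emeasure (\<mu> v) A + (\<integral>\<^sup>+w\<in>{u<..<v}. (\<integral>\<^sup>+y. indicator A y * ennreal (J.r y w) \<partial>\<mu> w) \<partial>lborel) =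
      indicator A x + (\<integral>\<^sup>+w\<in>{u<..<v}. (\<integral>\<^sup>+y. emeasure (Qs s y w) A \<partial>\<mu> w) \<partial>lborel)"
      unfolding a_def b_def using em[OF A(1)] v by (simp add: ennreal_indicator)
  qed
  have mild: "emeasure (\<mu> v) A = indicator A x * ennreal (J.S x u v) +
        (\<integral>\<^sup>+w\<in>{u<..<v}. (\<integral>\<^sup>+y. J.G v w (indicator A) y \<partial>\<mu> w) \<partial>lborel)"
    if v: "u < v" "v < s" and A: "A \<in> sets X" "A \<subseteq> C n" for v A n
  proof (rule J.integrated_imp_mild[OF \<mu> x v(1) A(1) _ fin[OF A v]])
    fix v' and f :: "'a \<Rightarrow> ennreal" assume v': "u < v'" "v' \<le> v" and f: "f \<in> borel_measurable X" "\<And>y. y \<notin> A \<Longrightarrow> f y = 0"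
    show "(\<integral>\<^sup>+y. f y \<partial>\<mu> v') + (\<integral>\<^sup>+w\<in>{u<..<v'}. (\<integral>\<^sup>+y. f y * ennreal (J.r y w) \<partial>\<mu> w) \<partial>lborel) =
      f x + (\<integral>\<^sup>+w\<in>{u<..<v'}. (\<integral>\<^sup>+y. (\<integral>\<^sup>+z. f z \<partial>Qs s y w) \<partial>\<mu> w) \<partial>lborel)"
    \<comment> \<open>Subsets of \<open>A\<close> again lie in \<open>C n\<close>, so the equation
      is at hand for all functions vanishing off \<open>A\<close>.\<close>
    proof (rule J.integrated_extend[OF \<mu> x A(1) _ f])
      fix A' assume A': "A' \<in> sets X" "A' \<subseteq> A"
      show "emeasure (\<mu> v') A' + (\<integral>\<^sup>+w\<in>{u<..<v'}. (\<integral>\<^sup>+y. indicator A' y * ennreal (J.r y w) \<partial>\<mu> w) \<partial>lborel) =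
        indicator A' x + (\<integral>\<^sup>+w\<in>{u<..<v'}. (\<integral>\<^sup>+y. emeasure (Qs s y w) A' \<partial>\<mu> w) \<partial>lborel)"
        by (rule main[OF A'(1) order_trans[OF A'(2) A(2)]]) (use v v' in auto)
    qed
  qed
  have "emeasure (J.Vm u x t) B \<le> emeasure (\<mu> t) B"
    by (rule J.Vm_minimal[OF \<mu> x C(1) C(2) mild u(2,3) B])
  then have "ennreal (Pbar X q u x t B) \<le> ennreal (P u x t B)"
    using em[OF B, of t] u ennreal_Pbar[OF x u(1,3) B] by simp
  then show ?thesis using P0[OF u(2,3) B] by simp
qed

end

section \<open>From horizons to the whole time interval\<close>

lemma horizon:
  assumes "T0 \<le> u" "u < t" "ereal t < T1"
  obtains s where "T0 < s" "t < s" "ereal s < T1"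
  using real_between_ereal[OF assms(3)] assms(1,2) by (metis le_less_trans less_trans)

lemma Pbar_series_finite:
  assumes "(u, x, t, B) \<in> trans_dom X T0 T1"
  shows "Pbar_series X q u x t B < \<infinity>"
proof -
  have d: "T0 \<le> u" "u < t" "ereal t < T1" "x \<in> space X" "B \<in> sets X"
    using assms unfolding trans_dom_def time_dom_def by auto
  obtain s where s: "T0 < s" "t < s" "ereal s < T1" using horizon[OF d(1-3)] .
  interpret J: jump_rates X "Qs s" by (rule jump_rates_Qs[OF s(1,3)])
  have "Pbar_series X q u x t B \<le> 1"
    unfolding Pbar_series_eq[OF s(1,3) d(4,1) s(2) d(5)] by (rule J.emeasure_Vm_le_1[OF d(4)])
  then show ?thesis using le_less_trans[OF _ ennreal_one_less_top] by simp
qed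

lemma Pbar_measure_space:
  assumes u: "T0 \<le> u" "u < t" "ereal t < T1" and x: "x \<in> space X"
  shows "measure_space (space X) (sets X) (\<lambda>B. ennreal (Pbar X q u x t B))"
    and "B \<in> sets X \<Longrightarrow> Pbar X q u x t B \<le> 1"
proof -
  obtain s where s: "T0 < s" "t < s" "ereal s < T1" using horizon[OF u] .
  interpret J: jump_rates X "Qs s" by (rule jump_rates_Qs[OF s(1,3)])
  note E = ennreal_Pbar[OF s(1,3) x u(1) s(2)]
  show "measure_space (space X) (sets X) (\<lambda>B. ennreal (Pbar X q u x t B))"
    unfolding measure_space_def
  proof (intro conjI)
    show "sigma_algebra (space X) (sets X)" by (rule sets.sigma_algebra_axioms)
    show "positive (sets X) (\<lambda>B. ennreal (Pbar X q u x t B))"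
      unfolding positive_def using E[of "{}"] by simp
    show "countably_additive (sets X) (\<lambda>B. ennreal (Pbar X q u x t B))"
      unfolding countably_additive_def
    proof (intro allI impI)
      fix A :: "nat \<Rightarrow> 'a set" assume A: "range A \<subseteq> sets X" "disjoint_family A" "\<Union> (range A) \<in> sets X"
      have "A i \<in> sets X" for i using A(1) by auto
      then show "(\<Sum>i. ennreal (Pbar X q u x t (A i))) = ennreal (Pbar X q u x t (\<Union> (range A)))"
        using A suminf_emeasure[of A "J.Vm u x t"] by (simp add: E)
    qed
  qed
  show "Pbar X q u x t B \<le> 1" if "B \<in> sets X"
    using J.emeasure_Vm_le_1[OF x, of u t B] unfolding E[OF that, symmetric]
    by (simp add: ennreal_le_1)
qed

text \<open>Measurability in \<open>t\<close> is known below each horizon. Rational horizons exhaust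
  the times below \<open>T1\<close>, so countably many measurable pieces are glued.\<close>

lemma Pbar_in_P_hat: "Pbar X q \<in> P_hat X T0 T1"
  unfolding P_hat_def
proof (intro CollectI conjI)
  show "\<forall>(u, x, t, B)\<in>trans_dom X T0 T1. 0 \<le> Pbar X q u x t B" by (auto simp: Pbar_def)
  show "\<forall>u\<in>time_dom T0 T1. \<forall>x\<in>space X. \<forall>t. u < t \<and> ereal t < T1 \<longrightarrow>
       measure_space (space X) (sets X) (\<lambda>B. ennreal (Pbar X q u x t B))"
    using Pbar_measure_space(1) unfolding time_dom_def by blast
  show "\<forall>u\<in>time_dom T0 T1. \<forall>x\<in>space X. \<forall>B\<in>sets X.
       (\<lambda>t. Pbar X q u x t B) \<in> borel_measurable (restrict_space borel {t. u < t \<and> ereal t < T1})"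
  proof (intro ballI)
    fix u x B assume u: "u \<in> time_dom T0 T1" and x: "x \<in> space X" and B: "B \<in> sets X"
    have u0: "T0 \<le> u" using u unfolding time_dom_def by simp
    let ?M = "restrict_space borel {t. u < t \<and> ereal t < T1} :: real measure"
    define \<C> where "\<C> = {{u<..<s} |s. s \<in> \<rat> \<and> u < s \<and> ereal s < T1}"
    show "(\<lambda>t. Pbar X q u x t B) \<in> borel_measurable ?M"
    proof (rule measurable_piecewise_restrict[of \<C>])
      have "\<C> = (\<lambda>s. {u<..<s}) ` {s \<in> \<rat>. u < s \<and> ereal s < T1}" unfolding \<C>_def by blast
      then show "countable \<C>" using countable_rat by (auto intro!: countable_image intro: countable_subset)
      show "space ?M \<subseteq> \<Union>\<C>"
      proof
        fix t assume "t \<in> space ?M"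
        then have t: "u < t" "ereal t < T1" by (auto simp: space_restrict_space)
        obtain s where s: "t < s" "ereal s < T1" using real_between_ereal[OF t(2)] .
        obtain r where r: "r \<in> \<rat>" "t < r" "r < s" using Rats_dense_in_real[OF s(1)] by blast
        then have "ereal r < T1" using s(2) less_trans[of "ereal r" "ereal s" T1] by simp
        then show "t \<in> \<Union>\<C>" unfolding \<C>_def using r t by force
      qed
      fix \<Omega> assume "\<Omega> \<in> \<C>"
      then obtain s where \<Omega>: "\<Omega> = {u<..<s}" and s: "u < s" "ereal s < T1" unfolding \<C>_def by blast
      have T0s: "T0 < s" using u0 s by simp
      interpret J: jump_rates X "Qs s" by (rule jump_rates_Qs[OF T0s s(2)])
      have sub: "\<Omega> \<subseteq> {t. u < t \<and> ereal t < T1}"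
        unfolding \<Omega> using s(2) less_trans[of "ereal _" "ereal s" T1] by auto
      then have "\<Omega> \<inter> space ?M = \<Omega>" by (auto simp: space_restrict_space)
      moreover have "\<Omega> \<in> sets ?M" using sub unfolding \<Omega> sets_restrict_space by (auto intro!: image_eqI[of _ _ "{u<..<s}"])
      ultimately show "\<Omega> \<inter> space ?M \<in> sets ?M" by simp
      have "(\<lambda>t. emeasure (J.Vm u x t) B) \<in> borel_measurable borel"
        using J.Vm_kernel[OF x, of u] B unfolding finite_kernel_def by blast
      then have "(\<lambda>t. enn2real (emeasure (J.Vm u x t) B)) \<in> borel_measurable borel"
        by measurable
      then have "(\<lambda>t. enn2real (emeasure (J.Vm u x t) B)) \<in> borel_measurable (restrict_space ?M \<Omega>)"
        by (intro measurable_restrict_space1)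
      also have "?this \<longleftrightarrow> (\<lambda>t. Pbar X q u x t B) \<in> borel_measurable (restrict_space ?M \<Omega>)"
      proof (rule measurable_cong)
        fix t assume "t \<in> space (restrict_space ?M \<Omega>)"
        then have t: "t < s" unfolding \<Omega> by (auto simp: space_restrict_space)
        show "enn2real (emeasure (J.Vm u x t) B) = Pbar X q u x t B"
          unfolding Pbar_def Pbar_series_eq[OF T0s s(2) x u0 t B] ..
      qed
      finally show "(\<lambda>t. Pbar X q u x t B) \<in> borel_measurable (restrict_space ?M \<Omega>)" .
    qed
  qed
qed

lemma Pbar_initial_and_ac: "initial_and_ac X T0 T1 q (Pbar X q)"
  and Pbar_forward_equation: "forward_equation X T0 T1 q (Pbar X q)"
proof -
  have T0s: "T0 < s" if "u \<in> time_dom T0 T1" "u < s" for u s :: real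
    using that unfolding time_dom_def by simp
  have T0u: "T0 \<le> u" if "u \<in> time_dom T0 T1" for u
    using that unfolding time_dom_def by simp
  show "initial_and_ac X T0 T1 q (Pbar X q)"
    unfolding initial_and_ac_def using Pbar_forward(1,2)[OF T0s _ T0u] by blast
  show "forward_equation X T0 T1 q (Pbar X q)"
    unfolding forward_equation_def using Pbar_forward(3)[OF T0s _ T0u] by blast
qed

lemma Pbar_minimal:
  assumes P: "P \<in> P_hat X T0 T1" "initial_and_ac X T0 T1 q P" "forward_equation X T0 T1 q P"
    and d: "(u, x, t, B) \<in> trans_dom X T0 T1"
  shows "Pbar X q u x t B \<le> P u x t B"
proof -
  have d: "T0 \<le> u" "u < t" "ereal t < T1" "x \<in> space X" "B \<in> sets X"
    using d unfolding trans_dom_def time_dom_def by auto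
  obtain s where s: "T0 < s" "t < s" "ereal s < T1" using horizon[OF d(1-3)] .
  show ?thesis by (rule Pbar_le[OF s(1,3) P d(1,2) s(2) d(4,5)])
qed

text \<open>P-bar already has the total mass 1 that \<open>P\<close> cannot exceed, so neither of
  the inequalities on \<open>B\<close> and on its complement can be strict.\<close>

lemma Pbar_unique:
  assumes reg: "regular X T0 T1 (Pbar X q)"
    and P: "P \<in> P_hat X T0 T1" "initial_and_ac X T0 T1 q P" "forward_equation X T0 T1 q P"
    and P1: "\<forall>(u, x, t, B)\<in>trans_dom X T0 T1. P u x t B \<in> {0..1}"
    and d: "(u, x, t, B) \<in> trans_dom X T0 T1"
  shows "P u x t B = Pbar X q u x t B"
proof -
  have u: "u \<in> time_dom T0 T1" "T0 \<le> u" "u < t" "ereal t < T1" "x \<in> space X" and B: "B \<in> sets X"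
    using d unfolding trans_dom_def time_dom_def by auto
  have dom: "(u, x, t, A) \<in> trans_dom X T0 T1" if "A \<in> sets X" for A
    using d that unfolding trans_dom_def by simp
  have compl: "R B + R (space X - B) = R (space X)"
    if ms: "measure_space (space X) (sets X) (\<lambda>B. ennreal (R B))" and R0: "\<And>B. B \<in> sets X \<Longrightarrow> 0 \<le> R B" for R
  proof -
    have "emeasure (to_measure X R) B + emeasure (to_measure X R) (space X - B) = emeasure (to_measure X R) (B \<union> (space X - B))"
      using B by (intro plus_emeasure) auto
    also have "B \<union> (space X - B) = space X" using sets.sets_into_space[OF B] by blast
    finally have "ennreal (R B) + ennreal (R (space X - B)) = ennreal (R (space X))"
      using B by (simp add: emeasure_to_measure[OF ms])
    then show ?thesis using B R0 by (simp flip: ennreal_plus)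
  qed
  have "measure_space (space X) (sets X) (\<lambda>B. ennreal (P u x t B))"
    using P(1) u unfolding P_hat_def by blast
  from compl[OF this] have "P u x t B + P u x t (space X - B) = P u x t (space X)"
    using P1 dom by force
  moreover have "Pbar X q u x t B + Pbar X q u x t (space X - B) = Pbar X q u x t (space X)"
    by (rule compl[OF Pbar_measure_space(1)[OF u(2-5)]]) (simp add: Pbar_def)
  moreover have "P u x t (space X) \<le> 1" using P1 dom[of "space X"] by force
  moreover have "Pbar X q u x t (space X) = 1" using reg u unfolding regular_def by blast
  moreover have "Pbar X q u x t (space X - B) \<le> P u x t (space X - B)"
    by (rule Pbar_minimal[OF P dom]) (use B in auto)
  moreover have "Pbar X q u x t B \<le> P u x t B" by (rule Pbar_minimal[OF P d])
  ultimately show ?thesis by linarith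
qed

end

theorem theorem3:
  fixes X :: "'a measure" and T0 :: real and T1 :: ereal
    and q :: "'a \<Rightarrow> real \<Rightarrow> 'a set \<Rightarrow> real"
  assumes "standard_borel X"
    and "0 \<le> T0" and "ereal T0 < T1"
    and "Q_function X T0 T1 q"
    and "conservative X T0 T1 q"
    and "\<forall>s. T0 < s \<and> ereal s < T1 \<longrightarrow>
           (\<forall>x\<in>space X. bdd_above ((\<lambda>t. exit_rate q x t) ` {T0..<s}))"
  shows "(\<forall>(u, x, t, B)\<in>trans_dom X T0 T1. Pbar_series X q u x t B < \<infinity>) \<and>
    minimal_in X T0 T1
      {P \<in> P_hat X T0 T1. initial_and_ac X T0 T1 q P \<and> forward_equation X T0 T1 q P}
      (Pbar X q) \<and>
    (regular X T0 T1 (Pbar X q) \<longrightarrow>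
      unique_in X T0 T1
        {P \<in> P_hat X T0 T1. initial_and_ac X T0 T1 q P \<and> forward_equation X T0 T1 q P \<and>
           (\<forall>(u, x, t, B)\<in>trans_dom X T0 T1. P u x t B \<in> {0..1})}
        (Pbar X q))"
proof -
  interpret Q_bounded X T0 T1 q
    by unfold_locales (use assms in auto)
  have "\<forall>(u, x, t, B)\<in>trans_dom X T0 T1. Pbar_series X q u x t B < \<infinity>"
    using Pbar_series_finite by blast
  moreover have "minimal_in X T0 T1
      {P \<in> P_hat X T0 T1. initial_and_ac X T0 T1 q P \<and> forward_equation X T0 T1 q P} (Pbar X q)"
    unfolding minimal_in_def
    using Pbar_in_P_hat Pbar_initial_and_ac Pbar_forward_equation Pbar_minimal by blast
  moreover have "unique_in X T0 T1
        {P \<in> P_hat X T0 T1. initial_and_ac X T0 T1 q P \<and> forward_equation X T0 T1 q P \<and>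
           (\<forall>(u, x, t, B)\<in>trans_dom X T0 T1. P u x t B \<in> {0..1})} (Pbar X q)"
    if reg: "regular X T0 T1 (Pbar X q)"
  proof -
    have "\<forall>(u, x, t, B)\<in>trans_dom X T0 T1. Pbar X q u x t B \<in> {0..1}"
      using Pbar_measure_space(2) by (auto simp: trans_dom_def time_dom_def Pbar_def)
    then show ?thesis
      unfolding unique_in_def
      using Pbar_in_P_hat Pbar_initial_and_ac Pbar_forward_equation Pbar_unique[OF reg] by blast
  qed
  ultimately show ?thesis by blast
qed

end
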